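(* Let $k\ge3$ be a fixed integer. As $x\to\infty$, $$\sum_{n\le x}\mu(n)\omega(n)^k\left\{\frac{x}{n}\right\}\ll_k\frac{x(\log\log x)^{\frac{2k-1}{2}}}{\log x}.$$
   Context: $\mu$ is the Möbius function, $\omega(n)$ the number of distinct prime factors of $n$, and $\{w\}=w-\lfloor w\rfloor$ is the fractional part of $w$. $\ll_k$ means the implied constant may depend on $k$. *)

theory Defs
  imports
    "HOL-Analysis.Analysis"
    "HOL-Library.Landau_Symbols"
    "HOL-Computational_Algebra.Squarefree"
begin

definition prime_omega :: "nat \<Rightarrow> nat" where
  "prime_omega n = card (prime_factors n)"

(* For squarefree n the number of prime factors is prime_omega n.
   In HOL, 0 is not squarefree, so moebius_mu 0 = 0. *)
definition moebius_mu :: "nat \<Rightarrow> int" where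
  "moebius_mu n = (if squarefree n then (-1) ^ prime_omega n else 0)"

end

theory Submission
  imports Defs "HOL-Probability.Probability" "HOL-Complex_Analysis.Complex_Analysis"
begin

text \<open>
  Put \<open>h m = (\<Sum>d | d dvd m. \<mu> d * \<omega> d ^ k)\<close> and \<open>M x = (\<Sum>n\<le>x. \<mu> n / n)\<close>. Moebius inversion turns the
  sum into \<open>\<Sum>m\<le>x. h m * (x / m * M (x / m) - 1)\<close>. Here \<open>h m\<close> is the alternating sum of
  \<open>card S ^ k\<close> over the sets \<open>S\<close> of prime factors of \<open>m\<close>, a \<open>k\<close>-th power hit by an \<open>\<omega> m\<close>-fold
  difference, so it vanishes unless \<open>1 \<le> \<omega> m \<le> k\<close>. By Chebyshev and the Hardy-Ramanujan induction
  there are \<open>O (x (ln ln x) ^ (k - 1) / ln x)\<close> such \<open>m \<le> x\<close>, and \<open>M x = O ((ln x) ^ (-2))\<close> makes the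
  weights \<open>x / m * M (x / m)\<close> summable over dyadic ranges of \<open>x / m\<close>.

  The bound on \<open>M\<close> involves no contour shift. The Laplace transform of \<open>u \<mapsto> M (exp u)\<close> is
  \<open>1 / (s \<zeta> (1 + s))\<close>. A 3-4-1 inequality with constants gives a lower bound for \<open>\<zeta>\<close> to the right of
  the line 1 which, together with the Lipschitz bound there, persists in discs of radius
  \<open>const * (1 + \<bar>t\<bar>) powr (-1/4)\<close>; Cauchy's inequality then bounds the eighth derivative of the
  transform by \<open>const * (1 + \<bar>t\<bar>) ^ 2\<close>. That derivative is the transform of \<open>u ^ 8 * M (exp u)\<close>, which
  is averaged against a Gaussian of width \<open>v powr (-2)\<close> around \<open>v\<close>; \<open>M (exp u)\<close> is nearly Lipschitz in
  \<open>u\<close>, so the average is close to the value at \<open>v\<close>.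
\<close>

section \<open>Laplace transforms\<close>

text \<open>The weights \<open>x / m * M (x / m)\<close> dictate how much decay of \<open>M\<close>
  is needed. The relevant \<open>m\<close> with \<open>x / m\<close> near \<open>2 ^ i\<close>
  number at most about \<open>x / 2 ^ i\<close> times a factor independent of \<open>i\<close>, so
  after weighting the range \<open>i\<close> contributes in proportion to the size of
  \<open>M\<close> at \<open>2 ^ i\<close>. The trivial bound for \<open>M\<close>, and even a
  saving of one logarithm, would leave a sum over \<open>i\<close> that grows with \<open>x\<close>;
  a saving of two logarithms leaves a convergent one.

  The outcome has exponent \<open>k - 1\<close> of \<open>ln (ln x)\<close>, which is smaller than
  the exponent \<open>k - 1/2\<close> of the claim.\<close>

lemma integrable_exp_atLeast:
  fixes a c :: real assumes "c > 0"
  shows "integrable lborel (\<lambda>u. indicator {a..} u * exp (- c * u))"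
    and "(\<integral>u. indicator {a..} u * exp (- c * u) \<partial>lborel) = exp (- c * a) / c"
proof -
  have "((\<lambda>x. - exp (- c * x) / c) \<longlongrightarrow> 0) at_top"
    using assms by real_asymp
  hence *: "(\<integral>\<^sup>+u. ennreal (exp (- c * u)) * indicator {a..} u \<partial>lborel) = ennreal (0 - (- exp (- c * a) / c))"
    using assms by (intro nn_integral_FTC_atLeast) (auto intro!: derivative_eq_intros)
  have "(\<integral>\<^sup>+u. ennreal (indicator {a..} u * exp (- c * u)) \<partial>lborel) = (\<integral>\<^sup>+u. ennreal (exp (- c * u)) * indicator {a..} u \<partial>lborel)"
    by (intro nn_integral_cong) (auto simp: indicator_def)
  with * have **: "(\<integral>\<^sup>+u. ennreal (indicator {a..} u * exp (- c * u)) \<partial>lborel) = ennreal (exp (- c * a) / c)"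
    by simp
  show "integrable lborel (\<lambda>u. indicator {a..} u * exp (- c * u))"
    by (rule integrableI_nonneg) (auto simp: **[simplified])
  show "(\<integral>u. indicator {a..} u * exp (- c * u) \<partial>lborel) = exp (- c * a) / c"
    by (subst integral_eq_nn_integral) (use assms **[simplified] in auto)
qed

lemma integrable_cexp_atLeast:
  fixes a :: real and s :: complex assumes "Re s > 0"
  shows "integrable lborel (\<lambda>u. indicator {a..} u * exp (- s * of_real u))"
    and "(\<integral>u. indicator {a..} u * exp (- s * of_real u) \<partial>lborel) = exp (- s * a) / s"
proof -
  show int: "integrable lborel (\<lambda>u. indicator {a..} u * exp (- s * of_real u))"
    by (rule Bochner_Integration.integrable_bound[OF integrable_exp_atLeast(1)[OF assms, of a]])
       (auto simp: norm_mult indicator_def)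
  have nz: "s \<noteq> 0" using assms by auto
  have lim: "((\<lambda>x. - exp (- s * of_real x) / s) \<longlongrightarrow> 0) at_top"
  proof (rule tendsto_norm_zero_cancel)
    have "((\<lambda>x. exp (- Re s * x) / norm s) \<longlongrightarrow> 0) at_top"
      using assms nz by real_asymp
    thus "((\<lambda>x. norm (- exp (- s * of_real x) / s)) \<longlongrightarrow> 0) at_top"
      by (simp add: norm_divide)
  qed
  have "(LBINT x=ereal a..\<infinity>. exp (- s * of_real x)) = 0 - (- exp (- s * of_real a) / s)"
  proof (rule interval_integral_FTC_integrable[where F = "\<lambda>x. - exp (- s * of_real x) / s"])
    fix x assume "ereal a < ereal x"
    show "((\<lambda>x. - exp (- s * of_real x) / s) has_vector_derivative exp (- s * of_real x)) (at x)"
      using nz by (auto intro!: derivative_eq_intros has_vector_derivative_real_field simp: field_simps)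
  next
    have "set_integrable lborel {a<..} (\<lambda>x. exp (- s * of_real x))"
      unfolding set_integrable_def
      by (rule Bochner_Integration.integrable_bound[OF int]) (auto simp: indicator_def)
    thus "set_integrable lborel (einterval (ereal a) \<infinity>) (\<lambda>x. exp (- s * of_real x))"
      by (simp add: einterval_def greaterThan_def)
  next
    have "isCont (\<lambda>x. - exp (- s * of_real x) / s) a" using nz by (intro continuous_intros) auto
    thus "(((\<lambda>x. - exp (- s * of_real x) / s) \<circ> real_of_ereal) \<longlongrightarrow> - exp (- s * of_real a) / s) (at_right (ereal a))"
      by (auto simp: ereal_tendsto_simps isCont_def intro: filterlim_mono at_le)
  next
    show "(((\<lambda>x. - exp (- s * of_real x) / s) \<circ> real_of_ereal) \<longlongrightarrow> 0) (at_left \<infinity>)"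
      using lim by (simp add: ereal_tendsto_simps)
  qed auto
  hence "(LBINT x:{a<..}. exp (- s * of_real x)) = exp (- s * of_real a) / s"
    by (simp add: interval_lebesgue_integral_def einterval_def greaterThan_def)
  also have "(LBINT x:{a<..}. exp (- s * of_real x)) = (\<integral>u. indicator {a..} u * exp (- s * of_real u) \<partial>lborel)"
    unfolding set_lebesgue_integral_def
    by (intro integral_cong_AE) (auto simp: indicator_def intro!: AE_I[where N = "{a}"])
  finally show "(\<integral>u. indicator {a..} u * exp (- s * of_real u) \<partial>lborel) = exp (- s * a) / s" .
qed

text \<open>Growth below every exponential, instead of boundedness, makes the class closed under
  multiplication by \<open>u\<close>, so every derivative of a transform is again a transform of a
  member.\<close>

definition causal :: "(real \<Rightarrow> complex) \<Rightarrow> bool" where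
  "causal g \<longleftrightarrow> g \<in> borel_measurable borel \<and> (\<forall>u<0. g u = 0) \<and>
     (\<forall>a>0. \<exists>C. \<forall>u. norm (g u) \<le> C * exp (a * u))"

text \<open>The integral runs over the whole line; for a \<open>causal\<close> function it is the
  usual one-sided transform.\<close>

definition laplace :: "(real \<Rightarrow> complex) \<Rightarrow> complex \<Rightarrow> complex" where
  "laplace g s = (\<integral>u. g u * exp (- s * of_real u) \<partial>lborel)"

lemma causalD:
  assumes "causal g" "a > 0"
  obtains C where "C \<ge> 0" "\<And>u. norm (g u) \<le> C * exp (a * u)" "\<And>u. norm (g u) \<le> C * (indicator {0..} u * exp (a * u))"
proof -
  obtain C where C: "\<And>u. norm (g u) \<le> C * exp (a * u)" using assms unfolding causal_def by blast
  have "0 \<le> C" using order_trans[OF norm_ge_zero C[of 0]] by simp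
  moreover have "norm (g u) \<le> C * (indicator {0..} u * exp (a * u))" for u
    using C[of u] assms(1) by (auto simp: causal_def indicator_def)
  ultimately show ?thesis using that C by blast
qed

lemma causal_measurable [measurable_dest]: "causal g \<Longrightarrow> g \<in> borel_measurable borel"
  by (simp add: causal_def)

lemma causal_bounded:
  assumes "g \<in> borel_measurable borel" "\<And>u. u < 0 \<Longrightarrow> g u = 0" "\<And>u. norm (g u) \<le> 1"
  shows "causal g"
  unfolding causal_def
proof (intro conjI allI impI)
  fix a :: real assume a: "a > 0"
  have "norm (g u) \<le> 1 * exp (a * u)" for u
    using assms(2)[of u] assms(3)[of u] a by (cases "u < 0") (auto intro: order_trans)
  thus "\<exists>C. \<forall>u. norm (g u) \<le> C * exp (a * u)" by blast
qed (use assms in auto)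

lemma integrable_causal:
  assumes "causal g" "Re s > 0"
  shows "integrable lborel (\<lambda>u. g u * exp (- s * of_real u))"
proof -
  note [measurable] = causal_measurable[OF assms(1)]
  obtain C where C: "C \<ge> 0" "\<And>u. norm (g u) \<le> C * (indicator {0..} u * exp (Re s / 2 * u))"
    using causalD[OF assms(1), of "Re s / 2"] assms(2) by (metis half_gt_zero)
  have "integrable lborel (\<lambda>u. C * (indicator {0..} u * exp (- (Re s / 2) * u)))"
    using assms by (intro integrable_mult_right integrable_exp_atLeast) auto
  thus ?thesis
  proof (rule Bochner_Integration.integrable_bound)
    have "norm (g u) * exp (- Re s * u) \<le> C * (indicator {0..} u * exp (- (Re s / 2) * u))" for u
    proof -
      have "norm (g u) * exp (- Re s * u) \<le> C * (indicator {0..} u * exp (Re s / 2 * u)) * exp (- Re s * u)"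
        by (intro mult_right_mono C) auto
      also have "\<dots> = C * (indicator {0..} u * exp (- (Re s / 2) * u))"
        by (simp add: indicator_def flip: exp_add)
      finally show ?thesis .
    qed
    thus "AE u in lborel. norm (g u * exp (- s * of_real u)) \<le> norm (C * (indicator {0..} u * exp (- (Re s / 2) * u)))"
      using C(1) by (intro AE_I2) (simp add: norm_mult abs_mult)
  qed auto
qed

text \<open>Keeping track of the left end \<open>b\<close> of the support is what yields the factor
  \<open>real N powr (- Re s)\<close> for \<open>frac_tail N\<close>, whose support starts at
  \<open>ln (real N)\<close>.\<close>

lemma norm_laplace_le:
  assumes "causal g" "\<And>u. norm (g u) \<le> C * (indicator {b..} u * exp (a * u))" "a < Re s" "Re s > 0"
  shows "norm (laplace g s) \<le> C * exp (- (Re s - a) * b) / (Re s - a)"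
proof -
  have "norm (laplace g s) \<le> (\<integral>u. C * (indicator {b..} u * exp (- (Re s - a) * u)) \<partial>lborel)"
    unfolding laplace_def
  proof (rule Bochner_Integration.integral_norm_bound_integral)
    show "integrable lborel (\<lambda>u. C * (indicator {b..} u * exp (- (Re s - a) * u)))"
      using assms by (intro integrable_mult_right integrable_exp_atLeast) auto
    fix u
    have "norm (g u * exp (- s * of_real u)) \<le> C * (indicator {b..} u * exp (a * u)) * exp (- Re s * u)"
      unfolding norm_mult using assms(2)[of u] by (auto intro!: mult_right_mono)
    thus "norm (g u * exp (- s * of_real u)) \<le> C * (indicator {b..} u * exp (- (Re s - a) * u))"
      by (simp add: indicator_def algebra_simps flip: exp_add split: if_splits)
  qed (use integrable_causal assms in auto)
  also have "\<dots> = C * exp (- (Re s - a) * b) / (Re s - a)"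
    using assms by (simp only: integral_mult_right_zero integrable_exp_atLeast(2)) (simp add: integrable_exp_atLeast(2))
  finally show ?thesis .
qed

lemma real_le_exp: "0 < (a::real) \<Longrightarrow> u \<ge> 0 \<Longrightarrow> u \<le> exp (a * u) / a"
  using exp_ge_add_one_self[of "a * u"] by (simp add: pos_le_divide_eq mult.commute del: exp_ge_add_one_self)

lemma causal_mult_ident:
  assumes "causal g" shows "causal (\<lambda>u. - of_real u * g u)"
  unfolding causal_def
proof (intro conjI allI impI)
  note [measurable] = causal_measurable[OF assms(1)]
  show "(\<lambda>u. - of_real u * g u) \<in> borel_measurable borel" by measurable
  show "u < 0 \<Longrightarrow> - of_real u * g u = 0" for u using assms by (simp add: causal_def)
  fix a :: real assume a: "a > 0"
  then obtain C where C: "C \<ge> 0" "\<And>u. norm (g u) \<le> C * (indicator {0..} u * exp (a / 2 * u))"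
    using causalD[OF assms, of "a/2"] by (metis half_gt_zero)
  have "norm (- of_real u * g u) \<le> 2 * C / a * exp (a * u)" for u
  proof (cases "u \<ge> 0")
    case True
    have "\<bar>u\<bar> * norm (g u) \<le> exp (a / 2 * u) / (a/2) * (C * exp (a / 2 * u))"
      using real_le_exp[of "a/2" u] C(2)[of u] a True by (intro mult_mono) auto
    also have "\<dots> = 2 * C / a * exp (a * u)" by (simp add: field_simps flip: exp_add)
    finally show ?thesis by (simp add: norm_mult)
  qed (use C a assms in \<open>auto simp: causal_def\<close>)
  thus "\<exists>C. \<forall>u. norm (- of_real u * g u) \<le> C * exp (a * u)" by blast
qed

text \<open>The second-order Taylor remainder of the exponential is dominated by the absolute
  integral of \<open>u\<^sup>2 * g u\<close>, which gives an explicit error quadratic in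
  \<open>h\<close>.\<close>

lemma laplace_has_field_derivative:
  assumes "causal g" "Re s > 0"
  shows "(laplace g has_field_derivative laplace (\<lambda>u. - of_real u * g u) s) (at s)"
proof -
  define g1 g2 where "g1 = (\<lambda>u. - of_real u * g u)" and "g2 = (\<lambda>u. - of_real u * g1 u)"
  have c: "causal g1" "causal g2" unfolding g1_def g2_def by (intro causal_mult_ident assms)+
  \<comment> \<open>Half of the decay keeps \<open>u\<^sup>2 * g u\<close> integrable; the other
    half pays for the factor \<open>exp (r * u)\<close> in the Taylor remainder, available because
    \<open>norm h < r\<close>.\<close>
  define r where "r = Re s / 2"
  have r: "r > 0" using assms by (simp add: r_def)
  define K where "K = (\<integral>u. norm (g2 u * exp (- of_real r * of_real u)) \<partial>lborel)"
  have intK: "integrable lborel (\<lambda>u. norm (g2 u * exp (- of_real r * of_real u)))"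
    using integrable_causal[OF c(2), of "of_real r"] r by (intro integrable_norm) auto
  have bound: "norm (laplace g (s + h) - laplace g s - h * laplace g1 s) \<le> norm h ^ 2 * K" if h: "norm h < r" for h
  proof -
    have "Re (s + h) > 0" using abs_Re_le_cmod[of h] h r by (simp add: r_def)
    hence int: "integrable lborel (\<lambda>u. g u * exp (- (s + h) * of_real u))" "integrable lborel (\<lambda>u. g u * exp (- s * of_real u))"
       "integrable lborel (\<lambda>u. h * (g1 u * exp (- s * of_real u)))"
      using assms c by (intro integrable_mult_right integrable_causal; simp)+
    have "laplace g (s + h) - laplace g s - h * laplace g1 s =
        (\<integral>u. g u * exp (- (s + h) * of_real u) - g u * exp (- s * of_real u) - h * (g1 u * exp (- s * of_real u)) \<partial>lborel)"
      unfolding laplace_def using int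
      by (subst Bochner_Integration.integral_diff, auto)+
    also have "norm \<dots> \<le> (\<integral>u. norm h ^ 2 * norm (g2 u * exp (- of_real r * of_real u)) \<partial>lborel)"
    proof (rule Bochner_Integration.integral_norm_bound_integral)
      fix u
      show "norm (g u * exp (- (s + h) * of_real u) - g u * exp (- s * of_real u) - h * (g1 u * exp (- s * of_real u)))
         \<le> norm h ^ 2 * norm (g2 u * exp (- of_real r * of_real u))"
      proof (cases "u < 0")
        case True thus ?thesis using assms by (simp add: g1_def causal_def)
      next
        case False
        have "g u * exp (- (s + h) * of_real u) - g u * exp (- s * of_real u) - h * (g1 u * exp (- s * of_real u))
          = g u * exp (- s * of_real u) * (exp (- h * of_real u) - (1 + (- h * of_real u)))"
          by (simp add: g1_def algebra_simps exp_add exp_diff exp_minus divide_inverse)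
        also have "norm \<dots> = norm (g u) * exp (- Re s * u) * norm (exp (- h * of_real u) - (1 + (- h * of_real u)))"
          by (simp add: norm_mult)
        also have "\<dots> \<le> norm (g u) * exp (- Re s * u) * (exp (r * u) * (norm h ^ 2 * u ^ 2))"
        proof (rule mult_left_mono)
          have "norm (exp (- h * of_real u) - (1 + (- h * of_real u))) \<le> exp \<bar>Re (- h * of_real u)\<bar> * norm (- h * of_real u) ^ 2"
            using Taylor_exp[of "- h * of_real u" 1] by (simp add: numeral_2_eq_2)
          also have "\<dots> \<le> exp (r * u) * norm (- h * of_real u) ^ 2"
            using abs_Re_le_cmod[of h] h False
            by (intro mult_right_mono) (auto simp: abs_mult intro!: mult_right_mono)
          finally show "norm (exp (- h * of_real u) - (1 + (- h * of_real u))) \<le> exp (r * u) * (norm h ^ 2 * u ^ 2)"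
            by (simp add: norm_mult power_mult_distrib)
        qed auto
        also have "\<dots> = norm h ^ 2 * norm (g2 u * exp (- of_real r * of_real u))"
          by (simp add: g1_def g2_def norm_mult r_def power2_eq_square field_simps flip: exp_add)
        finally show ?thesis .
      qed
    qed (use int intK in \<open>auto\<close>)
    also have "\<dots> = norm h ^ 2 * K" by (simp add: K_def)
    finally show ?thesis .
  qed
  have "((\<lambda>h. (laplace g (s + h) - laplace g s) / h - laplace g1 s) \<longlongrightarrow> 0) (at 0)"
  proof (rule Lim_null_comparison)
    show "((\<lambda>h. norm h * K) \<longlongrightarrow> 0) (at (0::complex))"
      by (auto intro!: tendsto_eq_intros)
    show "eventually (\<lambda>h. norm ((laplace g (s + h) - laplace g s) / h - laplace g1 s) \<le> norm h * K) (at 0)"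
      unfolding eventually_at
    proof (intro exI[of _ r] conjI ballI impI r)
      fix h :: complex assume h: "h \<noteq> 0 \<and> dist h 0 < r"
      have "(laplace g (s + h) - laplace g s) / h - laplace g1 s = (laplace g (s + h) - laplace g s - h * laplace g1 s) / h"
        using h by (simp add: field_simps)
      also have "norm \<dots> \<le> norm h ^ 2 * K / norm h"
        unfolding norm_divide using bound[of h] h by (intro divide_right_mono) auto
      finally show "norm ((laplace g (s + h) - laplace g s) / h - laplace g1 s) \<le> norm h * K"
        using h by (simp add: power2_eq_square)
    qed
  qed
  hence "((\<lambda>h. (laplace g (s + h) - laplace g s) / h) \<longlongrightarrow> laplace g1 s) (at 0)"
    by (simp add: LIM_zero_iff)
  thus ?thesis by (simp add: DERIV_def g1_def)
qed

lemma laplace_holomorphic: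
  assumes "causal g" shows "laplace g holomorphic_on {s. Re s > 0}"
  using laplace_has_field_derivative[OF assms]
  by (auto simp: holomorphic_on_def field_differentiable_def intro: has_field_derivative_at_within)

lemma causal_power:
  assumes "causal g" shows "causal (\<lambda>u. (- of_real u) ^ n * g u)"
proof (induction n)
  case (Suc n) thus ?case using causal_mult_ident[OF Suc] by (simp add: mult_ac)
qed (use assms in auto)

lemma higher_deriv_laplace:
  assumes "causal g" "Re s > 0"
  shows "(deriv ^^ n) (laplace g) s = laplace (\<lambda>u. (- of_real u) ^ n * g u) s"
  using assms(2)
proof (induction n arbitrary: s)
  case (Suc n)
  have op: "open {s. Re s > 0}" by (rule open_halfspace_Re_gt)
  have "(deriv ^^ Suc n) (laplace g) s = deriv (laplace (\<lambda>u. (- of_real u) ^ n * g u)) s"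
    unfolding funpow.simps comp_def
    by (rule complex_derivative_transform_within_open[OF _ _ op])
       (use Suc assms laplace_holomorphic causal_power in \<open>auto intro!: holomorphic_higher_deriv op\<close>)
  also have "\<dots> = laplace (\<lambda>u. - of_real u * ((- of_real u) ^ n * g u)) s"
    by (intro DERIV_imp_deriv laplace_has_field_derivative causal_power assms Suc)
  finally show ?case by (simp add: mult_ac)
qed auto

section \<open>A Tauberian estimate by Gaussian averaging\<close>

text \<open>Fubini together with the characteristic function of the normal distribution. It takes
  the place of Fourier inversion: the transform is averaged against a normal density, so it may grow
  polynomially and need not be integrable. Frequencies of order \<open>T\<close> correspond to a
  Gaussian of width \<open>1 / T\<close> around \<open>v\<close>.\<close>

lemma gaussian_average_fourier:
  fixes g :: "real \<Rightarrow> complex"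
  assumes g: "integrable lborel g"
  shows "(\<integral>t. iexp (T * v * t) * (\<integral>u. g u * iexp (- (T * t * u)) \<partial>lborel) \<partial>std_normal_distribution) =
         (\<integral>u. g u * exp (- (T * (v - u))\<^sup>2 / 2) \<partial>lborel)"
    and "integrable std_normal_distribution (\<lambda>t. iexp (T * v * t) * (\<integral>u. g u * iexp (- (T * t * u)) \<partial>lborel))"
proof -
  interpret N: prob_space std_normal_distribution by (rule prob_space_normal_density) auto
  interpret P: pair_sigma_finite std_normal_distribution lborel ..
  note [measurable] = borel_measurable_integrable[OF g]
  let ?F = "\<lambda>(t, u). iexp (T * v * t) * (g u * iexp (- (T * t * u)))"
  have nF: "norm (?F (t, u)) = norm (g u)" for t u by (simp add: norm_mult)
  have int: "integrable (std_normal_distribution \<Otimes>\<^sub>M lborel) ?F"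
  proof (rule P.Fubini_integrable)
    show "integrable std_normal_distribution (\<lambda>t. \<integral>u. norm (?F (t, u)) \<partial>lborel)"
      unfolding nF by simp
    show "AE t in std_normal_distribution. integrable lborel (\<lambda>u. ?F (t, u))"
      by (intro AE_I2 Bochner_Integration.integrable_bound[OF g]) (auto simp: norm_mult)
  qed measurable
  have eq: "(\<integral>u. ?F (t, u) \<partial>lborel) = iexp (T * v * t) * (\<integral>u. g u * iexp (- (T * t * u)) \<partial>lborel)" for t
    by simp
  show "integrable std_normal_distribution (\<lambda>t. iexp (T * v * t) * (\<integral>u. g u * iexp (- (T * t * u)) \<partial>lborel))"
    using P.integrable_fst'[OF int] unfolding eq .
  have "(\<integral>t. iexp (T * v * t) * (\<integral>u. g u * iexp (- (T * t * u)) \<partial>lborel) \<partial>std_normal_distribution) =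
        (\<integral>t. (\<integral>u. ?F (t, u) \<partial>lborel) \<partial>std_normal_distribution)"
    by (simp only: eq)
  also have "\<dots> = (\<integral>u. (\<integral>t. ?F (t, u) \<partial>std_normal_distribution) \<partial>lborel)"
    by (rule P.Fubini_integral[symmetric]) (use int in simp)
  also have "\<dots> = (\<integral>u. g u * char std_normal_distribution (T * (v - u)) \<partial>lborel)"
  proof (intro Bochner_Integration.integral_cong refl)
    fix u
    have "(\<integral>t. ?F (t, u) \<partial>std_normal_distribution) = (\<integral>t. g u * iexp (T * (v - u) * t) \<partial>std_normal_distribution)"
      by (intro Bochner_Integration.integral_cong refl) (simp add: algebra_simps exp_diff exp_minus field_simps)
    thus "(\<integral>t. ?F (t, u) \<partial>std_normal_distribution) = g u * char std_normal_distribution (T * (v - u))"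
      by (simp add: char_def)
  qed
  finally show "(\<integral>t. iexp (T * v * t) * (\<integral>u. g u * iexp (- (T * t * u)) \<partial>lborel) \<partial>std_normal_distribution) =
         (\<integral>u. g u * exp (- (T * (v - u))\<^sup>2 / 2) \<partial>lborel)"
    by (simp add: char_std_normal_distribution)
qed

lemma integrable_poly_exp_neg_square:
  fixes a :: real assumes "a \<ge> 0"
  shows "integrable lborel (\<lambda>x. (1 + \<bar>x\<bar>) ^ n * (a + \<bar>x\<bar>) * exp (- x\<^sup>2 / 2))"
proof -
  have bd: "(1 + \<bar>x\<bar>) ^ n * (a + \<bar>x\<bar>) \<le> (a + 1) * 2 ^ Suc n * (1 + \<bar>x\<bar> ^ Suc n)" for x :: real
  proof -
    have "(1 + \<bar>x\<bar>) ^ n * (a + \<bar>x\<bar>) \<le> (1 + \<bar>x\<bar>) ^ n * ((a + 1) * (1 + \<bar>x\<bar>))"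
      using assms by (intro mult_left_mono) (auto simp: algebra_simps)
    also have "\<dots> = (a + 1) * (1 + \<bar>x\<bar>) ^ Suc n" by simp
    also have "(1 + \<bar>x\<bar>) ^ Suc n \<le> (2 * max 1 \<bar>x\<bar>) ^ Suc n"
      by (intro power_mono) auto
    also have "\<dots> = 2 ^ Suc n * (max 1 \<bar>x\<bar>) ^ Suc n" by (simp only: power_mult_distrib)
    also have "(max 1 \<bar>x\<bar>) ^ Suc n \<le> 1 + \<bar>x\<bar> ^ Suc n" by (cases "\<bar>x\<bar> \<le> 1") (auto simp: max_def)
    finally show ?thesis using assms by (simp add: mult_left_mono mult_ac)
  qed
  define c where "c = (a + 1) * 2 ^ Suc n * sqrt (2 * pi)"
  have "integrable lborel (\<lambda>x. c * (std_normal_density x * \<bar>x\<bar> ^ 0 + std_normal_density x * \<bar>x\<bar> ^ Suc n))"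
    by (intro integrable_mult_right Bochner_Integration.integrable_add integrable_std_normal_moment_abs)
  thus ?thesis
  proof (rule Bochner_Integration.integrable_bound)
    have "(1 + \<bar>x\<bar>) ^ n * (a + \<bar>x\<bar>) * exp (- x\<^sup>2 / 2) \<le> c * (std_normal_density x * \<bar>x\<bar> ^ 0 + std_normal_density x * \<bar>x\<bar> ^ Suc n)" for x
    proof -
      have "(1 + \<bar>x\<bar>) ^ n * (a + \<bar>x\<bar>) * exp (- x\<^sup>2 / 2) \<le> (a + 1) * 2 ^ Suc n * (1 + \<bar>x\<bar> ^ Suc n) * exp (- x\<^sup>2 / 2)"
        using bd[of x] by (intro mult_right_mono) auto
      also have "\<dots> = c * (std_normal_density x * \<bar>x\<bar> ^ 0 + std_normal_density x * \<bar>x\<bar> ^ Suc n)"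
        by (simp add: c_def std_normal_density_def field_simps)
      finally show ?thesis .
    qed
    thus "AE x in lborel. norm ((1 + \<bar>x\<bar>) ^ n * (a + \<bar>x\<bar>) * exp (- x\<^sup>2 / 2)) \<le>
        norm (c * (std_normal_density x * \<bar>x\<bar> ^ 0 + std_normal_density x * \<bar>x\<bar> ^ Suc n))"
      using assms by (intro AE_I2) (smt (verit) abs_ge_self abs_mult exp_ge_zero mult_nonneg_nonneg real_norm_def zero_le_power abs_ge_zero)
  qed measurable
qed

lemma integral_std_normal_square:
  "integrable std_normal_distribution (\<lambda>x. x\<^sup>2)" "(\<integral>x. x\<^sup>2 \<partial>std_normal_distribution) = 1"
proof -
  have "has_bochner_integral lborel (\<lambda>x. std_normal_density x * x\<^sup>2) 1"
    using std_normal_moment_even[of 1] by (simp add: numeral_2_eq_2)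
  thus "integrable std_normal_distribution (\<lambda>x. x\<^sup>2)" "(\<integral>x. x\<^sup>2 \<partial>std_normal_distribution) = 1"
    by (auto simp: integrable_density integral_density normal_density_nonneg has_bochner_integral_iff)
qed

lemma integral_std_normal_affine_square:
  "integrable std_normal_distribution (\<lambda>x. a + b * x\<^sup>2)" (is ?A)
  "(\<integral>x. a + b * x\<^sup>2 \<partial>std_normal_distribution) = a + b" (is ?B)
proof -
  interpret N: prob_space std_normal_distribution by (rule prob_space_normal_density) auto
  have 1: "integrable std_normal_distribution (\<lambda>x. a)" by (rule N.integrable_const)
  have 2: "integrable std_normal_distribution (\<lambda>x. b * x\<^sup>2)"
    by (rule integrable_mult_right) (rule integral_std_normal_square)
  show ?A using 1 2 by (rule Bochner_Integration.integrable_add)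
  have "(\<integral>x. a + b * x\<^sup>2 \<partial>std_normal_distribution) =
      (\<integral>x. a \<partial>std_normal_distribution) + (\<integral>x. b * x\<^sup>2 \<partial>std_normal_distribution)"
    by (rule Bochner_Integration.integral_add[OF 1 2])
  also have "(\<integral>x. a \<partial>std_normal_distribution) = a"
    by (simp only: lebesgue_integral_const N.prob_space scaleR_one)
  also have "(\<integral>x. b * x\<^sup>2 \<partial>std_normal_distribution) = b"
    by (simp only: integral_mult_right_zero integral_std_normal_square mult_1_right)
  finally show ?B .
qed

text \<open>Width \<open>v powr (-2)\<close> means frequencies of order \<open>v\<^sup>2\<close>,
  where \<open>tr\<close> gives a bound of order \<open>v ^ 4\<close>. The averaging weight has mass
  of order \<open>v ^ 6\<close>, namely height \<open>v ^ 8\<close> times width, so the average of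
  \<open>f\<close> has order \<open>v powr (-2)\<close>. By \<open>lip\<close>, replacing the
  average by \<open>f v\<close> costs no more than the width, which has the same order.\<close>

lemma laplace_tauberian:
  fixes f :: "real \<Rightarrow> real"
  assumes meas [measurable]: "f \<in> borel_measurable borel"
    and neg: "\<And>u. u < 0 \<Longrightarrow> f u = 0" and bdd: "\<And>u. \<bar>f u\<bar> \<le> 1"
    and lip: "\<And>u v. u \<ge> 0 \<Longrightarrow> v \<ge> 0 \<Longrightarrow> \<bar>f u - f v\<bar> \<le> \<bar>u - v\<bar> + exp (- min u v)"
    and c: "c > 0"
    and tr: "\<And>s. 0 < Re s \<Longrightarrow> Re s \<le> c \<Longrightarrow>
        norm (laplace (\<lambda>u. (- of_real u) ^ 8 * of_real (f u)) s) \<le> C * (1 + \<bar>Im s\<bar>)\<^sup>2"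
  shows "\<exists>D. \<forall>v\<ge>0. \<bar>f v\<bar> \<le> D / (1 + v)\<^sup>2"
proof -
  have caus: "causal (\<lambda>u. of_real (f u))"
    by (rule causal_bounded) (use neg bdd in auto)
  \<comment> \<open>A profile in the rescaled variable \<open>x = v\<^sup>2 * (u - v)\<close>: the
    eighth power dominates \<open>(u / v) ^ 8\<close>, and the factor
    \<open>2 + \<bar>x\<bar>\<close> makes room for the error \<open>f u - f v\<close>.\<close>
  define h where "h = (\<lambda>x::real. (1 + \<bar>x\<bar>) ^ 8 * (2 + \<bar>x\<bar>) * exp (- x\<^sup>2 / 2))"
  have h_int: "integrable lborel h" unfolding h_def by (rule integrable_poly_exp_neg_square) auto
  define I where "I = (\<integral>x. h x \<partial>lborel)"
  \<comment> \<open>From here on the abscissa \<open>1 / v\<close> lies in the range where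
    \<open>tr\<close> applies.\<close>
  define v0 where "v0 = max 1 (1 / c)"
  define c0 where "c0 = exp (-2) * exp (-1/2 :: real)"
  have C: "C \<ge> 0" using order_trans[OF norm_ge_zero tr[of "of_real c"]] c by simp
  have main: "\<bar>f v\<bar> \<le> (4 * C + 4 * I) / c0 / v\<^sup>2" if v: "v \<ge> v0" for v
  proof -
    have v1: "v \<ge> 1" and "1 / c \<le> v" using v by (simp_all add: v0_def)
    hence vc: "1 / v \<le> c" using c by (simp add: field_simps)
    define K where "K = (\<lambda>u. exp (- (v\<^sup>2 * (v - u))\<^sup>2 / 2))"
    \<comment> \<open>The weight under which \<open>f\<close> is averaged: \<open>u ^ 8\<close>
      stems from the eighth derivative, \<open>exp (- u / v)\<close> from working on the line
      \<open>Re s = 1 / v\<close>, and \<open>K\<close> from the Gaussian.\<close>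
    define W where "W = (\<lambda>u. indicator {0..} u * u ^ 8 * exp (- u / v) * K u)"
    define g where "g = (\<lambda>u. (- of_real u) ^ 8 * of_real (f u) * exp (- of_real (1 / v) * complex_of_real u))"
    have g_int: "integrable lborel g"
      unfolding g_def by (intro integrable_causal causal_power caus) (use v1 in simp)
    have ghat: "(\<integral>u. g u * iexp (- (v\<^sup>2 * t * u)) \<partial>lborel) =
        laplace (\<lambda>u. (- of_real u) ^ 8 * of_real (f u)) (Complex (1 / v) (v\<^sup>2 * t))" for t
      unfolding laplace_def g_def
    proof (intro Bochner_Integration.integral_cong refl)
      fix u :: real
      have "exp (- of_real (1 / v) * complex_of_real u) * iexp (- (v\<^sup>2 * t * u)) = exp (- Complex (1 / v) (v\<^sup>2 * t) * of_real u)"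
        by (simp add: Complex_eq algebra_simps flip: exp_add)
      thus "(- of_real u) ^ 8 * of_real (f u) * exp (- of_real (1 / v) * complex_of_real u) * iexp (- (v\<^sup>2 * t * u)) =
        (- of_real u) ^ 8 * of_real (f u) * exp (- Complex (1 / v) (v\<^sup>2 * t) * of_real u)"
        by (simp add: mult.assoc)
    qed
    have fW_eq: "g u * exp (- (v\<^sup>2 * (v - u))\<^sup>2 / 2) = complex_of_real (f u * W u)" for u
    proof -
      have "exp (- of_real (1 / v) * complex_of_real u) = of_real (exp (- u / v))"
        by (simp flip: exp_of_real)
      moreover have "(- complex_of_real u) ^ 8 = of_real (u ^ 8)" by simp
      ultimately have "g u = of_real (u ^ 8 * f u * exp (- u / v))" unfolding g_def by simp
      moreover have "u ^ 8 * f u * exp (- u / v) * K u = f u * W u"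
        using neg[of u] by (auto simp: W_def indicator_def)
      ultimately show ?thesis by (simp add: K_def flip: of_real_mult)
    qed
    define X where "X = (\<integral>t. iexp (v\<^sup>2 * v * t) * (\<integral>u. g u * iexp (- (v\<^sup>2 * t * u)) \<partial>lborel) \<partial>std_normal_distribution)"
    have "complex_of_real (\<integral>u. f u * W u \<partial>lborel) = X"
      unfolding X_def by (subst gaussian_average_fourier(1)[OF g_int]) (simp only: fW_eq integral_complex_of_real)
    hence "\<bar>\<integral>u. f u * W u \<partial>lborel\<bar> = norm X" by (metis norm_of_real)
    also have "norm X \<le> (\<integral>t. C * (2 + 2 * v ^ 4 * t\<^sup>2) \<partial>std_normal_distribution)"
      unfolding X_def
    proof (rule Bochner_Integration.integral_norm_bound_integral)
      show "integrable std_normal_distribution (\<lambda>t. C * (2 + 2 * v ^ 4 * t\<^sup>2))"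
        by (intro integrable_mult_right integral_std_normal_affine_square)
      fix t :: real
      have "norm (iexp (v\<^sup>2 * v * t) * (\<integral>u. g u * iexp (- (v\<^sup>2 * t * u)) \<partial>lborel)) \<le> C * (1 + \<bar>v\<^sup>2 * t\<bar>)\<^sup>2"
        unfolding norm_mult ghat using tr[of "Complex (1 / v) (v\<^sup>2 * t)"] v1 vc by simp
      also have "(1 + \<bar>v\<^sup>2 * t\<bar>)\<^sup>2 \<le> 2 + 2 * v ^ 4 * t\<^sup>2"
        using zero_le_power2[of "1 - \<bar>v\<^sup>2 * t\<bar>"] by (simp add: power2_eq_square algebra_simps eval_nat_numeral)
      finally show "norm (iexp (v\<^sup>2 * v * t) * (\<integral>u. g u * iexp (- (v\<^sup>2 * t * u)) \<partial>lborel)) \<le> C * (2 + 2 * v ^ 4 * t\<^sup>2)"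
        using C by (simp add: mult_left_mono)
    qed (rule gaussian_average_fourier(2)[OF g_int])
    also have "\<dots> = C * (2 + 2 * v ^ 4)"
      by (simp only: integral_mult_right_zero integral_std_normal_affine_square)
    also have "\<dots> \<le> C * (4 * v ^ 4)" using v1 C by (intro mult_left_mono) auto
    finally have J: "\<bar>\<integral>u. f u * W u \<partial>lborel\<bar> \<le> 4 * C * v ^ 4" by (simp add: mult_ac)

    have K_h: "(v\<^sup>2 * (u - v))\<^sup>2 = (v\<^sup>2 * (v - u))\<^sup>2" for u by (simp add: power2_eq_square algebra_simps)
    have hK: "h (v\<^sup>2 * (u - v)) = (1 + \<bar>v\<^sup>2 * (u - v)\<bar>) ^ 8 * (2 + \<bar>v\<^sup>2 * (u - v)\<bar>) * K u" for u
      unfolding h_def K_h K_def by (rule refl)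
    have vv: "1 \<le> v\<^sup>2" using v1 by simp
    have lev: "\<bar>u - v\<bar> \<le> \<bar>v\<^sup>2 * (u - v)\<bar>" for u
      using mult_right_mono[OF vv, of "\<bar>u - v\<bar>"] by (simp add: abs_mult)
    have W_le: "0 \<le> W u" "W u \<le> v ^ 8 * ((1 + \<bar>v\<^sup>2 * (u - v)\<bar>) ^ 8 * K u)" for u
    proof -
      show "0 \<le> W u" by (auto simp: W_def K_def indicator_def)
      show "W u \<le> v ^ 8 * ((1 + \<bar>v\<^sup>2 * (u - v)\<bar>) ^ 8 * K u)"
      proof (cases "u \<ge> 0")
        case True
        have "u \<le> v * (1 + \<bar>v\<^sup>2 * (u - v)\<bar>)"
        proof -
          have "\<bar>v\<^sup>2 * (u - v)\<bar> \<le> v * \<bar>v\<^sup>2 * (u - v)\<bar>" using v1 by (simp add: mult_left_le_one_le mult_le_cancel_right1)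
          thus ?thesis using lev[of u] by (simp add: algebra_simps)
        qed
        hence "u ^ 8 \<le> (v * (1 + \<bar>v\<^sup>2 * (u - v)\<bar>)) ^ 8" using True by (intro power_mono) auto
        moreover have "exp (- u / v) \<le> 1" using True v1 by simp
        ultimately have "u ^ 8 * exp (- u / v) \<le> (v * (1 + \<bar>v\<^sup>2 * (u - v)\<bar>)) ^ 8 * 1"
          using v1 by (intro mult_mono) auto
        hence "u ^ 8 * exp (- u / v) * K u \<le> (v * (1 + \<bar>v\<^sup>2 * (u - v)\<bar>)) ^ 8 * 1 * K u"
          by (intro mult_right_mono) (auto simp: K_def)
        thus ?thesis using True by (simp add: W_def power_mult_distrib mult_ac)
      qed (use v1 in \<open>auto simp: W_def K_def\<close>)
    qed
    have hv_int: "integrable lborel (\<lambda>u. h (v\<^sup>2 * (u - v)))"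
      using lborel_integrable_real_affine[OF h_int, of "v\<^sup>2" "- (v\<^sup>2 * v)"] v1 by (simp add: algebra_simps)
    have hv: "(\<integral>u. h (v\<^sup>2 * (u - v)) \<partial>lborel) = I / v\<^sup>2"
    proof -
      have "I = \<bar>v\<^sup>2\<bar> *\<^sub>R (\<integral>u. h (- (v\<^sup>2 * v) + v\<^sup>2 * u) \<partial>lborel)"
        unfolding I_def by (rule lborel_integral_real_affine) (use v1 in simp)
      also have "(\<lambda>u. h (- (v\<^sup>2 * v) + v\<^sup>2 * u)) = (\<lambda>u. h (v\<^sup>2 * (u - v)))" by (simp add: algebra_simps)
      finally show ?thesis using v1 by (simp add: field_simps)
    qed
    have [measurable]: "K \<in> borel_measurable borel" "W \<in> borel_measurable borel" unfolding K_def W_def by measurable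
    have W_h: "W u \<le> v ^ 8 * h (v\<^sup>2 * (u - v))" for u
    proof -
      have "(1 + \<bar>v\<^sup>2 * (u - v)\<bar>) ^ 8 * K u * 1 \<le> (1 + \<bar>v\<^sup>2 * (u - v)\<bar>) ^ 8 * K u * (2 + \<bar>v\<^sup>2 * (u - v)\<bar>)"
        by (intro mult_left_mono) (auto simp: K_def)
      also have "\<dots> = h (v\<^sup>2 * (u - v))" unfolding hK by (simp only: mult_ac)
      finally have "v ^ 8 * ((1 + \<bar>v\<^sup>2 * (u - v)\<bar>) ^ 8 * K u) \<le> v ^ 8 * h (v\<^sup>2 * (u - v))"
        using v1 by (intro mult_left_mono) simp_all
      thus ?thesis using W_le(2)[of u] by linarith
    qed
    have W_int: "integrable lborel W"
      by (rule Bochner_Integration.integrable_bound[OF integrable_mult_right[OF hv_int, of "v ^ 8"]])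
         (use W_le(1) in \<open>auto intro!: AE_I2 order_trans[OF W_h abs_ge_self]\<close>)
    have fW_int: "integrable lborel (\<lambda>u. f u * W u)"
    proof (rule Bochner_Integration.integrable_bound[OF W_int])
      show "AE u in lborel. norm (f u * W u) \<le> norm (W u)"
        using mult_right_mono[OF bdd, of "\<bar>W u\<bar>" for u] by (intro AE_I2) (simp add: abs_mult)
    qed measurable
    have diff: "\<bar>f u - f v\<bar> \<le> 4 / v\<^sup>2 * (2 + \<bar>v\<^sup>2 * (u - v)\<bar>)" if "u \<ge> 0" for u
    proof -
      have e: "4 / v\<^sup>2 * (2 + \<bar>v\<^sup>2 * (u - v)\<bar>) = 8 / v\<^sup>2 + 4 * \<bar>u - v\<bar>"
        using v1 unfolding abs_mult by (simp add: ring_distribs)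
      show ?thesis
      proof (cases "u \<ge> v / 2")
        case True
        have "(v / 2)\<^sup>2 / 2 \<le> exp (v / 2)"
          using exp_lower_Taylor_quadratic[of "v/2"] v1 by simp
        hence "exp (- (v / 2)) \<le> 8 / v\<^sup>2" using v1 by (simp add: exp_minus field_simps power2_eq_square)
        moreover have "exp (- min u v) \<le> exp (- (v / 2))" using True v1 by auto
        moreover have "0 \<le> v" using v1 by simp
        ultimately show ?thesis using lip[OF that, of v] unfolding e by argo
      next
        case False
        \<comment> \<open>Away from \<open>v\<close> the trivial bound 2 for the difference
          suffices, since \<open>\<bar>u - v\<bar>\<close> exceeds \<open>v / 2\<close>, which is at
          least \<open>1 / 2\<close>.\<close>
        hence "2 \<le> 4 * \<bar>u - v\<bar>" using v1 by auto
        moreover have "\<bar>f u - f v\<bar> \<le> 2" using bdd[of u] bdd[of v] by linarith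
        moreover have "0 \<le> 8 / v\<^sup>2" by simp
        ultimately show ?thesis unfolding e by linarith
      qed
    qed
    have "\<bar>\<integral>u. (f u - f v) * W u \<partial>lborel\<bar> \<le> (\<integral>u. 4 * v ^ 6 * h (v\<^sup>2 * (u - v)) \<partial>lborel)"
      unfolding real_norm_def[symmetric]
    proof (rule Bochner_Integration.integral_norm_bound_integral)
      show "integrable lborel (\<lambda>u. (f u - f v) * W u)"
        using fW_int W_int by (simp add: left_diff_distrib)
      fix u
      show "norm ((f u - f v) * W u) \<le> 4 * v ^ 6 * h (v\<^sup>2 * (u - v))"
      proof (cases "u \<ge> 0")
        case True
        have "\<bar>f u - f v\<bar> * W u \<le> (4 / v\<^sup>2 * (2 + \<bar>v\<^sup>2 * (u - v)\<bar>)) * (v ^ 8 * ((1 + \<bar>v\<^sup>2 * (u - v)\<bar>) ^ 8 * K u))"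
          using diff[OF True] W_le[of u] by (intro mult_mono) auto
        also have "\<dots> = 4 * (v ^ 8 / v\<^sup>2) * h (v\<^sup>2 * (u - v))"
          unfolding hK by (simp only: divide_inverse mult_ac)
        also have "v ^ 8 / v\<^sup>2 = v ^ 6" using v1 by (simp add: field_simps flip: power_add)
        finally show ?thesis using W_le(1)[of u] by (simp add: abs_mult)
      next
        case False
        thus ?thesis using v1 by (simp add: W_def h_def)
      qed
    qed (use hv_int in auto)
    also have "\<dots> = 4 * v ^ 6 * (I / v\<^sup>2)" using hv by simp
    also have "\<dots> = 4 * I * v ^ 4" using v1 by (simp add: field_simps flip: power_add)
    also have "(\<integral>u. (f u - f v) * W u \<partial>lborel) = (\<integral>u. f u * W u \<partial>lborel) - f v * (\<integral>u. W u \<partial>lborel)"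
      using fW_int W_int by (simp add: left_diff_distrib Bochner_Integration.integral_diff)
    finally have up: "\<bar>f v * (\<integral>u. W u \<partial>lborel)\<bar> \<le> (4 * C + 4 * I) * v ^ 4"
      using J by (simp add: algebra_simps)

    \<comment> \<open>Only the interval from \<open>v\<close> to \<open>v + 1 / v\<^sup>2\<close> is
      kept. There \<open>u \<le> 2 * v\<close> and the rescaled variable is at most 1, which
      explains the two factors \<open>exp (-2)\<close> and \<open>exp (-1/2)\<close> of
      \<open>c0\<close>.\<close>
    have "c0 * v ^ 6 \<le> (\<integral>u. W u \<partial>lborel)"
    proof -
      have "c0 * v ^ 6 = (\<integral>u. v ^ 8 * c0 * indicator {v..v + 1 / v\<^sup>2} u \<partial>lborel)"
        using v1 by (simp add: field_simps flip: power_add)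
      also have "\<dots> \<le> (\<integral>u. W u \<partial>lborel)"
      proof (rule integral_mono[OF _ W_int])
        fix u
        show "v ^ 8 * c0 * indicator {v..v + 1 / v\<^sup>2} u \<le> W u"
        proof (cases "u \<in> {v..v + 1 / v\<^sup>2}")
          case True
          have "1 / v\<^sup>2 \<le> 1" by (rule divide_le_eq_1_pos[THEN iffD2]) (use vv in linarith)+
          hence "u \<le> 2 * v" using True v1 unfolding atLeastAtMost_iff by linarith
          hence "exp (-2) \<le> exp (- u / v)" using v1 by (simp add: field_simps)
          moreover have "v\<^sup>2 * (u - v) \<le> 1" using True v1 by (simp add: field_simps)
          hence "(v\<^sup>2 * (u - v))\<^sup>2 \<le> 1\<^sup>2" using True v1 by (intro power_mono) auto
          hence "exp (-1/2) \<le> K u" unfolding K_def K_h[symmetric] by simp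
          moreover have "v ^ 8 \<le> u ^ 8" using True v1 by (intro power_mono) auto
          ultimately have "v ^ 8 * (exp (-2) * exp (-1/2)) \<le> u ^ 8 * (exp (- u / v) * K u)"
            using v1 by (intro mult_mono) auto
          thus ?thesis using True v1 by (simp add: W_def c0_def mult_ac)
        qed (use W_le(1) in simp)
      qed auto
      finally show ?thesis .
    qed
    hence "\<bar>f v\<bar> * (c0 * v ^ 6) \<le> \<bar>f v * (\<integral>u. W u \<partial>lborel)\<bar>"
      by (simp add: abs_mult mult_left_mono)
    with up have "\<bar>f v\<bar> * (c0 * v ^ 6) \<le> (4 * C + 4 * I) * v ^ 4" by linarith
    hence "\<bar>f v\<bar> * (c0 * v\<^sup>2) * v ^ 4 \<le> (4 * C + 4 * I) * v ^ 4"
      by (simp add: mult_ac flip: power_add)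
    hence "\<bar>f v\<bar> * (c0 * v\<^sup>2) \<le> 4 * C + 4 * I" using v1 by (simp add: mult_le_cancel_right)
    moreover have "c0 > 0" by (simp add: c0_def)
    ultimately show ?thesis using v1 by (simp add: field_simps)
  qed
  define A where "A = (4 * C + 4 * I) / c0"
  show ?thesis
  proof (intro exI allI impI)
    fix v :: real assume v: "v \<ge> 0"
    have v01: "v0 \<ge> 1" by (simp add: v0_def)
    have "0 \<le> A / v0\<^sup>2" using order_trans[OF abs_ge_zero main[of v0]] by (simp add: A_def)
    hence "0 \<le> A / v0\<^sup>2 * v0\<^sup>2" by (rule mult_nonneg_nonneg) simp
    hence A: "A \<ge> 0" using v01 by simp
    \<comment> \<open>The summand \<open>(1 + v0)\<^sup>2\<close> covers all \<open>v < v0\<close>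
      by means of \<open>bdd\<close> alone.\<close>
    show "\<bar>f v\<bar> \<le> (4 * A + (1 + v0)\<^sup>2) / (1 + v)\<^sup>2"
    proof (cases "v \<ge> v0")
      case True
      have "(1 + v)\<^sup>2 \<le> (2 * v)\<^sup>2" using True v01 by (intro power_mono) auto
      hence "A * (1 + v)\<^sup>2 \<le> A * (4 * v\<^sup>2)" using A by (intro mult_left_mono) (auto simp: power_mult_distrib)
      hence "A / v\<^sup>2 \<le> 4 * A / (1 + v)\<^sup>2" using True v01 by (simp add: field_simps)
      also have "\<dots> \<le> (4 * A + (1 + v0)\<^sup>2) / (1 + v)\<^sup>2" by (intro divide_right_mono) auto
      finally show ?thesis using main[OF True] by (simp add: A_def)
    next
      case False
      have "(1 + v)\<^sup>2 \<le> (1 + v0)\<^sup>2" using False v by (intro power_mono) auto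
      hence "1 \<le> (4 * A + (1 + v0)\<^sup>2) / (1 + v)\<^sup>2" using A v by (simp add: field_simps)
      thus ?thesis using bdd[of v] by linarith
    qed
  qed
qed

section \<open>Divisor sums of the Moebius function\<close>

lemma prod_primes_dvd:
  fixes m :: nat
  assumes "finite A" "\<And>p. p \<in> A \<Longrightarrow> prime p \<and> p dvd m"
  shows "\<Prod>A dvd m"
  using assms
proof (induction A rule: finite_induct)
  case (insert p A)
  have "coprime p (\<Prod>A)"
    by (rule prod_coprime_right) (use insert in \<open>auto intro!: primes_coprime\<close>)
  thus ?case using insert by (simp add: divides_mult)
qed auto

lemma prime_factors_prod_primes:
  fixes S :: "nat set"
  assumes "finite S" "\<And>p. p \<in> S \<Longrightarrow> prime p"
  shows "prime_factors (\<Prod>S) = S" "squarefree (\<Prod>S)" "prime_omega (\<Prod>S) = card S"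
    "moebius_mu (\<Prod>S) = (-1) ^ card S"
proof -
  have "0 \<notin> id ` S" using assms(2) by (auto dest: prime_gt_0_nat)
  hence "prime_factors (prod id S) = (\<Union>p\<in>S. prime_factors p)"
    using prime_factors_prod[OF assms(1), of id] by simp
  also have "\<dots> = S" using assms(2) by (auto simp: prime_prime_factors)
  finally show pf: "prime_factors (\<Prod>S) = S" by (simp add: id_def)
  show sf: "squarefree (\<Prod>S)"
    by (rule squarefree_prod_coprime) (use assms(2) in \<open>auto intro: primes_coprime squarefree_prime\<close>)
  show "prime_omega (\<Prod>S) = card S" "moebius_mu (\<Prod>S) = (-1) ^ card S"
    using pf sf by (simp_all add: prime_omega_def moebius_mu_def)
qed

lemma prod_prime_factors_squarefree:
  fixes n :: nat assumes "squarefree n"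
  shows "\<Prod>(prime_factors n) = n"
proof -
  have "n \<noteq> 0" using assms by (metis not_squarefree_0)
  hence "n = (\<Prod>p\<in>prime_factors n. p ^ multiplicity p n)"
    using prod_prime_factors[of n] by simp
  also have "\<dots> = (\<Prod>p\<in>prime_factors n. p)"
  proof (intro prod.cong refl)
    fix p assume p: "p \<in> prime_factors n"
    hence "0 < multiplicity p n" by (simp add: prime_factors_multiplicity)
    moreover have "multiplicity p n \<le> 1"
      using p assms squarefree_factorial_semiring''[of n] \<open>n \<noteq> 0\<close> by auto
    ultimately have "multiplicity p n = 1" by linarith
    thus "p ^ multiplicity p n = p" by simp
  qed
  finally show ?thesis by simp
qed

text \<open>Serves twice: with the prime factors of \<open>n\<close> for divisor sums, and with all
  primes up to \<open>N\<close> for the Euler product.\<close>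

lemma bij_betw_prod_primes:
  fixes P :: "nat set"
  assumes "finite P" "\<And>p. p \<in> P \<Longrightarrow> prime p"
  shows "bij_betw \<Prod> (Pow P) {n. squarefree n \<and> prime_factors n \<subseteq> P}"
  by (rule bij_betw_byWitness[where f' = prime_factors])
     (use assms in \<open>auto simp: prod_prime_factors_squarefree prime_factors_prod_primes finite_subset subset_iff\<close>)

text \<open>The function \<open>F\<close> is arbitrary so that the constant 1 gives Moebius
  inversion and the \<open>k\<close>-th power gives the function \<open>h\<close> of the
  overview.\<close>

lemma sum_divisors_moebius:
  fixes F :: "nat \<Rightarrow> real"
  assumes "n > 0"
  shows "(\<Sum>d | d dvd n. of_int (moebius_mu d) * F (prime_omega d)) =
         (\<Sum>S\<in>Pow (prime_factors n). (-1) ^ card S * F (card S))"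
proof -
  have sub: "prime_factors d \<subseteq> prime_factors n" if "d dvd n" for d
    using dvd_prime_factors[of n d] that assms by simp
  have "(\<Sum>d | d dvd n. of_int (moebius_mu d) * F (prime_omega d)) =
        (\<Sum>d | squarefree d \<and> prime_factors d \<subseteq> prime_factors n. of_int (moebius_mu d) * F (prime_omega d))"
  proof (rule sum.mono_neutral_cong_right)
    show "{d. squarefree d \<and> prime_factors d \<subseteq> prime_factors n} \<subseteq> {d. d dvd n}"
    proof safe
      fix d assume d: "squarefree d" "prime_factors d \<subseteq> prime_factors n"
      have "\<Prod>(prime_factors d) dvd n" by (rule prod_primes_dvd) (use d in auto)
      thus "d dvd n" using prod_prime_factors_squarefree[OF d(1)] by simp
    qed
  qed (use assms in \<open>auto simp: moebius_mu_def dest: subsetD[OF sub] intro: finite_divisors_nat\<close>)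
  also have "\<dots> = (\<Sum>S\<in>Pow (prime_factors n). (-1) ^ card S * F (card S))"
  proof (rule sum.reindex_bij_betw[OF bij_betw_prod_primes, symmetric, THEN trans])
    have "of_int (moebius_mu (\<Prod>S)) * F (prime_omega (\<Prod>S)) = (-1) ^ card S * F (card S)"
      if "S \<in> Pow (prime_factors n)" for S
    proof -
      have "finite S" "\<And>p. p \<in> S \<Longrightarrow> prime p" using that by (auto intro: finite_subset)
      thus ?thesis by (simp add: prime_factors_prod_primes)
    qed
    thus "(\<Sum>S\<in>Pow (prime_factors n). of_int (moebius_mu (\<Prod>S)) * F (prime_omega (\<Prod>S))) =
        (\<Sum>S\<in>Pow (prime_factors n). (-1) ^ card S * F (card S))" by (rule sum.cong[OF refl])
  qed auto
  finally show ?thesis .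
qed

text \<open>Pairing \<open>S\<close> with \<open>insert p S\<close> is a first difference: the top
  binomial term of \<open>(card S + 1) ^ k\<close> cancels, leaving powers \<open>l < k\<close> over
  subsets of a set with one element fewer, so the induction hypothesis applies to each.\<close>

lemma sum_Pow_alternating_power:
  assumes "finite P" "card P > k"
  shows "(\<Sum>S\<in>Pow P. (-1) ^ card S * real (card S) ^ k) = 0"
  using assms
proof (induction k arbitrary: P rule: less_induct)
  case (less k)
  then obtain p Q where P: "P = insert p Q" "p \<notin> Q" "finite Q"
    by (metis card.empty ex_in_conv finite_insert less_nat_zero_code mk_disjoint_insert)
  have "(\<Sum>S\<in>Pow P. (-1) ^ card S * real (card S) ^ k) =
     (\<Sum>S\<in>Pow Q. (-1) ^ card S * real (card S) ^ k) + (\<Sum>S\<in>insert p ` Pow Q. (-1) ^ card S * real (card S) ^ k)"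
    unfolding P(1) Pow_insert using P by (intro sum.union_disjoint) auto
  also have "(\<Sum>S\<in>insert p ` Pow Q. (-1) ^ card S * real (card S) ^ k) =
      (\<Sum>S\<in>Pow Q. (-1) ^ card (insert p S) * real (card (insert p S)) ^ k)"
    by (rule sum.reindex_cong[of "insert p"]) (use P in \<open>auto simp: inj_on_def\<close>)
  also have "\<dots> = (\<Sum>S\<in>Pow Q. - ((-1) ^ card S * (\<Sum>l\<le>k. real (k choose l) * real (card S) ^ l)))"
  proof (intro sum.cong refl)
    fix S assume S: "S \<in> Pow Q"
    have "card (insert p S) = Suc (card S)" using P S by (subst card_insert_disjoint) (auto dest: finite_subset)
    moreover have "real (Suc (card S)) ^ k = (\<Sum>l\<le>k. real (k choose l) * real (card S) ^ l)"
      using binomial_ring[of "real (card S)" 1 k] by (simp add: add.commute)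
    ultimately show "(-1) ^ card (insert p S) * real (card (insert p S)) ^ k =
        - ((-1) ^ card S * (\<Sum>l\<le>k. real (k choose l) * real (card S) ^ l))" by simp
  qed
  also have "(\<Sum>S\<in>Pow Q. (-1) ^ card S * real (card S) ^ k) + \<dots> =
      - (\<Sum>l<k. real (k choose l) * (\<Sum>S\<in>Pow Q. (-1) ^ card S * real (card S) ^ l))"
  proof -
    have "(\<Sum>l\<le>k. real (k choose l) * real (card S) ^ l) = (\<Sum>l<k. real (k choose l) * real (card S) ^ l) + real (card S) ^ k" for S :: "'a set"
      by (simp flip: lessThan_Suc_atMost)
    hence "(\<Sum>S\<in>Pow Q. (-1) ^ card S * real (card S) ^ k) +
          (\<Sum>S\<in>Pow Q. - ((-1) ^ card S * (\<Sum>l\<le>k. real (k choose l) * real (card S) ^ l))) =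
        (\<Sum>S\<in>Pow Q. - (\<Sum>l<k. real (k choose l) * ((-1) ^ card S * real (card S) ^ l)))"
      unfolding sum.distrib[symmetric] by (intro sum.cong refl) (simp add: algebra_simps sum_distrib_left)
    also have "\<dots> = - (\<Sum>l<k. real (k choose l) * (\<Sum>S\<in>Pow Q. (-1) ^ card S * real (card S) ^ l))"
      unfolding sum_negf sum.swap[of _ "Pow Q"] sum_distrib_left ..
    finally show ?thesis .
  qed
  also have "\<dots> = 0" using less P by simp
  finally show ?case .
qed

lemma sum_divisors_moebius_mu:
  assumes "n > 0"
  shows "(\<Sum>d | d dvd n. real_of_int (moebius_mu d)) = (if n = 1 then 1 else 0)"
proof -
  have "(\<Sum>d | d dvd n. real_of_int (moebius_mu d)) = (\<Sum>S\<in>Pow (prime_factors n). (-1) ^ card S)"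
    using sum_divisors_moebius[OF assms, of "\<lambda>_. 1"] by simp
  also have "\<dots> = (if n = 1 then 1 else 0)"
  proof (cases "n = 1")
    case False
    hence "prime_factors n \<noteq> {}" using assms by (simp add: prime_factorization_empty_iff)
    thus ?thesis using sum_Pow_alternating_power[of "prime_factors n" 0] False by (simp add: card_gt_0_iff)
  qed simp
  finally show ?thesis .
qed

section \<open>Moebius inversion for sums over the positive integers up to a real bound\<close>

definition pos_upto :: "real \<Rightarrow> nat set" where
  "pos_upto x = {n. 0 < n \<and> real n \<le> x}"

lemma pos_upto_eq: "pos_upto x = {0<..nat \<lfloor>x\<rfloor>}"
proof -
  have "n \<le> nat \<lfloor>x\<rfloor> \<longleftrightarrow> real n \<le> x" if "n > 0" for n
    using that by (auto simp: le_nat_iff le_floor_iff nat_le_iff) linarith+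
  thus ?thesis by (auto simp: pos_upto_def)
qed

lemma finite_pos_upto [simp, intro]: "finite (pos_upto x)" by (simp add: pos_upto_eq)

lemma card_pos_upto: "x \<ge> 0 \<Longrightarrow> real (card (pos_upto x)) = of_int \<lfloor>x\<rfloor>"
  by (simp add: pos_upto_eq)

lemma sum_pos_upto_one:
  "x \<ge> 1 \<Longrightarrow> (\<Sum>m\<in>pos_upto x. if m = 1 then c else 0) = (c :: real)"
  by (subst sum.delta[OF finite_pos_upto]) (simp add: pos_upto_def)

text \<open>Both sides run over the pairs \<open>(d, e)\<close> with \<open>d * e \<le> x\<close>,
  on the left grouped by the product.\<close>

lemma sum_divisors_pos_upto:
  fixes F :: "nat \<Rightarrow> nat \<Rightarrow> real"
  shows "(\<Sum>m\<in>pos_upto x. \<Sum>d | d dvd m. F d (m div d)) = (\<Sum>d\<in>pos_upto x. \<Sum>e\<in>pos_upto (x / d). F d e)"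
proof -
  have "(\<Sum>m\<in>pos_upto x. \<Sum>d | d dvd m. F d (m div d)) =
        (\<Sum>(m, d)\<in>(SIGMA m:pos_upto x. {d. d dvd m}). F d (m div d))"
    by (rule sum.Sigma) (auto simp: pos_upto_eq intro: finite_divisors_nat)
  also have "\<dots> = (\<Sum>(d, e)\<in>(SIGMA d:pos_upto x. pos_upto (x / d)). F d e)"
  proof (rule sum.reindex_bij_witness[of _ "\<lambda>(d, e). (d * e, d)" "\<lambda>(m, d). (d, m div d)"])
    fix a assume "a \<in> (SIGMA m:pos_upto x. {d. d dvd m})"
    then obtain d e where a: "a = (d * e, d)" "0 < d * e" "real (d * e) \<le> x" by (auto simp: pos_upto_def elim!: dvdE)
    have "d \<le> d * e" using a(2) by simp
    hence "real d \<le> real (d * e)" by (rule of_nat_mono)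
    hence "real d \<le> x" using a(3) by (rule order_trans)
    thus "(case a of (m, d) \<Rightarrow> (d, m div d)) \<in> (SIGMA d:pos_upto x. pos_upto (x / real d))"
      using a by (auto simp: pos_upto_def field_simps)
  next
    fix b assume "b \<in> (SIGMA d:pos_upto x. pos_upto (x / real d))"
    thus "(case b of (d, e) \<Rightarrow> (d * e, d)) \<in> (SIGMA m:pos_upto x. {d. d dvd m})"
      by (auto simp: pos_upto_def field_simps)
  qed (auto simp: pos_upto_def)
  also have "\<dots> = (\<Sum>d\<in>pos_upto x. \<Sum>e\<in>pos_upto (x / d). F d e)"
    by (rule sum.Sigma[symmetric]) auto
  finally show ?thesis .
qed

text \<open>The function \<open>M\<close> of the overview.\<close>

definition moebius_recip_sum :: "real \<Rightarrow> real" where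
  "moebius_recip_sum x = (\<Sum>n\<in>pos_upto x. of_int (moebius_mu n) / n)"

lemma sum_floor_divisor_sum:
  fixes a :: "nat \<Rightarrow> real"
  shows "(\<Sum>n\<in>pos_upto x. a n * of_int \<lfloor>x / n\<rfloor>) = (\<Sum>m\<in>pos_upto x. \<Sum>d | d dvd m. a d)"
  using sum_divisors_pos_upto[of "\<lambda>d _. a d" x]
  by (auto intro!: sum.cong simp: card_pos_upto pos_upto_def[of x])

lemma sum_recip_moebius_recip_sum:
  assumes "x \<ge> 1"
  shows "(\<Sum>n\<in>pos_upto x. moebius_recip_sum (x / n) / n) = 1"
proof -
  have "(\<Sum>n\<in>pos_upto x. moebius_recip_sum (x / n) / n) =
        (\<Sum>n\<in>pos_upto x. \<Sum>e\<in>pos_upto (x / n). of_int (moebius_mu e) / (real n * real e))"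
    by (simp add: moebius_recip_sum_def sum_divide_distrib mult.commute)
  also have "\<dots> = (\<Sum>m\<in>pos_upto x. \<Sum>d | d dvd m. of_int (moebius_mu (m div d)) / (real d * real (m div d)))"
    by (rule sum_divisors_pos_upto[symmetric])
  also have "\<dots> = (\<Sum>m\<in>pos_upto x. if m = 1 then 1 else 0)"
  proof (rule sum.cong[OF refl])
    fix m assume m: "m \<in> pos_upto x"
    have "(\<Sum>d | d dvd m. of_int (moebius_mu (m div d)) / (real d * real (m div d))) =
          (\<Sum>d | d dvd m. of_int (moebius_mu (m div d)) / m)"
      by (intro sum.cong refl) (auto simp flip: of_nat_mult)
    also have "\<dots> = (\<Sum>d | d dvd m. of_int (moebius_mu d) / m)"
      by (rule sum.reindex_bij_witness[of _ "\<lambda>d. m div d" "\<lambda>d. m div d"])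
         (use m in \<open>auto simp: pos_upto_def elim!: dvdE\<close>)
    also have "\<dots> = (if m = 1 then 1 else 0)"
      using sum_divisors_moebius_mu[of m] m by (simp add: pos_upto_def flip: sum_divide_distrib)
    finally show "(\<Sum>d | d dvd m. of_int (moebius_mu (m div d)) / (real d * real (m div d))) = (if m = 1 then 1 else 0 :: real)" .
  qed
  also have "\<dots> = 1" using assms by (rule sum_pos_upto_one)
  finally show ?thesis .
qed

text \<open>The floor part of \<open>frac\<close> yields divisor sums directly. The main term
  \<open>x * (\<Sum>n\<in>pos_upto x. a n / n)\<close> does not; inserting the identity
  \<open>sum_recip_moebius_recip_sum\<close> at \<open>x / d\<close> as a factor 1 turns it into a
  sum over \<open>m = d * e\<close> with the same divisor sums as coefficients. Thus wherever the
  divisor sum of \<open>a\<close> vanishes, both parts vanish.\<close>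

lemma sum_frac_eq:
  fixes a :: "nat \<Rightarrow> real"
  assumes "x \<ge> 1"
  shows "(\<Sum>n\<in>pos_upto x. a n * frac (x / n)) =
         (\<Sum>m\<in>pos_upto x. (\<Sum>d | d dvd m. a d) * (x / m * moebius_recip_sum (x / m) - 1))"
proof -
  have "(\<Sum>m\<in>pos_upto x. (\<Sum>d | d dvd m. a d) / m * moebius_recip_sum (x / m)) =
        (\<Sum>m\<in>pos_upto x. \<Sum>d | d dvd m. a d / (real d * real (m div d)) * moebius_recip_sum (x / (real d * real (m div d))))"
    by (intro sum.cong refl) (auto simp: sum_divide_distrib sum_distrib_right simp flip: of_nat_mult)
  also have "\<dots> = (\<Sum>d\<in>pos_upto x. \<Sum>e\<in>pos_upto (x / d). a d / (real d * real e) * moebius_recip_sum (x / (real d * real e)))"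
    by (rule sum_divisors_pos_upto)
  also have "\<dots> = (\<Sum>d\<in>pos_upto x. a d / d * (\<Sum>e\<in>pos_upto (x / d). moebius_recip_sum (x / d / e) / e))"
    by (simp add: sum_distrib_left mult_ac)
  also have "\<dots> = (\<Sum>d\<in>pos_upto x. a d / d)"
  proof (intro sum.cong refl)
    fix d assume "d \<in> pos_upto x"
    hence "x / d \<ge> 1" by (simp add: pos_upto_def)
    from sum_recip_moebius_recip_sum[OF this]
    show "a d / d * (\<Sum>e\<in>pos_upto (x / d). moebius_recip_sum (x / d / e) / e) = a d / d" by simp
  qed
  finally have 1: "(\<Sum>m\<in>pos_upto x. (\<Sum>d | d dvd m. a d) / m * moebius_recip_sum (x / m)) = (\<Sum>d\<in>pos_upto x. a d / d)" .
  have "(\<Sum>n\<in>pos_upto x. a n * frac (x / n)) = x * (\<Sum>n\<in>pos_upto x. a n / n) - (\<Sum>n\<in>pos_upto x. a n * of_int \<lfloor>x / n\<rfloor>)"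
    by (simp add: frac_def algebra_simps sum_subtractf sum_distrib_left)
  also have "\<dots> = (\<Sum>m\<in>pos_upto x. x * ((\<Sum>d | d dvd m. a d) / m * moebius_recip_sum (x / m)) - (\<Sum>d | d dvd m. a d))"
    unfolding 1[symmetric] sum_floor_divisor_sum by (simp add: sum_distrib_left sum_subtractf)
  also have "\<dots> = (\<Sum>m\<in>pos_upto x. (\<Sum>d | d dvd m. a d) * (x / m * moebius_recip_sum (x / m) - 1))"
    by (intro sum.cong refl) (simp add: algebra_simps)
  finally show ?thesis .
qed

lemma abs_moebius_mu_le: "\<bar>real_of_int (moebius_mu n)\<bar> \<le> 1"
  by (simp add: moebius_mu_def power_abs)

text \<open>Moebius inversion evaluates the sum of
  \<open>moebius_mu n * \<lfloor>x / n\<rfloor>\<close> as 1, so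
  \<open>x * moebius_recip_sum x\<close> is 1 plus a sum of fractional parts with signs or zero
  coefficients.\<close>

lemma abs_moebius_recip_sum_le: "\<bar>moebius_recip_sum x\<bar> \<le> 1"
proof (cases "x \<ge> 1")
  case True
  have "(\<Sum>n\<in>pos_upto x. real_of_int (moebius_mu n) * of_int \<lfloor>x / n\<rfloor>) = (\<Sum>m\<in>pos_upto x. if m = 1 then 1 else 0)"
    unfolding sum_floor_divisor_sum by (intro sum.cong refl sum_divisors_moebius_mu) (auto simp: pos_upto_def)
  also have "\<dots> = 1" using True by (rule sum_pos_upto_one)
  finally have "x * moebius_recip_sum x = 1 + (\<Sum>n\<in>pos_upto x. of_int (moebius_mu n) * frac (x / n))"
    by (simp add: frac_def algebra_simps sum_subtractf sum_distrib_left moebius_recip_sum_def)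
  also have "\<bar>\<dots>\<bar> \<le> 1 + (\<Sum>n\<in>pos_upto x. \<bar>of_int (moebius_mu n) * frac (x / n)\<bar>)"
    by (intro order_trans[OF abs_triangle_ineq] add_mono sum_abs) auto
  also have "(\<Sum>n\<in>pos_upto x. \<bar>of_int (moebius_mu n) * frac (x / n)\<bar>) \<le> (\<Sum>n\<in>pos_upto x. frac (x / n))"
    using abs_moebius_mu_le by (intro sum_mono) (auto simp: abs_mult intro!: mult_left_le_one_le)
  \<comment> \<open>The term \<open>n = 1\<close> is kept exactly and the others are bounded by 1:
    then \<open>1 + frac x + (\<lfloor>x\<rfloor> - 1)\<close> is exactly \<open>x\<close>.\<close>
  also have "\<dots> = frac x + (\<Sum>n\<in>pos_upto x - {1}. frac (x / n))"
  proof (subst sum.remove[of _ 1])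
    show "1 \<in> pos_upto x" using True by (simp add: pos_upto_def)
  qed auto
  also have "(\<Sum>n\<in>pos_upto x - {1}. frac (x / n)) \<le> (\<Sum>n\<in>pos_upto x - {1}. 1)"
    by (intro sum_mono) (auto intro: less_imp_le frac_lt_1)
  also have "(\<Sum>n\<in>pos_upto x - {1}. 1) = real (card (pos_upto x)) - 1"
  proof -
    have "1 \<in> pos_upto x" using True by (simp add: pos_upto_def)
    thus ?thesis by (simp add: card_Diff_singleton of_nat_diff card_gt_0_iff Suc_le_eq) (metis card_gt_0_iff One_nat_def Suc_leI empty_iff finite_pos_upto of_nat_1 of_nat_diff)
  qed
  also have "1 + (frac x + (real (card (pos_upto x)) - 1)) = x" using True by (simp add: card_pos_upto frac_def)
  finally show ?thesis using True by (simp add: abs_mult)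
next
  case False
  hence "pos_upto x = {}" by (auto simp: pos_upto_def)
  thus ?thesis by (simp add: moebius_recip_sum_def)
qed

section \<open>The zeta function near the line Re s = 1\<close>

text \<open>This is \<open>n\<close> to the power \<open>- s\<close>, written as an exponential so
  that it is entire in \<open>s\<close>. In particular \<open>npow s 0\<close> is not 0, which is
  why the zeta series carries the factor \<open>of_bool (n > 0)\<close>.\<close>

definition npow :: "complex \<Rightarrow> nat \<Rightarrow> complex" where
  "npow s n = exp (- s * of_real (ln (real n)))"

lemma npow_mult: "a > 0 \<Longrightarrow> b > 0 \<Longrightarrow> npow s (a * b) = npow s a * npow s b"
  by (simp add: npow_def ln_mult algebra_simps flip: exp_add)

lemma npow_1 [simp]: "npow s (Suc 0) = 1"
  by (simp add: npow_def)

lemma norm_npow: "norm (npow s n) = exp (- Re s * ln (real n))"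
  by (simp add: npow_def)

lemma norm_npow': "n > 0 \<Longrightarrow> norm (npow s n) = real n powr (- Re s)"
  by (simp add: norm_npow powr_def)

lemma npow_holomorphic [holomorphic_intros]: "(\<lambda>s. npow s n) holomorphic_on A"
  unfolding npow_def by (intro holomorphic_intros)

lemma summable_norm_npow:
  assumes "Re s > 1"
  shows "summable (\<lambda>n. norm (npow s n))"
proof (rule summable_comparison_test_ev)
  show "summable (\<lambda>n. real n powr (- Re s))" using assms by (simp add: summable_real_powr_iff)
  show "eventually (\<lambda>n. norm (norm (npow s n)) \<le> real n powr (- Re s)) sequentially"
    using eventually_gt_at_top[of 0] by eventually_elim (simp add: norm_npow')
qed

text \<open>Partial summation: the term \<open>a n\<close> enters the summatory function at
  \<open>u = ln n\<close>, and the transform of that step is \<open>a n * npow s n / s\<close>. It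
  is applied to the tail of the zeta series and to \<open>moebius_mu n / n\<close>.\<close>

lemma laplace_summatory:
  fixes a :: "nat \<Rightarrow> complex"
  assumes a0: "a 0 = 0" and s: "Re s > 0" and sm: "summable (\<lambda>n. norm (a n * npow s n))"
  shows "(\<lambda>n. a n * npow s n) sums (s * laplace (\<lambda>u. \<Sum>n\<in>pos_upto (exp u). a n) s)"
proof -
  define F where "F = (\<lambda>n u. a n * (indicator {ln (real n)..} u * exp (- s * complex_of_real u)))"
  have lnu: "ln (real n) \<le> u \<longleftrightarrow> real n \<le> exp u" if "n > 0" for n u
    using that by (metis exp_le_cancel_iff exp_ln of_nat_0_less_iff)
  have int: "integrable lborel (F n)" for n
    unfolding F_def by (intro integrable_mult_right integrable_cexp_atLeast s)
  have nF: "(\<integral>u. norm (F n u) \<partial>lborel) = norm (a n * npow s n) / Re s" for n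
  proof -
    have "(\<lambda>u. norm (F n u)) = (\<lambda>u. norm (a n) * (indicator {ln (real n)..} u * exp (- Re s * u)))"
      by (auto simp: F_def norm_mult indicator_def fun_eq_iff)
    hence "(\<integral>u. norm (F n u) \<partial>lborel) = norm (a n) * (exp (- Re s * ln (real n)) / Re s)"
      using integrable_exp_atLeast(2)[OF s] by (simp only: integral_mult_right_zero)
    thus ?thesis by (simp add: norm_mult norm_npow)
  qed
  have Fs: "(\<lambda>n. F n u) sums ((\<Sum>n\<in>pos_upto (exp u). a n) * exp (- s * complex_of_real u))" for u
  proof -
    have "F n u = 0" if "n \<notin> pos_upto (exp u)" for n
      using that a0 by (cases "n = 0") (auto simp: F_def pos_upto_def indicator_def lnu)
    hence "(\<lambda>n. F n u) sums (\<Sum>n\<in>pos_upto (exp u). F n u)" by (intro sums_finite) auto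
    also have "(\<Sum>n\<in>pos_upto (exp u). F n u) = (\<Sum>n\<in>pos_upto (exp u). a n * exp (- s * complex_of_real u))"
    proof (intro sum.cong refl)
      fix n assume n: "n \<in> pos_upto (exp u)"
      hence "ln (real n) \<le> u" by (simp add: pos_upto_def lnu)
      thus "F n u = a n * exp (- s * complex_of_real u)" by (simp add: F_def)
    qed
    finally show ?thesis by (simp add: sum_distrib_right)
  qed
  have "(\<lambda>n. integral\<^sup>L lborel (F n)) sums (\<integral>u. (\<Sum>n. F n u) \<partial>lborel)"
  proof (rule sums_integral[OF int])
    show "AE u in lborel. summable (\<lambda>n. norm (F n u))"
    proof (intro AE_I2)
      fix u
      have "F n u = 0" if "n \<notin> pos_upto (exp u)" for n
        using that a0 by (cases "n = 0") (auto simp: F_def pos_upto_def indicator_def lnu)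
      thus "summable (\<lambda>n. norm (F n u))" by (intro summable_finite[of "pos_upto (exp u)"]) auto
    qed
    show "summable (\<lambda>n. \<integral>u. norm (F n u) \<partial>lborel)"
      unfolding nF by (intro summable_divide sm)
  qed
  also have "(\<integral>u. (\<Sum>n. F n u) \<partial>lborel) = laplace (\<lambda>u. \<Sum>n\<in>pos_upto (exp u). a n) s"
    unfolding laplace_def by (simp only: sums_unique[OF Fs, symmetric])
  also have "(\<lambda>n. integral\<^sup>L lborel (F n)) = (\<lambda>n. a n * npow s n / s)"
    by (simp only: F_def integral_mult_right_zero integrable_cexp_atLeast(2)[OF s] npow_def times_divide_eq_right)
  finally have "(\<lambda>n. s * (a n * npow s n / s)) sums (s * laplace (\<lambda>u. \<Sum>n\<in>pos_upto (exp u). a n) s)"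
    by (rule sums_mult)
  moreover have "s \<noteq> 0" using s by auto
  ultimately show ?thesis by simp
qed

text \<open>In the variable \<open>y = exp u\<close>, its transform is the integral of
  \<open>frac y * y powr (- s - 1)\<close> from \<open>N\<close> on, the remainder in Euler
  summation.\<close>

definition frac_tail :: "nat \<Rightarrow> real \<Rightarrow> complex" where
  "frac_tail N u = indicator {ln (real N)..} u * of_real (frac (exp u))"

lemma norm_frac_tail_le: "norm (frac_tail N u) \<le> indicator {ln (real N)..} u"
  using frac_lt_1[of "exp u"] by (auto simp: frac_tail_def indicator_def frac_ge_0 intro: less_imp_le)

lemma causal_frac_tail:
  assumes "N > 0" shows "causal (frac_tail N)"
proof (rule causal_bounded)
  show "frac_tail N \<in> borel_measurable borel" unfolding frac_tail_def[abs_def] frac_def by measurable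
  have "ln (real N) \<ge> 0" using assms by (simp add: ln_ge_zero)
  thus "u < 0 \<Longrightarrow> frac_tail N u = 0" for u by (simp add: frac_tail_def)
  show "norm (frac_tail N u) \<le> 1" for u
    using norm_frac_tail_le[of N u] by (auto simp: indicator_def split: if_splits intro: order_trans)
qed

text \<open>For \<open>u \<ge> ln N\<close> the number of \<open>n > N\<close> up to
  \<open>exp u\<close> is \<open>exp u - N - frac (exp u)\<close>. The first part produces the pole
  at 1, the last one converges for \<open>Re s > 0\<close>.\<close>

lemma zeta_tail_sums:
  assumes s: "Re s > 1" and N: "N > 0"
  shows "(\<lambda>n. of_bool (n > N) * npow s n) sums (N * npow s N / (s - 1) - s * laplace (frac_tail N) s)"
proof -
  have s0: "Re s > 0" "s \<noteq> 0" "s - 1 \<noteq> 0" "Re (s - 1) > 0" using s by auto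
  let ?I = "\<lambda>u. indicator {ln (real N)..} u :: complex"
  have A: "(\<Sum>n\<in>pos_upto (exp u). of_bool (n > N)) = ?I u * (of_real (exp u) - of_nat N) - frac_tail N u" for u
  proof -
    have "(\<Sum>n\<in>pos_upto (exp u). of_bool (n > N) :: complex) = of_nat (card (pos_upto (exp u) \<inter> {n. n > N}))"
      by simp
    also have "pos_upto (exp u) \<inter> {n. n > N} = {N<..nat \<lfloor>exp u\<rfloor>}" by (auto simp: pos_upto_eq)
    also have "card \<dots> = nat \<lfloor>exp u\<rfloor> - N" by simp
    also have "of_nat (nat \<lfloor>exp u\<rfloor> - N) = ?I u * (of_real (exp u) - of_nat N) - frac_tail N u"
    proof (cases "u \<ge> ln (real N)")
      case True
      hence "real N \<le> exp u" using N by (metis exp_le_cancel_iff exp_ln of_nat_0_less_iff)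
      hence "N \<le> nat \<lfloor>exp u\<rfloor>" by (simp add: le_nat_iff le_floor_iff)
      hence "of_nat (nat \<lfloor>exp u\<rfloor> - N) = complex_of_real (of_int \<lfloor>exp u\<rfloor>) - of_nat N"
        by (simp add: of_nat_diff)
      thus ?thesis using True by (simp add: frac_tail_def frac_def)
    next
      case False
      hence "exp u < real N" using N by (metis exp_less_cancel_iff exp_ln not_le of_nat_0_less_iff)
      hence "nat \<lfloor>exp u\<rfloor> - N = 0" by (simp add: nat_le_iff) linarith
      thus ?thesis using False by (simp add: frac_tail_def)
    qed
    finally show ?thesis .
  qed
  have e: "exp (- (s - 1) * of_real (ln (real N))) = N * npow s N"
  proof -
    have "exp (- (s - 1) * of_real (ln (real N))) = exp (of_real (ln (real N))) * npow s N"
      by (simp add: npow_def ring_distribs flip: exp_add)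
    also have "exp (complex_of_real (ln (real N))) = N" using N by (simp add: exp_of_real)
    finally show ?thesis .
  qed
  have "laplace (\<lambda>u. \<Sum>n\<in>pos_upto (exp u). of_bool (n > N)) s =
     (\<integral>u. ?I u * exp (- (s - 1) * of_real u) - N * (?I u * exp (- s * of_real u)) - frac_tail N u * exp (- s * of_real u) \<partial>lborel)"
    unfolding laplace_def A
    by (intro Bochner_Integration.integral_cong refl)
       (simp add: algebra_simps flip: exp_of_real exp_add)
  also have "\<dots> = exp (- (s - 1) * of_real (ln (real N))) / (s - 1) - N * (npow s N / s) - laplace (frac_tail N) s"
    unfolding laplace_def npow_def
      integrable_cexp_atLeast(2)[OF s0(1), symmetric] integrable_cexp_atLeast(2)[OF s0(4), symmetric]
    by (subst Bochner_Integration.integral_diff Bochner_Integration.integral_mult_right_zero |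
        intro integrable_causal causal_frac_tail N s0 Bochner_Integration.integrable_diff integrable_mult_right integrable_cexp_atLeast refl)+
  finally have "s * laplace (\<lambda>u. \<Sum>n\<in>pos_upto (exp u). of_bool (n > N)) s =
     N * npow s N / (s - 1) - s * laplace (frac_tail N) s"
    unfolding e using s0 by (simp add: field_simps)
  moreover have "summable (\<lambda>n. norm (of_bool (n > N) * npow s n))"
    by (rule summable_comparison_test'[OF summable_norm_npow[OF s], of 0]) (auto simp: norm_mult)
  ultimately show ?thesis using laplace_summatory[of "\<lambda>n. of_bool (n > N)" s] s0 by simp
qed

text \<open>
  This is \<open>(s - 1) * \<zeta> s\<close> for every \<open>N > 0\<close>; choosing \<open>N\<close> close to \<open>1 + \<bar>Im s\<bar>\<close> balances the terms.
\<close>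

definition zeta_reg_split :: "nat \<Rightarrow> complex \<Rightarrow> complex" where
  "zeta_reg_split N s = (s - 1) * (\<Sum>n\<in>{1..N}. npow s n) + N * npow s N - s * (s - 1) * laplace (frac_tail N) s"

definition zeta_reg :: "complex \<Rightarrow> complex" where
  "zeta_reg = zeta_reg_split 1"

definition zeta_series :: "complex \<Rightarrow> complex" where
  "zeta_series s = (\<Sum>n. of_bool (n > 0) * npow s n)"

lemma zeta_series_sums:
  assumes "Re s > 1"
  shows "(\<lambda>n. of_bool (n > 0) * npow s n) sums zeta_series s"
proof -
  have "summable (\<lambda>n. of_bool (n > 0) * npow s n)"
    by (rule summable_comparison_test'[OF summable_norm_npow[OF assms], of 0]) (auto simp: norm_mult)
  thus ?thesis by (simp add: zeta_series_def summable_sums)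
qed

lemma zeta_reg_split_eq_series:
  assumes "Re s > 1" "N > 0"
  shows "zeta_reg_split N s = (s - 1) * zeta_series s"
proof -
  have "(\<lambda>n. of_bool (n > N) * npow s n + of_bool (n \<in> {1..N}) * npow s n) sums
     ((N * npow s N / (s - 1) - s * laplace (frac_tail N) s) + (\<Sum>n\<in>{1..N}. of_bool (n \<in> {1..N}) * npow s n))"
    by (intro sums_add zeta_tail_sums assms sums_finite) auto
  also have "(\<lambda>n. of_bool (n > N) * npow s n + of_bool (n \<in> {1..N}) * npow s n) = (\<lambda>n. of_bool (n > 0) * npow s n)"
    using assms by (auto simp: fun_eq_iff)
  finally have "zeta_series s = (N * npow s N / (s - 1) - s * laplace (frac_tail N) s) + (\<Sum>n\<in>{1..N}. npow s n)"
    using zeta_series_sums[OF assms(1)] sums_unique2 by auto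
  moreover have "s - 1 \<noteq> 0" using assms by auto
  ultimately show ?thesis by (simp add: zeta_reg_split_def field_simps)
qed

lemma zeta_reg_split_holomorphic:
  "N > 0 \<Longrightarrow> zeta_reg_split N holomorphic_on {s. Re s > 0}"
  unfolding zeta_reg_split_def[abs_def] by (intro holomorphic_intros laplace_holomorphic causal_frac_tail)

lemma zeta_reg_holomorphic: "zeta_reg holomorphic_on {s. Re s > 0}"
  unfolding zeta_reg_def by (rule zeta_reg_split_holomorphic) simp

text \<open>The identity theorem carries the agreement from \<open>Re s > 1\<close> to the left;
  this permits \<open>N\<close> to depend on \<open>s\<close> in the growth bound.\<close>

lemma zeta_reg_eq_split:
  assumes "N > 0" "Re s > 0"
  shows "zeta_reg s = zeta_reg_split N s"
proof (rule analytic_continuation_open[where f = zeta_reg and g = "zeta_reg_split N" and s = "{s. Re s > 1}" and s' = "{s. Re s > 0}"])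
  show "{s. Re s > 1} \<noteq> {}" by (auto intro: exI[of _ 2])
  show "connected {s. Re s > 0}" by (intro convex_connected convex_halfspace_Re_gt)
  fix z assume "z \<in> {s. 1 < Re s}"
  thus "zeta_reg z = zeta_reg_split N z" using assms by (simp add: zeta_reg_def zeta_reg_split_eq_series)
qed (use assms in \<open>auto simp: open_halfspace_Re_gt intro: zeta_reg_holomorphic zeta_reg_split_holomorphic\<close>)

lemma zeta_reg_1 [simp]: "zeta_reg 1 = 1"
  by (simp add: zeta_reg_def zeta_reg_split_def)

lemma zeta_reg_eq_series: "Re s > 1 \<Longrightarrow> zeta_reg s = (s - 1) * zeta_series s"
  by (simp add: zeta_reg_def zeta_reg_split_eq_series)

lemma power_20_powr: "x > 0 \<Longrightarrow> (x ^ 20) powr (1/20) = (x :: real)"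
  using powr_powr[of x 20 "1/20"] powr_realpow[of x 20] by simp

text \<open>Bernoulli's inequality for the exponent 20 shows that \<open>20 * y powr (1/20)\<close>
  increases by at least \<open>y powr (-19/20)\<close> from \<open>y - 1\<close> to
  \<open>y\<close>.\<close>

lemma sum_powr_le:
  "(\<Sum>n\<in>{1..N}. real n powr (-19/20)) \<le> 20 * real N powr (1/20)"
proof (induction N)
  case (Suc N)
  define y where "y = real (Suc N)"
  have y: "y \<ge> 1" by (simp add: y_def)
  have "1 + 20 * (- 1 / (20 * y)) \<le> (1 + - 1 / (20 * y)) ^ 20"
    using Bernoulli_inequality[of "- 1 / (20 * y)" 20] y by (simp add: field_simps)
  hence "real N / y \<le> (1 - 1 / (20 * y)) ^ 20" by (simp add: y_def field_simps)
  hence "(real N / y) powr (1/20) \<le> ((1 - 1 / (20 * y)) ^ 20) powr (1/20)"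
    using y by (intro powr_mono2) auto
  also have "\<dots> = 1 - 1 / (20 * y)"
  proof -
    have "1 - 1 / (20 * y) > 0" using y by (simp add: field_simps)
    thus ?thesis by (rule power_20_powr)
  qed
  finally have "(real N / y) powr (1/20) * y powr (1/20) \<le> (1 - 1 / (20 * y)) * y powr (1/20)"
    by (intro mult_right_mono) auto
  also have "(real N / y) powr (1/20) * y powr (1/20) = real N powr (1/20)"
    using y by (simp add: powr_divide)
  also have "(1 - 1 / (20 * y)) * y powr (1/20) = y powr (1/20) - y powr (1/20) / y / 20"
    by (simp add: left_diff_distrib)
  also have "y powr (1/20) / y = y powr (-19/20)"
    using y powr_diff[of y "1/20" 1] by simp
  finally have "real N powr (1/20) \<le> y powr (1/20) - y powr (-19/20) / 20" .
  with Suc show ?case by (simp add: y_def)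
qed auto

text \<open>
  With this exponent all growth rates are natural powers of the height: \<open>(s - 1) * \<zeta> s\<close> is at most
  \<open>height s ^ 21\<close> and at least \<open>height s ^ 16\<close> near the line 1, up to constants, and eight
  derivatives on discs of radius \<open>height s ^ (-5)\<close> cost \<open>height s ^ 40 = (1 + \<bar>Im s\<bar>) ^ 2\<close>.
\<close>

definition height :: "complex \<Rightarrow> real" where
  "height s = (1 + \<bar>Im s\<bar>) powr (1/20)"

lemma height_ge_1: "height s \<ge> 1" by (simp add: height_def ge_one_powr_ge_zero)

lemma height_pow_20: "height s ^ 20 = 1 + \<bar>Im s\<bar>"
  by (simp add: height_def powr_powr flip: powr_realpow)

lemma zeta_reg_bound:
  assumes "19/20 \<le> Re s" "Re s \<le> 3"
  shows "norm (zeta_reg s) \<le> 65 * height s ^ 21"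
proof -
  define y where "y = 1 + \<bar>Im s\<bar>"
  define N where "N = nat \<lfloor>y\<rfloor>"
  have y: "y \<ge> 1" by (simp add: y_def)
  have N: "N > 0" "real N \<le> y" "y \<le> 2 * real N"
  proof -
    have "1 \<le> \<lfloor>y\<rfloor>" using y by (simp add: le_floor_iff)
    thus "N > 0" "real N \<le> y" "y \<le> 2 * real N" unfolding N_def by (simp_all, linarith+)
  qed
  have hy: "height s = y powr (1/20)" by (simp add: height_def y_def)
  have hy20: "height s ^ 20 = y" by (simp add: height_pow_20 y_def)
  have h1: "height s \<ge> 1" by (rule height_ge_1)
  have np: "norm (npow s n) \<le> real n powr (-19/20)" if "n > 0" for n
    using that assms by (subst norm_npow') (auto intro!: powr_mono)
  have Nh: "real N powr (1/20) \<le> height s" unfolding hy using N by (intro powr_mono2) auto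
  have "norm (\<Sum>n\<in>{1..N}. npow s n) \<le> (\<Sum>n\<in>{1..N}. real n powr (-19/20))"
    by (intro order_trans[OF norm_sum] sum_mono np) auto
  also have "\<dots> \<le> 20 * height s" using sum_powr_le[of N] Nh by linarith
  finally have a: "norm (\<Sum>n\<in>{1..N}. npow s n) \<le> 20 * height s" .
  have ns: "norm s \<le> 3 * y" "norm (s - 1) \<le> 2 * y"
    using cmod_le[of s] cmod_le[of "s - 1"] assms y by (auto simp: y_def)
  have NN: "real N * real N powr (-19/20) = real N powr (1/20)"
    using N powr_add[of "real N" 1 "-19/20"] by simp
  have b: "norm (N * npow s N) \<le> height s"
  proof -
    have "norm (N * npow s N) \<le> real N * real N powr (-19/20)"
      using np[OF N(1)] by (auto simp: norm_mult intro!: mult_left_mono)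
    thus ?thesis using Nh NN by linarith
  qed
  have "norm (laplace (frac_tail N) s) \<le> 1 * exp (- (Re s - 0) * ln (real N)) / (Re s - 0)"
    by (rule norm_laplace_le) (use causal_frac_tail N assms norm_frac_tail_le in auto)
  also have "\<dots> \<le> real N powr (-19/20) / (1/2)"
    using np[OF N(1)] assms by (intro frac_le) (auto simp: norm_npow)
  finally have c: "norm (laplace (frac_tail N) s) \<le> 2 * real N powr (-19/20)" by simp
  have d: "y * real N powr (-19/20) \<le> 2 * height s"
  proof -
    have "y * real N powr (-19/20) \<le> 2 * real N * real N powr (-19/20)" using N by (intro mult_right_mono) auto
    thus ?thesis using NN Nh by simp
  qed
  have "norm (zeta_reg s) \<le> norm ((s - 1) * (\<Sum>n\<in>{1..N}. npow s n)) + norm (N * npow s N) + norm (s * (s - 1) * laplace (frac_tail N) s)"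
    using zeta_reg_eq_split[OF N(1), of s] assms
    by (auto simp: zeta_reg_split_def intro!: order_trans[OF norm_triangle_ineq4] add_right_mono norm_triangle_ineq)
  \<comment> \<open>The constant 65 is 40 + 1 + 24: the truncated sum, the boundary term, and the
    remainder, where one factor \<open>y\<close> together with \<open>real N powr (-19/20)\<close>
    is at most \<open>2 * height s\<close>.\<close>
  also have "\<dots> \<le> 2 * y * (20 * height s) + height s + (3 * y) * (2 * y) * (2 * real N powr (-19/20))"
    unfolding norm_mult[of "s - 1"] norm_mult[of _ "laplace _ _"] norm_mult[of s]
    using y h1 by (intro add_mono mult_mono a b c ns) auto
  also have "\<dots> \<le> 65 * (y * height s)"
  proof -
    have "12 * y * (y * real N powr (-19/20)) \<le> 12 * y * (2 * height s)"
      using y by (intro mult_left_mono d) auto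
    moreover have "1 * height s \<le> y * height s" using y h1 by (intro mult_right_mono) auto
    ultimately show ?thesis by (simp add: mult_ac)
  qed
  also have "\<dots> = 65 * height s ^ 21" by (simp add: hy20[symmetric] flip: power_Suc2)
  finally show ?thesis .
qed

section \<open>The Dirichlet series of the Moebius function and its Euler product\<close>

lemma has_sum_npow:
  assumes "Re s > 1" shows "(npow s has_sum zeta_series s) {0<..}"
proof -
  have "((\<lambda>n. of_bool (n > 0) * npow s n) has_sum zeta_series s) UNIV"
    by (rule norm_summable_imp_has_sum[OF _ zeta_series_sums[OF assms]])
       (rule summable_comparison_test'[OF summable_norm_npow[OF assms], of 0], auto simp: norm_mult)
  thus ?thesis by (rule has_sum_cong_neutral[THEN iffD1, rotated -1]) auto
qed

definition moebius_series :: "complex \<Rightarrow> complex" where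
  "moebius_series s = (\<Sum>n. of_int (moebius_mu n) * npow s n)"

lemma moebius_mu_0 [simp]: "moebius_mu 0 = 0"
  by (simp add: moebius_mu_def)

lemma norm_moebius_npow_le: "norm (of_int (moebius_mu n) * npow s n) \<le> norm (npow s n)"
proof -
  have "norm (of_int (moebius_mu n) :: complex) \<le> 1" using abs_moebius_mu_le[of n] by simp
  thus ?thesis unfolding norm_mult by (intro mult_left_le_one_le) auto
qed

lemma summable_norm_moebius_npow:
  assumes "Re s > 1" shows "summable (\<lambda>n. norm (of_int (moebius_mu n) * npow s n))"
  by (rule summable_comparison_test'[OF summable_norm_npow[OF assms], of 0]) (use norm_moebius_npow_le in auto)

lemma moebius_series_sums:
  assumes "Re s > 1" shows "(\<lambda>n. of_int (moebius_mu n) * npow s n) sums moebius_series s"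
  unfolding moebius_series_def by (rule summable_sums[OF summable_norm_cancel[OF summable_norm_moebius_npow[OF assms]]])

lemma has_sum_moebius_npow:
  assumes "Re s > 1" shows "((\<lambda>n. of_int (moebius_mu n) * npow s n) has_sum moebius_series s) UNIV"
  by (rule norm_summable_imp_has_sum[OF summable_norm_moebius_npow[OF assms] moebius_series_sums[OF assms]])

lemma has_sum_product_Times:
  fixes f :: "'a \<Rightarrow> complex" and g :: "'b \<Rightarrow> complex"
  assumes "(f has_sum S) A" "(g has_sum T) B" "(\<lambda>a. norm (f a)) summable_on A" "(\<lambda>b. norm (g b)) summable_on B"
  shows "((\<lambda>(a, b). f a * g b) has_sum (S * T)) (A \<times> B)"
proof (rule has_sum_SigmaI)
  show "((\<lambda>b. case (a, b) of (a, b) \<Rightarrow> f a * g b) has_sum (f a * T)) B" for a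
    using has_sum_cmult_right[OF assms(2)] by simp
  show "((\<lambda>a. f a * T) has_sum (S * T)) A" by (rule has_sum_cmult_left[OF assms(1)])
  have "(\<lambda>x. norm (case x of (a, b) \<Rightarrow> f a * g b)) summable_on (A \<times> B)"
  proof (subst Infinite_Sum.abs_summable_on_Sigma_iff, intro conjI ballI)
    show "(\<lambda>b. norm (case (a, b) of (a, b) \<Rightarrow> f a * g b)) summable_on B" for a
      using summable_on_cmult_right[OF assms(4)] by (simp add: norm_mult)
    have "(\<lambda>a. norm (f a) * (\<Sum>\<^sub>\<infinity>b\<in>B. norm (g b))) summable_on A"
      by (rule summable_on_cmult_left[OF assms(3)])
    thus "(\<lambda>a. norm (\<Sum>\<^sub>\<infinity>b\<in>B. norm (case (a, b) of (a, b) \<Rightarrow> f a * g b))) summable_on A"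
      by (simp add: norm_mult infsum_cmult_right' abs_mult infsum_nonneg)
  qed
  thus "(\<lambda>(a, b). f a * g b) summable_on (A \<times> B)" by (rule Infinite_Sum.abs_summable_summable)
qed

lemma moebius_series_mult_zeta_series:
  assumes "Re s > 1" shows "moebius_series s * zeta_series s = 1"
proof -
  let ?m = "\<lambda>n. of_int (moebius_mu n) * npow s n"
  have hs: "(?m has_sum moebius_series s) {0<..}"
    by (rule has_sum_cong_neutral[THEN iffD1, OF _ _ _ has_sum_moebius_npow[OF assms]]) auto
  have abs2: "(\<lambda>n. norm (npow s n)) summable_on {0<..}"
    by (rule summable_on_subset_banach[OF norm_summable_imp_summable_on]) (use summable_norm_npow[OF assms] in auto)
  have abs1: "(\<lambda>n. norm (?m n)) summable_on {0<..}"
    by (rule summable_on_subset_banach[OF norm_summable_imp_summable_on]) (use summable_norm_moebius_npow[OF assms] in auto)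
  have "((\<lambda>(a, b). ?m a * npow s b) has_sum (moebius_series s * zeta_series s)) ({0<..} \<times> {0<..})"
    by (rule has_sum_product_Times[OF hs has_sum_npow[OF assms] abs1 abs2])
  also have "?this \<longleftrightarrow> ((\<lambda>(n, d). ?m d * npow s (n div d)) has_sum (moebius_series s * zeta_series s)) (SIGMA n:{0<..}. {d. d dvd n})"
    by (rule has_sum_reindex_bij_witness[of _ "\<lambda>(n, d). (d, n div d)" "\<lambda>(a, b). (a * b, a)"])
       (auto elim!: dvdE)
  finally have "((\<lambda>n. \<Sum>d | d dvd n. ?m d * npow s (n div d)) has_sum (moebius_series s * zeta_series s)) {0<..}"
    by (rule has_sum_SigmaD) (auto intro!: has_sum_finite finite_divisors_nat)
  also have "?this \<longleftrightarrow> ((\<lambda>n. 1) has_sum (moebius_series s * zeta_series s)) {1::nat}"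
  proof (rule has_sum_cong_neutral)
    have eq: "(\<Sum>d | d dvd n. ?m d * npow s (n div d)) = npow s n * of_bool (n = 1)" if "n > 0" for n
    proof -
      have "(\<Sum>d | d dvd n. ?m d * npow s (n div d)) = (\<Sum>d | d dvd n. npow s n * of_real (of_int (moebius_mu d)))"
      proof (intro sum.cong refl)
        fix d assume "d \<in> {d. d dvd n}"
        then obtain e where e: "n = d * e" by (auto elim: dvdE)
        with that have "d > 0" "e > 0" by auto
        thus "?m d * npow s (n div d) = npow s n * of_real (of_int (moebius_mu d))" by (simp add: e npow_mult)
      qed
      also have "\<dots> = npow s n * of_real (\<Sum>d | d dvd n. of_int (moebius_mu d))"
        by (simp only: sum_distrib_left of_real_sum)
      also have "\<dots> = npow s n * of_bool (n = 1)" using sum_divisors_moebius_mu[OF that] by simp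
      finally show ?thesis .
    qed
    show "(\<Sum>d | d dvd n. ?m d * npow s (n div d)) = 0" if "n \<in> {0<..} - {1}" for n
      using that by (subst eq) auto
    show "(\<Sum>d | d dvd n. ?m d * npow s (n div d)) = 1" if "n \<in> {0<..} \<inter> {1}" for n
      using that by (subst eq) auto
  qed auto
  finally have "((\<lambda>n. 1) has_sum (moebius_series s * zeta_series s)) {1::nat}" .
  moreover have "((\<lambda>n. 1) has_sum (1::complex)) {1::nat}" by (rule has_sum_finiteI) auto
  ultimately show ?thesis by (rule has_sum_unique)
qed

lemma moebius_series_mult_zeta_reg:
  assumes "Re s > 1" shows "moebius_series s * zeta_reg s = s - 1"
  using moebius_series_mult_zeta_series[OF assms] by (simp add: zeta_reg_eq_series[OF assms])

text \<open>Each partial product expands into a finite sum over the squarefree integers composed of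
  primes up to \<open>N\<close>. These sets exhaust the squarefree integers, so unconditional
  convergence of the series gives the limit, without infinite products or logarithms.\<close>

lemma euler_product_moebius_series:
  assumes "Re s > 1"
  shows "(\<lambda>N. \<Prod>p | prime p \<and> p \<le> N. 1 - npow s p) \<longlonglongrightarrow> moebius_series s"
proof -
  define P where "P = (\<lambda>N::nat. {p. prime p \<and> p \<le> N})"
  define B where "B = (\<lambda>N. {n. squarefree n \<and> prime_factors n \<subseteq> P N})"
  have finP: "finite (P N)" for N by (simp add: P_def)
  have bij: "bij_betw \<Prod> (Pow (P N)) (B N)" for N
    unfolding B_def by (rule bij_betw_prod_primes[OF finP]) (simp add: P_def)
  let ?m = "\<lambda>n. of_int (moebius_mu n) * npow s n"
  have "(\<Prod>p\<in>P N. 1 - npow s p) = sum ?m (B N)" for N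
  proof -
    have "(\<Prod>p\<in>P N. 1 - npow s p) = (\<Sum>S\<in>Pow (P N). (-1) ^ card S * (\<Prod>p\<in>S. npow s p))"
      using prod_diff_conv_sum[OF finP, of "\<lambda>_. 1" "npow s"] by simp
    also have "\<dots> = (\<Sum>S\<in>Pow (P N). ?m (\<Prod>S))"
    proof (intro sum.cong refl)
      fix S assume "S \<in> Pow (P N)"
      hence S: "finite S" "\<And>p. p \<in> S \<Longrightarrow> prime p" using finP by (auto simp: P_def intro: finite_subset)
      have "npow s (\<Prod>S) = (\<Prod>p\<in>S. npow s p)" using S
        by (induction S rule: finite_induct) (auto simp: npow_mult prime_gt_0_nat prod_pos)
      thus "(-1) ^ card S * (\<Prod>p\<in>S. npow s p) = ?m (\<Prod>S)"
        using prime_factors_prod_primes(4)[OF S] by simp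
    qed
    also have "\<dots> = sum ?m (B N)" by (rule sum.reindex_bij_betw[OF bij])
    finally show ?thesis .
  qed
  moreover have "(\<lambda>N. sum ?m (B N)) \<longlonglongrightarrow> moebius_series s"
  proof -
    have hs: "(?m has_sum moebius_series s) {n. squarefree n}"
      by (rule has_sum_cong_neutral[THEN iffD1, OF _ _ _ has_sum_moebius_npow[OF assms]]) (auto simp: moebius_mu_def)
    have "filterlim B (finite_subsets_at_top {n. squarefree n}) sequentially"
      unfolding filterlim_finite_subsets_at_top
    proof safe
      fix X :: "nat set" assume X: "finite X" "X \<subseteq> {n. squarefree n}"
      show "eventually (\<lambda>N. finite (B N) \<and> X \<subseteq> B N \<and> B N \<subseteq> {n. squarefree n}) sequentially"
        using eventually_ge_at_top[of "Max X"]
      proof eventually_elim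
        case (elim N)
        have "prime_factors n \<subseteq> P N" if "n \<in> X" for n
        proof
          fix p assume p: "p \<in> prime_factors n"
          have "n \<noteq> 0" by (metis X(2) mem_Collect_eq not_squarefree_0 subsetD that)
          hence "p \<le> n" using p by (auto intro: dvd_imp_le)
          also have "n \<le> N" using elim Max_ge[OF X(1) that] by linarith
          finally show "p \<in> P N" using p by (auto simp: P_def)
        qed
        thus ?case using X bij_betw_finite[OF bij[of N]] finP[of N] by (auto simp: B_def)
      qed
    qed
    with hs show ?thesis unfolding has_sum_def by (rule filterlim_compose)
  qed
  ultimately show ?thesis by (simp add: P_def)
qed

text \<open>
  The inequality \<open>x \<le> exp (x - 1)\<close> replaces the logarithms of the classical 3-4-1 argument; the
  loss \<open>exp (8 * r ^ 2)\<close> is harmless because its product over all primes converges.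
\<close>

lemma euler_factor_bound:
  fixes r \<theta> :: real
  assumes "r \<ge> 0"
  defines "w \<equiv> of_real r * exp (\<i> * of_real \<theta>)" and "w2 \<equiv> of_real r * exp (\<i> * of_real (2 * \<theta>))"
  shows "norm (1 - complex_of_real r) ^ 6 * norm (1 - w) ^ 8 * norm (1 - w2) ^ 2 \<le> exp (8 * r\<^sup>2)"
proof -
  have n: "(norm (1 - of_real r * exp (\<i> * of_real x)))\<^sup>2 = 1 - 2 * r * cos x + r\<^sup>2" for x
  proof -
    have "(norm (1 - of_real r * exp (\<i> * of_real x)))\<^sup>2 = (1 - r * cos x)\<^sup>2 + (r * sin x)\<^sup>2"
      by (simp add: cmod_power2 Re_exp Im_exp)
    also have "\<dots> = 1 - 2 * r * cos x + r\<^sup>2"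
      using sin_cos_squared_add[of x] by algebra
    finally show ?thesis .
  qed
  define A B C where "A = (norm (1 - complex_of_real r))\<^sup>2" and "B = (norm (1 - w))\<^sup>2" and "C = (norm (1 - w2))\<^sup>2"
  have vals: "A = 1 - 2 * r + r\<^sup>2" "B = 1 - 2 * r * cos \<theta> + r\<^sup>2" "C = 1 - 2 * r * (2 * (cos \<theta>)\<^sup>2 - 1) + r\<^sup>2"
    using n[of 0] n[of \<theta>] n[of "2 * \<theta>"] by (simp_all add: A_def B_def C_def w_def w2_def cos_double_cos)
  have pos: "A \<ge> 0" "B \<ge> 0" "C \<ge> 0" by (simp_all add: A_def B_def C_def)
  have le: "x \<le> exp (x - 1)" for x :: real using exp_ge_add_one_self[of "x - 1"] by simp
  have "A ^ 3 * B ^ 4 * C \<le> exp (A - 1) ^ 3 * exp (B - 1) ^ 4 * exp (C - 1)"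
    using pos by (intro mult_mono power_mono le) auto
  also have "\<dots> = exp (3 * (A - 1) + 4 * (B - 1) + (C - 1))"
    unfolding exp_add using exp_of_nat_mult[of 3 "A - 1"] exp_of_nat_mult[of 4 "B - 1"] by simp
  \<comment> \<open>The classical identity \<open>3 + 4 * cos \<theta> + cos (2 * \<theta>) = 2 * (1
    + cos \<theta>)\<^sup>2\<close> makes the part linear in \<open>r\<close> nonpositive.\<close>
  also have "3 * (A - 1) + 4 * (B - 1) + (C - 1) = 8 * r\<^sup>2 - 4 * r * (1 + cos \<theta>)\<^sup>2"
    by (simp add: vals power2_eq_square algebra_simps)
  also have "exp \<dots> \<le> exp (8 * r\<^sup>2)" using assms by simp
  also have "A ^ 3 * B ^ 4 * C = norm (1 - complex_of_real r) ^ 6 * norm (1 - w) ^ 8 * norm (1 - w2) ^ 2"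
    by (simp add: A_def B_def C_def flip: power_mult)
  finally show ?thesis .
qed

text \<open>Stated for the reciprocal of zeta, so that the classical lower bound becomes an upper
  bound. The exponents 6, 8, 2 are twice 3, 4, 1 because the Euler factors are handled through
  squared norms. The losses multiply to a constant since the squared modulus of
  \<open>npow s p\<close> is at most \<open>real p powr (-2)\<close>.\<close>

lemma moebius_series_341:
  "\<exists>K>0. \<forall>\<sigma> t. \<sigma> > 1 \<longrightarrow> norm (moebius_series (of_real \<sigma>)) ^ 6 *
     norm (moebius_series (Complex \<sigma> t)) ^ 8 * norm (moebius_series (Complex \<sigma> (2 * t))) ^ 2 \<le> K"
proof -
  have sm: "summable (\<lambda>n. real n powr (-2))" by (simp add: summable_real_powr_iff)
  define K where "K = exp (8 * (\<Sum>n. real n powr (-2)))"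
  have "norm (moebius_series (of_real \<sigma>)) ^ 6 *
     norm (moebius_series (Complex \<sigma> t)) ^ 8 * norm (moebius_series (Complex \<sigma> (2 * t))) ^ 2 \<le> K" if s: "\<sigma> > 1" for \<sigma> t
  proof (rule tendsto_upperbound)
    define E where "E = (\<lambda>s N. \<Prod>p | prime p \<and> p \<le> N. 1 - npow s p)"
    have lim: "(\<lambda>N. norm (E z N)) \<longlonglongrightarrow> norm (moebius_series z)" if "Re z > 1" for z
      unfolding E_def by (intro tendsto_norm euler_product_moebius_series that)
    show "(\<lambda>N. norm (E (of_real \<sigma>) N) ^ 6 * norm (E (Complex \<sigma> t) N) ^ 8 * norm (E (Complex \<sigma> (2 * t)) N) ^ 2) \<longlonglongrightarrow>
       norm (moebius_series (of_real \<sigma>)) ^ 6 * norm (moebius_series (Complex \<sigma> t)) ^ 8 * norm (moebius_series (Complex \<sigma> (2 * t))) ^ 2"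
      by (intro tendsto_mult tendsto_power lim) (use s in auto)
    show "eventually (\<lambda>N. norm (E (of_real \<sigma>) N) ^ 6 * norm (E (Complex \<sigma> t) N) ^ 8 * norm (E (Complex \<sigma> (2 * t)) N) ^ 2 \<le> K) sequentially"
    proof (intro always_eventually allI)
      fix N
      have "norm (E (of_real \<sigma>) N) ^ 6 * norm (E (Complex \<sigma> t) N) ^ 8 * norm (E (Complex \<sigma> (2 * t)) N) ^ 2 =
         (\<Prod>p | prime p \<and> p \<le> N. norm (1 - npow (of_real \<sigma>) p) ^ 6 * norm (1 - npow (Complex \<sigma> t) p) ^ 8 * norm (1 - npow (Complex \<sigma> (2 * t)) p) ^ 2)"
        by (simp add: E_def prod.distrib prod_power_distrib flip: prod_norm)
      also have "\<dots> \<le> (\<Prod>p | prime p \<and> p \<le> N. exp (8 * real p powr (-2)))"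
      proof (intro prod_mono conjI)
        fix p assume "p \<in> {p. prime p \<and> p \<le> N}"
        hence p: "p > 1" "p > 0" by (auto dest: prime_gt_1_nat prime_gt_0_nat)
        define r where "r = exp (- \<sigma> * ln (real p))"
        have e: "npow (Complex \<sigma> x) p = of_real r * exp (\<i> * of_real (- x * ln (real p)))" for x
          by (simp add: npow_def r_def Complex_eq algebra_simps exp_of_real[symmetric] flip: exp_add)
        have "norm (1 - npow (of_real \<sigma>) p) ^ 6 * norm (1 - npow (Complex \<sigma> t) p) ^ 8 * norm (1 - npow (Complex \<sigma> (2 * t)) p) ^ 2
           \<le> exp (8 * r\<^sup>2)"
          using euler_factor_bound[of r "- t * ln (real p)"] e[of t] e[of "2 * t"] e[of 0]
          by (simp add: r_def Complex_eq mult_ac)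
        also have "r\<^sup>2 = real p powr (- 2 * \<sigma>)" using p by (simp add: r_def powr_def flip: exp_of_nat_mult)
        also have "\<dots> \<le> real p powr (-2)" using p s by (intro powr_mono) auto
        finally show "norm (1 - npow (of_real \<sigma>) p) ^ 6 * norm (1 - npow (Complex \<sigma> t) p) ^ 8 * norm (1 - npow (Complex \<sigma> (2 * t)) p) ^ 2
           \<le> exp (8 * real p powr (-2))" by simp
      qed auto
      also have "\<dots> = exp (8 * (\<Sum>p | prime p \<and> p \<le> N. real p powr (-2)))"
        by (simp add: exp_sum sum_distrib_left)
      also have "\<dots> \<le> K"
        unfolding K_def by (simp, intro sum_le_suminf sm) auto
      finally show "norm (E (of_real \<sigma>) N) ^ 6 * norm (E (Complex \<sigma> t) N) ^ 8 * norm (E (Complex \<sigma> (2 * t)) N) ^ 2 \<le> K" .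
    qed
  qed auto
  moreover have "K > 0" by (simp add: K_def)
  ultimately show ?thesis by blast
qed

lemma height_le:
  assumes "1 + \<bar>Im w\<bar> \<le> 2 * (1 + \<bar>Im s\<bar>)"
  shows "height w \<le> 2 * height s"
proof -
  have "height w \<le> (2 * (1 + \<bar>Im s\<bar>)) powr (1/20)"
    unfolding height_def using assms by (intro powr_mono2) auto
  also have "\<dots> = 2 powr (1/20) * height s" using powr_mult[of 2 "1 + \<bar>Im s\<bar>" "1/20"] by (simp add: height_def ring_distribs)
  also have "\<dots> \<le> 2 powr 1 * height s" using height_ge_1[of s] by (intro mult_right_mono powr_mono) auto
  finally show ?thesis by simp
qed

text \<open>Cauchy's inequality on circles of radius \<open>1/40\<close>, which lead from
  \<open>Re s \<ge> 39/40\<close> to the range \<open>Re s \<ge> 19/20\<close> of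
  \<open>zeta_reg_bound\<close>: the factor 40 is the reciprocal radius, and \<open>2 ^ 21\<close>
  allows the height to double on the circle.\<close>

definition zeta_reg_deriv_const :: real where
  "zeta_reg_deriv_const = 65 * 2 ^ 21 * 40"

lemma deriv_zeta_reg_bound:
  assumes "39/40 \<le> Re s" "Re s \<le> 2"
  shows "norm (deriv zeta_reg s) \<le> zeta_reg_deriv_const * height s ^ 21"
proof -
  have "norm ((deriv ^^ 1) zeta_reg s) \<le> fact 1 * (65 * (2 * height s) ^ 21) / (1/40) ^ 1"
  proof (rule Cauchy_inequality)
    have sub: "cball s (1/40) \<subseteq> {s. Re s > 0}"
    proof
      fix w assume "w \<in> cball s (1/40)"
      thus "w \<in> {s. Re s > 0}" using abs_Re_le_cmod[of "s - w"] assms by (simp add: dist_norm)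
    qed
    show "zeta_reg holomorphic_on ball s (1/40)"
      by (rule holomorphic_on_subset[OF zeta_reg_holomorphic]) (use sub ball_subset_cball in blast)
    show "continuous_on (cball s (1/40)) zeta_reg"
      by (rule holomorphic_on_imp_continuous_on[OF holomorphic_on_subset[OF zeta_reg_holomorphic sub]])
    fix w assume w: "norm (s - w) = 1/40"
    have "\<bar>Re s - Re w\<bar> \<le> 1/40" using abs_Re_le_cmod[of "s - w"] w by simp
    hence "norm (zeta_reg w) \<le> 65 * height w ^ 21"
      using assms by (intro zeta_reg_bound) linarith+
    moreover have "\<bar>Im s - Im w\<bar> \<le> 1/40" using abs_Im_le_cmod[of "s - w"] w by simp
    hence "\<bar>Im w\<bar> \<le> \<bar>Im s\<bar> + 1/40"
      using abs_triangle_ineq2[of "Im w" "Im s"] abs_minus_commute[of "Im w" "Im s"] by argo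
    hence "height w \<le> 2 * height s" by (intro height_le) simp
    hence "65 * height w ^ 21 \<le> 65 * (2 * height s) ^ 21"
      using height_ge_1[of w] by (intro mult_left_mono power_mono) auto
    ultimately show "norm (zeta_reg w) \<le> 65 * (2 * height s) ^ 21" by linarith
  qed auto
  thus ?thesis by (simp add: zeta_reg_deriv_const_def power_mult_distrib)
qed

lemma zeta_reg_lipschitz:
  assumes "convex S" "x \<in> S" "y \<in> S"
    and S: "\<And>z. z \<in> S \<Longrightarrow> 39/40 \<le> Re z \<and> Re z \<le> 2 \<and> height z \<le> H"
  shows "norm (zeta_reg x - zeta_reg y) \<le> zeta_reg_deriv_const * H ^ 21 * norm (x - y)"
proof (rule field_differentiable_bound[OF assms(1) _ _ assms(2,3)])
  fix z assume z: "z \<in> S"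
  have "zeta_reg field_differentiable at z"
    by (rule holomorphic_on_imp_differentiable_at[OF zeta_reg_holomorphic open_halfspace_Re_gt]) (use S[OF z] in auto)
  thus "(zeta_reg has_field_derivative deriv zeta_reg z) (at z within S)"
    by (simp add: DERIV_deriv_iff_field_differentiable[symmetric] has_field_derivative_at_within)
  have "norm (deriv zeta_reg z) \<le> zeta_reg_deriv_const * height z ^ 21"
    by (rule deriv_zeta_reg_bound) (use S[OF z] in auto)
  also have "\<dots> \<le> zeta_reg_deriv_const * H ^ 21"
    using S[OF z] height_ge_1[of z] by (intro mult_left_mono power_mono) (auto simp: zeta_reg_deriv_const_def)
  finally show "norm (deriv zeta_reg z) \<le> zeta_reg_deriv_const * H ^ 21" .
qed

text \<open>Since \<open>moebius_series s * zeta_reg s = s - 1\<close>, the 3-4-1 inequality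
  compares powers of the distances to 1 with powers of \<open>zeta_reg\<close>. Away from the real
  axis the eight plus two distances give \<open>height s ^ 200\<close>, and the point at height
  \<open>2 * t\<close> costs \<open>height s ^ 42\<close>, hence 158.\<close>

lemma zeta_reg_lower_bound_power:
  assumes "\<delta> > 0" "\<delta> \<le> 1"
  shows "\<exists>c>0. \<forall>s. 1 < Re s \<longrightarrow> Re s \<le> 2 \<longrightarrow> \<bar>Im s\<bar> \<ge> \<delta> \<longrightarrow>
     c * (Re s - 1) ^ 6 * height s ^ 158 \<le> norm (zeta_reg s) ^ 8"
proof -
  obtain K where K: "K > 0" and K341: "\<And>\<sigma> t. \<sigma> > 1 \<Longrightarrow> norm (moebius_series (of_real \<sigma>)) ^ 6 *
     norm (moebius_series (Complex \<sigma> t)) ^ 8 * norm (moebius_series (Complex \<sigma> (2 * t))) ^ 2 \<le> K"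
    using moebius_series_341 by blast
  define M where "M = 65 ^ 6 * (65 * 2 ^ 21 :: real) ^ 2"
  define c where "c = (\<delta> / 2) ^ 10 / (K * M)"
  have M: "M > 0" by (simp add: M_def)
  have "c * (Re s - 1) ^ 6 * height s ^ 158 \<le> norm (zeta_reg s) ^ 8"
    if s: "1 < Re s" "Re s \<le> 2" "\<bar>Im s\<bar> \<ge> \<delta>" for s
  proof -
    define \<sigma> t h where "\<sigma> = Re s" and "t = Im s" and "h = height s"
    have h: "h \<ge> 1" "h ^ 20 = 1 + \<bar>t\<bar>" by (simp_all add: h_def height_ge_1 height_pow_20 t_def)
    define s1 s2 where "s1 = complex_of_real \<sigma>" and "s2 = Complex \<sigma> (2 * t)"
    have ss: "s = Complex \<sigma> t" by (simp add: \<sigma>_def t_def)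
    have \<sigma>: "\<sigma> > 1" "\<sigma> \<le> 2" using s by (auto simp: \<sigma>_def)
    define L where "L = norm (s1 - 1) ^ 6 * norm (s - 1) ^ 8 * norm (s2 - 1) ^ 2"
    have "L = (norm (moebius_series s1) ^ 6 * norm (moebius_series s) ^ 8 * norm (moebius_series s2) ^ 2) *
       (norm (zeta_reg s1) ^ 6 * norm (zeta_reg s) ^ 8 * norm (zeta_reg s2) ^ 2)"
      unfolding L_def
      by (subst moebius_series_mult_zeta_reg[symmetric], use \<sigma> in \<open>simp add: s1_def s2_def ss\<close>)+
         (simp add: norm_mult power_mult_distrib mult_ac)
    also have "\<dots> \<le> K * (norm (zeta_reg s1) ^ 6 * norm (zeta_reg s) ^ 8 * norm (zeta_reg s2) ^ 2)"
      using K341[OF \<sigma>(1), of t] by (intro mult_right_mono) (auto simp: s1_def s2_def ss)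
    also have "norm (zeta_reg s1) ^ 6 * norm (zeta_reg s) ^ 8 * norm (zeta_reg s2) ^ 2 \<le>
        65 ^ 6 * norm (zeta_reg s) ^ 8 * (65 * (2 * h) ^ 21) ^ 2"
    proof (intro mult_mono power_mono)
      have "norm (zeta_reg s1) \<le> 65 * height s1 ^ 21" using \<sigma> by (intro zeta_reg_bound) (auto simp: s1_def)
      thus "norm (zeta_reg s1) \<le> 65" by (simp add: height_def s1_def)
      have "norm (zeta_reg s2) \<le> 65 * height s2 ^ 21" using \<sigma> by (intro zeta_reg_bound) (auto simp: s2_def)
      also have "\<dots> \<le> 65 * (2 * h) ^ 21" using height_ge_1[of s2] unfolding h_def
        by (intro mult_left_mono power_mono height_le) (auto simp: s2_def t_def)
      finally show "norm (zeta_reg s2) \<le> 65 * (2 * h) ^ 21" .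
    qed auto
    also have "65 ^ 6 * norm (zeta_reg s) ^ 8 * (65 * (2 * h) ^ 21) ^ 2 = M * h ^ 42 * norm (zeta_reg s) ^ 8"
      by (simp add: M_def power_mult_distrib flip: power_mult)
    finally have L1: "L \<le> K * (M * h ^ 42 * norm (zeta_reg s) ^ 8)" using K by (simp add: mult_left_mono)
    have "(\<sigma> - 1) ^ 6 * (\<delta> / 2 * h ^ 20) ^ 8 * (\<delta> / 2 * h ^ 20) ^ 2 \<le> L"
      unfolding L_def
    proof (intro mult_mono power_mono)
      have td: "\<delta> / 2 * h ^ 20 \<le> \<bar>t\<bar>"
      proof -
        have "\<delta> * \<bar>t\<bar> \<le> 1 * \<bar>t\<bar>" using assms by (intro mult_right_mono) auto
        thus ?thesis using s by (simp add: h t_def algebra_simps)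
      qed
      show "\<delta> / 2 * h ^ 20 \<le> norm (s - 1)" using abs_Im_le_cmod[of "s - 1"] td by (simp add: t_def)
      show "\<delta> / 2 * h ^ 20 \<le> norm (s2 - 1)" using abs_Im_le_cmod[of "s2 - 1"] td by (simp add: s2_def)
      show "\<sigma> - 1 \<le> norm (s1 - 1)" using complex_Re_le_cmod[of "s1 - 1"] by (simp add: s1_def)
    qed (use \<sigma> h assms in auto)
    also have "(\<sigma> - 1) ^ 6 * (\<delta> / 2 * h ^ 20) ^ 8 * (\<delta> / 2 * h ^ 20) ^ 2 = (\<delta> / 2) ^ 10 * (\<sigma> - 1) ^ 6 * h ^ 158 * h ^ 42"
    proof -
      define d where "d = \<delta> / 2"
      have "(d * h ^ 20) ^ 8 * (d * h ^ 20) ^ 2 = (d * h ^ 20) ^ 10" by (simp flip: power_add)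
      also have "\<dots> = d ^ 10 * h ^ 200" by (simp add: power_mult_distrib flip: power_mult)
      also have "h ^ 200 = h ^ 158 * h ^ 42" by (simp flip: power_add)
      finally show ?thesis unfolding d_def[symmetric] by (simp only: mult_ac)
    qed
    finally have "((\<delta> / 2) ^ 10 * (\<sigma> - 1) ^ 6 * h ^ 158) * h ^ 42 \<le> (K * M * norm (zeta_reg s) ^ 8) * h ^ 42"
      using L1 by (simp add: mult_ac)
    hence "(\<delta> / 2) ^ 10 * (\<sigma> - 1) ^ 6 * h ^ 158 \<le> K * M * norm (zeta_reg s) ^ 8"
      by (rule mult_right_le_imp_le) (use h in auto)
    moreover have "0 < K * M" using K M by simp
    ultimately show ?thesis by (simp add: c_def \<sigma>_def h_def pos_divide_le_eq mult_ac)
  qed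
  moreover have "c > 0" using K M assms by (simp add: c_def)
  ultimately show ?thesis by blast
qed

text \<open>The 3-4-1 bound degenerates as \<open>Re s\<close> tends to 1, so it is used at distance
  \<open>\<kappa> ^ 4 / height s ^ 5\<close> and carried further left by the Lipschitz bound. The
  power 5 balances heights: \<open>(158 - 5 * 6) / 8\<close> and \<open>21 - 5\<close> both equal
  16. The power of \<kappa> breaks the tie: the lower bound carries \<open>\<kappa> ^ 3\<close>, the
  loss \<open>\<kappa> ^ 4\<close>. Near 1 continuity and \<open>zeta_reg 1 = 1\<close>
  suffice.\<close>

lemma zeta_reg_lower_bound:
  "\<exists>c>0. c \<le> 1 \<and> (\<forall>s. 1 < Re s \<longrightarrow> Re s \<le> 1 + c \<longrightarrow> c * height s ^ 16 \<le> norm (zeta_reg s))"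
proof -
  have "continuous_on {s. Re s > 0} zeta_reg" by (rule holomorphic_on_imp_continuous_on[OF zeta_reg_holomorphic])
  hence "isCont zeta_reg 1" by (simp add: continuous_on_eq_continuous_at open_halfspace_Re_gt)
  hence "(zeta_reg \<longlongrightarrow> zeta_reg 1) (nhds 1)"
    by (simp only: isCont_def tendsto_at_iff_tendsto_nhds)
  hence "eventually (\<lambda>s. dist (zeta_reg s) (zeta_reg 1) < 1/2) (nhds 1)"
    by (rule tendstoD) simp
  then obtain \<epsilon> where \<epsilon>: "\<epsilon> > 0" "\<And>s. dist s 1 < \<epsilon> \<Longrightarrow> dist (zeta_reg s) 1 < 1/2"
    unfolding eventually_nhds_metric by auto
  define \<delta> where "\<delta> = min 1 (\<epsilon> / 2)"
  have \<delta>: "0 < \<delta>" "\<delta> \<le> 1" "2 * \<delta> \<le> \<epsilon>" using \<epsilon> by (auto simp: \<delta>_def)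
  obtain b where b: "b > 0" and lb: "\<And>s. 1 < Re s \<Longrightarrow> Re s \<le> 2 \<Longrightarrow> \<bar>Im s\<bar> \<ge> \<delta> \<Longrightarrow>
     b * (Re s - 1) ^ 6 * height s ^ 158 \<le> norm (zeta_reg s) ^ 8"
    using zeta_reg_lower_bound_power[OF \<delta>(1,2)] by blast
  define C where "C = zeta_reg_deriv_const"
  have C: "C > 0" by (simp add: C_def zeta_reg_deriv_const_def)
  define a where "a = root 8 b"
  have a: "a > 0" "a ^ 8 = b" using b by (simp_all add: a_def)
  \<comment> \<open>Makes the Lipschitz loss at most half of the lower bound
    \<open>a * \<kappa> ^ 3 * height s ^ 16\<close>.\<close>
  define \<kappa> where "\<kappa> = min 1 (a / (2 * C))"
  have \<kappa>: "0 < \<kappa>" "\<kappa> \<le> 1" "C * \<kappa> \<le> a / 2" using a C by (auto simp: \<kappa>_def min_def field_simps)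
  have far: "a * \<kappa> ^ 3 * height s ^ 16 \<le> norm (zeta_reg s)"
    if s: "1 + \<kappa> ^ 4 / height s ^ 5 \<le> Re s" "Re s \<le> 2" "\<bar>Im s\<bar> \<ge> \<delta>" for s
  proof -
    define h where "h = height s"
    have h: "h \<ge> 1" by (simp add: h_def height_ge_1)
    have "0 < \<kappa> ^ 4 / h ^ 5" using h \<kappa> by simp
    hence s1: "1 < Re s" using s(1) unfolding h_def by linarith
    have "(a * \<kappa> ^ 3 * h ^ 16) ^ 8 = b * (\<kappa> ^ 4 / h ^ 5) ^ 6 * h ^ 158"
      using h by (simp add: a(2)[symmetric] power_mult_distrib power_divide field_simps flip: power_mult power_add)
    also have "\<dots> \<le> b * (Re s - 1) ^ 6 * h ^ 158"
      using s(1) b h \<kappa> by (intro mult_right_mono mult_left_mono power_mono) (auto simp: h_def)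
    also have "\<dots> \<le> norm (zeta_reg s) ^ 8" unfolding h_def by (rule lb[OF s1 s(2,3)])
    finally show ?thesis unfolding h_def[symmetric] by (rule power_le_imp_le_base[of _ 7, simplified]) simp
  qed
  have near: "a * \<kappa> ^ 3 / 2 * height s ^ 16 \<le> norm (zeta_reg s)"
    if s: "1 < Re s" "Re s \<le> 1 + \<kappa> ^ 4 / height s ^ 5" "\<bar>Im s\<bar> \<ge> \<delta>" for s
  proof -
    define h where "h = height s"
    have h: "h \<ge> 1" by (simp add: h_def height_ge_1)
    define \<sigma> where "\<sigma> = 1 + \<kappa> ^ 4 / h ^ 5"
    have "\<kappa> ^ 4 \<le> 1" using \<kappa> by (simp add: power_le_one)
    hence "\<kappa> ^ 4 \<le> h ^ 5" using one_le_power[OF h, of 5] by linarith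
    hence "\<kappa> ^ 4 / h ^ 5 \<le> 1" using h by (simp add: divide_le_eq_1)
    hence \<sigma>: "\<sigma> \<le> 2" by (simp add: \<sigma>_def)
    define s' where "s' = Complex \<sigma> (Im s)"
    have hs': "height s' = h" by (simp add: s'_def h_def height_def)
    have "a * \<kappa> ^ 3 * h ^ 16 \<le> norm (zeta_reg s')"
    proof -
      have "1 + \<kappa> ^ 4 / height s' ^ 5 \<le> Re s'" unfolding hs' by (simp add: s'_def \<sigma>_def)
      moreover have "Re s' \<le> 2" "\<bar>Im s'\<bar> \<ge> \<delta>" using s \<sigma> by (simp_all add: s'_def)
      ultimately show ?thesis using far[of s'] unfolding hs' by blast
    qed
    moreover have "norm (zeta_reg s' - zeta_reg s) \<le> C * h ^ 21 * norm (s' - s)"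
      unfolding C_def
    proof (rule zeta_reg_lipschitz[of "closed_segment s' s"])
      fix z assume "z \<in> closed_segment s' s"
      then obtain u where u: "0 \<le> u" "u \<le> 1" "z = (1 - u) *\<^sub>R s' + u *\<^sub>R s" by (auto simp: closed_segment_def)
      have "Im z = Im s" by (simp add: u s'_def algebra_simps)
      moreover have "Re z = (1 - u) * \<sigma> + u * Re s" by (simp add: u s'_def)
      moreover have "(1 - u) * 1 + u * 1 \<le> (1 - u) * \<sigma> + u * Re s"
        using u s \<kappa> h by (intro add_mono mult_left_mono) (auto simp: \<sigma>_def)
      moreover have "(1 - u) * \<sigma> + u * Re s \<le> (1 - u) * 2 + u * 2"
        using u s \<sigma> by (intro add_mono mult_left_mono) (auto simp: \<sigma>_def h_def)
      ultimately show "39/40 \<le> Re z \<and> Re z \<le> 2 \<and> height z \<le> h" by (simp add: height_def h_def)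
    qed auto
    moreover have "C * h ^ 21 * norm (s' - s) \<le> a / 2 * \<kappa> ^ 3 * h ^ 16"
    proof -
      have "s' - s = of_real (\<sigma> - Re s)" by (simp add: s'_def complex_eq_iff)
      hence "norm (s' - s) \<le> \<kappa> ^ 4 / h ^ 5" using s by (simp add: \<sigma>_def h_def del: of_real_diff)
      hence "C * h ^ 21 * norm (s' - s) \<le> C * h ^ 21 * (\<kappa> ^ 4 / h ^ 5)" using C h by (intro mult_left_mono) auto
      also have "\<dots> = (C * \<kappa>) * \<kappa> ^ 3 * h ^ 16" using h by (simp add: field_simps flip: power_add power_Suc)
      also have "\<dots> \<le> a / 2 * \<kappa> ^ 3 * h ^ 16" using \<kappa> h by (intro mult_right_mono) auto
      finally show ?thesis .
    qed
    moreover have "norm (zeta_reg s') \<le> norm (zeta_reg s) + norm (zeta_reg s' - zeta_reg s)"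
      by (metis norm_triangle_sub)
    ultimately show ?thesis by (simp add: h_def)
  qed
  \<comment> \<open>The bound \<delta> keeps points with small imaginary part within \<epsilon> of
    1. The bound \<open>1/4\<close> serves the same points: there
    \<open>height s ^ 20 \<le> 2\<close>, so the claim is at most \<open>1/2\<close>.\<close>
  define c where "c = min \<delta> (min (a * \<kappa> ^ 3 / 2) (1/4))"
  have c: "c > 0" "c \<le> \<delta>" "c \<le> a * \<kappa> ^ 3 / 2" "c \<le> 1/4" using \<delta> a \<kappa> by (auto simp: c_def)
  have "c * height s ^ 16 \<le> norm (zeta_reg s)" if s: "1 < Re s" "Re s \<le> 1 + c" for s
  proof (cases "\<bar>Im s\<bar> \<ge> \<delta>")
    case True
    have h: "height s \<ge> 1" by (rule height_ge_1)
    have "a * \<kappa> ^ 3 / 2 * height s ^ 16 \<le> norm (zeta_reg s)"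
    proof (cases "1 + \<kappa> ^ 4 / height s ^ 5 \<le> Re s")
      case False
      thus ?thesis using near[OF s(1) _ True] by simp
    next
      case T: True
      have "a * \<kappa> ^ 3 / 2 * height s ^ 16 \<le> a * \<kappa> ^ 3 * height s ^ 16" using a \<kappa> h by (intro mult_right_mono) auto
      also have "\<dots> \<le> norm (zeta_reg s)" by (rule far) (use T True s c in auto)
      finally show ?thesis .
    qed
    moreover have "c * height s ^ 16 \<le> a * \<kappa> ^ 3 / 2 * height s ^ 16" using c h by (intro mult_right_mono) auto
    ultimately show ?thesis by linarith
  next
    case False
    have "dist s 1 \<le> \<bar>Re (s - 1)\<bar> + \<bar>Im (s - 1)\<bar>" unfolding dist_norm by (rule cmod_le)
    hence "dist s 1 < \<epsilon>" using False s c \<delta> by simp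
    hence "dist (zeta_reg s) 1 < 1/2" by (rule \<epsilon>)
    hence "1/2 \<le> norm (zeta_reg s)"
      using norm_triangle_ineq2[of 1 "zeta_reg s"] by (simp add: dist_norm norm_minus_commute)
    moreover have "height s ^ 16 \<le> height s ^ 20" using height_ge_1 by (intro power_increasing) auto
    hence "c * height s ^ 16 \<le> 1/4 * height s ^ 20" using c height_ge_1[of s] by (intro mult_mono) auto
    moreover have "height s ^ 20 \<le> 2" using False \<delta> by (simp add: height_pow_20)
    ultimately show ?thesis by linarith
  qed
  thus ?thesis using c \<delta> by (intro exI[of _ c]) auto
qed

lemma higher_deriv_recip_zeta_reg_bound:
  "\<exists>c>0. \<exists>C. \<forall>s. 0 < Re s \<longrightarrow> Re s \<le> c \<longrightarrow>
     norm ((deriv ^^ 8) (\<lambda>s. 1 / zeta_reg (1 + s)) s) \<le> C * (1 + \<bar>Im s\<bar>)\<^sup>2"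
proof -
  obtain c where c: "c > 0" "c \<le> 1" and lb: "\<And>s. 1 < Re s \<Longrightarrow> Re s \<le> 1 + c \<Longrightarrow> c * height s ^ 16 \<le> norm (zeta_reg s)"
    using zeta_reg_lower_bound by blast
  define D where "D = zeta_reg_deriv_const * 2 ^ 21"
  have D: "D > 1" by (simp add: D_def zeta_reg_deriv_const_def)
  \<comment> \<open>The first bound keeps the discs inside the Lipschitz region; the second makes
    the variation over a disc of radius \<open>\<rho> / h ^ 5\<close> at most
    \<open>c / 2 * h ^ 16\<close>.\<close>
  define \<rho> where "\<rho> = min (1/40) (c / (2 * D))"
  have \<rho>: "0 < \<rho>" "\<rho> \<le> 1/40" "D * \<rho> \<le> c / 2" using c D by (auto simp: \<rho>_def min_def field_simps)
  define c' where "c' = min c (1/2)"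
  have "norm ((deriv ^^ 8) (\<lambda>s. 1 / zeta_reg (1 + s)) s) \<le> fact 8 * (2 / c) / \<rho> ^ 8 * (1 + \<bar>Im s\<bar>)\<^sup>2"
    if s: "0 < Re s" "Re s \<le> c'" for s
  proof -
    define h where "h = height s"
    have h: "h \<ge> 1" "h ^ 20 = 1 + \<bar>Im s\<bar>" by (simp_all add: h_def height_ge_1 height_pow_20)
    have hs: "height (1 + s) = h" by (simp add: h_def height_def)
    define r where "r = \<rho> / h ^ 5"
    have "0 < h ^ 5" using h by simp
    hence "\<rho> / h ^ 5 \<le> \<rho> / 1" using \<rho> one_le_power[OF h(1), of 5] by (intro divide_left_mono) auto
    moreover have "0 < r" using \<rho> h by (simp add: r_def)
    ultimately have r: "0 < r" "r \<le> 1/40" using \<rho> unfolding r_def by linarith+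
    have box: "39/40 \<le> Re z \<and> Re z \<le> 2 \<and> height z \<le> 2 * h" if "z \<in> cball (1 + s) r" for z
    proof -
      have "norm ((1 + s) - z) \<le> 1/40" using that r by (simp add: dist_norm)
      hence "\<bar>Re ((1 + s) - z)\<bar> \<le> 1/40" "\<bar>Im ((1 + s) - z)\<bar> \<le> 1/40"
        using abs_Re_le_cmod[of "(1 + s) - z"] abs_Im_le_cmod[of "(1 + s) - z"] by linarith+
      hence a: "\<bar>1 + Re s - Re z\<bar> \<le> 1/40" "\<bar>Im s - Im z\<bar> \<le> 1/40" "Re s \<le> 1/2" "Im (1 + s) = Im s"
        using s by (simp_all add: c'_def)
      have "\<bar>Im z\<bar> \<le> \<bar>Im s\<bar> + 1/40"
        using a(2) abs_triangle_ineq2[of "Im z" "Im s"] abs_minus_commute[of "Im z" "Im s"] by argo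
      hence "1 + \<bar>Im z\<bar> \<le> 2 * (1 + \<bar>Im (1 + s)\<bar>)" unfolding a(4) by simp
      moreover have "39/40 \<le> Re z" using a(1) s(1) unfolding abs_le_iff by argo
      moreover have "Re z \<le> 2" using a(1,3) unfolding abs_le_iff by argo
      ultimately show ?thesis unfolding hs[symmetric] using height_le by blast
    qed
    have low: "c / 2 * h ^ 16 \<le> norm (zeta_reg z)" if z: "z \<in> cball (1 + s) r" for z
    proof -
      have "norm (zeta_reg (1 + s) - zeta_reg z) \<le> zeta_reg_deriv_const * (2 * h) ^ 21 * norm (1 + s - z)"
        by (rule zeta_reg_lipschitz[of "cball (1 + s) r"]) (use box z r in auto)
      also have "\<dots> \<le> zeta_reg_deriv_const * (2 * h) ^ 21 * r"
        using z h by (intro mult_left_mono) (auto simp: dist_norm zeta_reg_deriv_const_def)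
      also have "\<dots> = (D * \<rho>) * h ^ 16"
        using h by (simp add: D_def r_def power_mult_distrib field_simps flip: power_add)
      also have "\<dots> \<le> c / 2 * h ^ 16" using \<rho> h by (intro mult_right_mono) auto
      finally have "norm (zeta_reg (1 + s) - zeta_reg z) \<le> c / 2 * h ^ 16" .
      moreover have "c * h ^ 16 \<le> norm (zeta_reg (1 + s))"
        unfolding hs[symmetric] by (rule lb) (use s in \<open>auto simp: c'_def\<close>)
      moreover have "norm (zeta_reg (1 + s)) \<le> norm (zeta_reg z) + norm (zeta_reg (1 + s) - zeta_reg z)"
        by (metis norm_triangle_sub)
      ultimately show ?thesis by simp
    qed
    \<comment> \<open>The gain \<open>h ^ 16\<close> is given away: a constant bound for the
      reciprocal already yields the growth \<open>h ^ 40\<close>, which comes from the radius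
      alone.\<close>
    have lowc: "c / 2 \<le> norm (zeta_reg z)" if z: "z \<in> cball (1 + s) r" for z
    proof -
      have "c / 2 * 1 \<le> c / 2 * h ^ 16" using c h by (intro mult_left_mono) auto
      thus ?thesis using low[OF z] by linarith
    qed
    have sh: "1 + z \<in> cball (1 + s) r" if "z \<in> cball s r" for z using that by (simp add: dist_norm)
    have hol: "(\<lambda>s. 1 / zeta_reg (1 + s)) holomorphic_on cball s r"
    proof (intro holomorphic_intros)
      have "zeta_reg \<circ> (\<lambda>s. 1 + s) holomorphic_on cball s r"
      proof (rule holomorphic_on_compose)
        show "zeta_reg holomorphic_on (+) 1 ` cball s r"
        proof (rule holomorphic_on_subset[OF zeta_reg_holomorphic], safe)
          fix z assume "z \<in> cball s r"
          from box[OF sh[OF this]] show "0 < Re (1 + z)" by linarith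
        qed
      qed (intro holomorphic_intros)
      thus "(\<lambda>s. zeta_reg (1 + s)) holomorphic_on cball s r" by (simp add: o_def)
      show "zeta_reg (1 + z) \<noteq> 0" if "z \<in> cball s r" for z using lowc[OF sh[OF that]] c by auto
    qed
    have "norm ((deriv ^^ 8) (\<lambda>s. 1 / zeta_reg (1 + s)) s) \<le> fact 8 * (2 / c) / r ^ 8"
    proof (rule Cauchy_inequality)
      show "(\<lambda>s. 1 / zeta_reg (1 + s)) holomorphic_on ball s r" by (rule holomorphic_on_subset[OF hol]) auto
      show "continuous_on (cball s r) (\<lambda>s. 1 / zeta_reg (1 + s))" by (rule holomorphic_on_imp_continuous_on[OF hol])
      fix z assume "norm (s - z) = r"
      hence "c / 2 \<le> norm (zeta_reg (1 + z))" by (intro lowc sh) (simp add: dist_norm)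
      moreover have "0 < c / 2" using c by simp
      ultimately have "1 / norm (zeta_reg (1 + z)) \<le> 1 / (c / 2)"
        by (intro divide_left_mono mult_pos_pos) linarith+
      thus "norm (1 / zeta_reg (1 + z)) \<le> 2 / c" by (simp add: norm_divide)
    qed (use r in auto)
    also have "\<dots> = fact 8 * (2 / c) / \<rho> ^ 8 * (h ^ 20)\<^sup>2"
      by (simp add: r_def power_divide flip: power_mult)
    finally show ?thesis by (simp only: h)
  qed
  moreover have "c' > 0" using c by (simp add: c'_def)
  ultimately show ?thesis by blast
qed

section \<open>Integers with few prime factors\<close>

lemma sum_recip_le_ln:
  assumes "0 < a" "a \<le> b"
  shows "(\<Sum>n\<in>{a<..b}. 1 / real n) \<le> ln (real b) - ln (real a)"
  using assms(2)
proof (induction b rule: dec_induct)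
  case (step b)
  have b: "b > 0" using step assms by simp
  have "ln (real b / real (Suc b)) \<le> real b / real (Suc b) - 1" using b by (intro ln_le_minus_one) simp
  hence "1 / real (Suc b) \<le> ln (real (Suc b)) - ln (real b)" using b by (simp add: ln_div field_simps)
  moreover have "{a<..Suc b} = insert (Suc b) {a<..b}" using step by auto
  ultimately show ?case using step by simp
qed auto

lemma sum_UNION_le:
  fixes f :: "'a \<Rightarrow> real"
  assumes "finite I" "\<And>i. finite (B i)" "\<And>x. f x \<ge> 0"
  shows "sum f (\<Union>i\<in>I. B i) \<le> (\<Sum>i\<in>I. sum f (B i))"
  using assms(1)
proof (induction I rule: finite_induct)
  case (insert i I)
  have "sum f (B i \<union> (\<Union>i\<in>I. B i)) + sum f (B i \<inter> (\<Union>i\<in>I. B i)) = sum f (B i) + sum f (\<Union>i\<in>I. B i)"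
    using insert assms by (intro sum.union_inter) auto
  moreover have "0 \<le> sum f (B i \<inter> (\<Union>i\<in>I. B i))" using assms by (intro sum_nonneg) auto
  ultimately show ?case using insert by simp
qed auto

section \<open>Chebyshev bounds for primes\<close>

definition primes_upto :: "nat \<Rightarrow> nat set" where
  "primes_upto n = {p. prime p \<and> p \<le> n}"

lemma finite_primes_upto [simp]: "finite (primes_upto n)" by (simp add: primes_upto_def)

lemma card_primes_upto_le: "card (primes_upto n) \<le> n"
proof -
  have "primes_upto n \<subseteq> {1..n}" by (auto simp: primes_upto_def dest: prime_gt_0_nat)
  from card_mono[OF _ this] show ?thesis by simp
qed

text \<open>Every prime in \<open>{n<..2 * n}\<close> divides the central binomial coefficient,
  which is at most \<open>4 ^ n\<close>, and exceeds \<open>n\<close>.\<close>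

lemma power_card_primes_le: "n ^ card (primes_upto (2 * n) - primes_upto n) \<le> 4 ^ n"
proof -
  define A where "A = primes_upto (2 * n) - primes_upto n"
  have A: "finite A" "\<And>p. p \<in> A \<Longrightarrow> prime p \<and> n < p \<and> p \<le> 2 * n" by (auto simp: A_def primes_upto_def)
  have "p dvd (2 * n) choose n" if "p \<in> A" for p
  proof -
    have p: "prime p" "n < p" "p \<le> 2 * n" using A that by auto
    have "p dvd fact (2 * n)" using p by (simp add: prime_dvd_fact_iff)
    also have "fact (2 * n) = fact n * fact n * ((2 * n) choose n)"
      using binomial_fact_lemma[of n "2 * n"] by (simp add: mult_2)
    finally show ?thesis using p by (simp add: prime_dvd_mult_iff prime_dvd_fact_iff)
  qed
  hence "\<Prod>A dvd (2 * n) choose n" using A by (intro prod_primes_dvd) auto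
  hence "\<Prod>A \<le> (2 * n) choose n" by (rule dvd_imp_le) simp
  also have "\<dots> \<le> 2 ^ (2 * n)" by (rule binomial_le_pow2)
  also have "\<dots> = 4 ^ n" by (simp add: power_mult)
  finally have "\<Prod>A \<le> 4 ^ n" .
  moreover have "(\<Prod>p\<in>A. n) \<le> (\<Prod>p\<in>A. p)" by (intro prod_mono) (auto dest!: A(2))
  ultimately show ?thesis by (simp add: A_def)
qed

text \<open>With \<open>n = 2 ^ j\<close> the binomial estimate reads
  \<open>j * D \<le> 2 * 2 ^ j\<close> for the \<open>D\<close> new primes. For
  \<open>j \<ge> 2\<close> the factor \<open>Suc j\<close> is at most \<open>3/2 * j\<close>, and 6
  is the constant with \<open>3/2 * (6 + 2) = 2 * 6\<close>; smaller \<open>j\<close> are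
  trivial.\<close>

lemma chebyshev_dyadic: "j * card (primes_upto (2 ^ j)) \<le> 6 * 2 ^ j"
proof (induction j)
  case (Suc j)
  define D where "D = card (primes_upto (2 * 2 ^ j) - primes_upto (2 ^ j))"
  have "(2 ^ j) ^ D \<le> (4 :: nat) ^ (2 ^ j)" unfolding D_def by (rule power_card_primes_le)
  hence "(2 :: nat) ^ (j * D) \<le> 2 ^ (2 * 2 ^ j)" by (simp add: power_mult)
  hence D: "j * D \<le> 2 * 2 ^ j" by (rule power_le_imp_le_exp[rotated]) simp
  have sub: "primes_upto (2 ^ j) \<subseteq> primes_upto (2 ^ Suc j)"
    by (auto simp: primes_upto_def)
  have c: "card (primes_upto (2 ^ Suc j)) = card (primes_upto (2 ^ j)) + D"
    using card_Diff_subset[OF _ sub] card_mono[OF _ sub] by (simp add: D_def)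
  show ?case
  proof (cases "j \<ge> 2")
    case True
    have "2 * Suc j * (card (primes_upto (2 ^ j)) + D) \<le> 3 * j * (card (primes_upto (2 ^ j)) + D)"
      using True by (intro mult_right_mono) auto
    also have "\<dots> = 3 * (j * card (primes_upto (2 ^ j)) + j * D)" by (simp add: algebra_simps)
    also have "\<dots> \<le> 3 * (6 * 2 ^ j + 2 * 2 ^ j)" using Suc D by (intro mult_left_mono add_mono) auto
    finally show ?thesis unfolding c by simp
  next
    case False
    hence "Suc j \<le> 2" by simp
    have "Suc j * card (primes_upto (2 ^ Suc j)) \<le> 6 * 2 ^ Suc j"
      by (rule mult_mono) (use \<open>Suc j \<le> 2\<close> card_primes_upto_le in auto)
    thus ?thesis .
  qed
qed simp

section \<open>Prime powers and integers with a prescribed number of prime factors\<close>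

definition omega_level :: "nat \<Rightarrow> real \<Rightarrow> nat set" where
  "omega_level r x = {m \<in> pos_upto x. prime_omega m = r}"

lemma finite_omega_level [simp]: "finite (omega_level r x)" by (simp add: omega_level_def)

lemma omega_level_mono: "x \<le> y \<Longrightarrow> omega_level r x \<subseteq> omega_level r y"
  by (auto simp: omega_level_def pos_upto_def)

lemma prime_omega_eq_1E:
  assumes "prime_omega q = 1" "q > 0"
  obtains p a where "prime p" "a > 0" "q = p ^ a"
proof -
  obtain p where p: "prime_factors q = {p}" using assms(1) by (auto simp: prime_omega_def card_1_singleton_iff)
  have "q = (\<Prod>p\<in>prime_factors q. p ^ multiplicity p q)" using prod_prime_factors[of q] assms by simp
  hence "q = p ^ multiplicity p q" using p by simp
  moreover have "prime p" "multiplicity p q > 0" using p by (auto simp: prime_factors_multiplicity)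
  ultimately show ?thesis using that by blast
qed

lemma square_le_two_power: "(2 * i + 1)\<^sup>2 \<le> 7 * 2 ^ (i :: nat)"
proof (induction i)
  case (Suc i)
  consider "i = 0" | "i = 1" | "i \<ge> 2" by linarith
  thus ?case
  proof cases
    case 3
    then obtain d where "i = 2 + d" using le_Suc_ex by blast
    hence "(2 * Suc i + 1)\<^sup>2 \<le> 2 * (2 * i + 1)\<^sup>2"
      by (simp add: power2_eq_square algebra_simps)
    thus ?thesis using Suc by simp
  qed (auto simp: power2_eq_square)
qed simp

text \<open>Level 1 consists of the prime powers. A proper power \<open>p ^ a \<le> 2 ^ j\<close>
  has \<open>p \<le> 2 ^ h\<close> and \<open>a \<le> j\<close>; the resulting
  \<open>2 ^ h * j\<close> pairs, times \<open>j\<close>, are absorbed by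
  \<open>square_le_two_power\<close>, adding 7 to Chebyshev's 6.\<close>

lemma card_prime_powers_dyadic: "j * card (omega_level 1 (2 ^ j)) \<le> 20 * 2 ^ j"
proof -
  define h where "h = (j + 1) div 2"
  define R :: "(nat \<times> nat) set" where "R = {1..2 ^ h} \<times> {1..j}"
  have sub: "omega_level 1 (2 ^ j) \<subseteq> primes_upto (2 ^ j) \<union> (\<lambda>(p, a). p ^ a) ` R"
  proof
    fix q assume q: "q \<in> omega_level 1 (2 ^ j)"
    hence q0: "q > 0" "prime_omega q = 1" "real q \<le> 2 ^ j" by (auto simp: omega_level_def pos_upto_def)
    hence ql: "q \<le> 2 ^ j" by (metis of_nat_le_iff of_nat_numeral of_nat_power)
    from q0 obtain p a where pa: "prime p" "a > 0" "q = p ^ a" by (metis prime_omega_eq_1E)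
    have p2: "p \<ge> 2" using pa by (simp add: prime_ge_2_nat)
    show "q \<in> primes_upto (2 ^ j) \<union> (\<lambda>(p, a). p ^ a) ` R"
    proof (cases "a = 1")
      case True
      thus ?thesis using pa ql by (simp add: primes_upto_def)
    next
      case False
      have "(2::nat) ^ a \<le> p ^ a" using p2 by (intro power_mono) auto
      also have "p ^ a \<le> 2 ^ j" using pa ql by simp
      finally have aj: "a \<le> j" by (rule power_le_imp_le_exp[rotated]) simp
      have "p ^ 2 \<le> p ^ a" using False pa p2 by (intro power_increasing) auto
      also have "\<dots> \<le> 2 ^ j" using pa ql by simp
      also have "(2::nat) ^ j \<le> 2 ^ (h * 2)" by (intro power_increasing) (auto simp: h_def)
      also have "\<dots> = (2 ^ h) ^ 2" by (simp add: power_mult)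
      finally have "p \<le> 2 ^ h" by (rule power2_le_imp_le) simp
      hence "(p, a) \<in> R" using p2 aj pa by (auto simp: R_def)
      thus ?thesis using pa by (intro UnI2 image_eqI[of _ _ "(p, a)"]) auto
    qed
  qed
  have "card (omega_level 1 (2 ^ j)) \<le> card (primes_upto (2 ^ j) \<union> (\<lambda>(p, a). p ^ a) ` R)"
    by (rule card_mono[OF _ sub]) (auto simp: R_def)
  also have "\<dots> \<le> card (primes_upto (2 ^ j)) + card ((\<lambda>(p, a). p ^ a) ` R)"
    by (rule card_Un_le)
  also have "card ((\<lambda>(p, a). p ^ a) ` R) \<le> card R"
    by (rule card_image_le) (auto simp: R_def)
  also have "\<dots> = 2 ^ h * j" by (simp add: R_def)
  finally have "j * card (omega_level 1 (2 ^ j)) \<le> j * card (primes_upto (2 ^ j)) + 2 ^ h * j\<^sup>2"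
    by (simp add: power2_eq_square algebra_simps flip: distrib_left)
  also have "\<dots> \<le> 6 * 2 ^ j + 2 ^ h * (7 * 2 ^ (j div 2))"
  proof (intro add_mono chebyshev_dyadic mult_left_mono)
    have "j\<^sup>2 \<le> (2 * (j div 2) + 1)\<^sup>2" by (intro power_mono) auto
    thus "j\<^sup>2 \<le> 7 * 2 ^ (j div 2)" using square_le_two_power[of "j div 2"] by linarith
  qed auto
  also have "2 ^ h * (7 * 2 ^ (j div 2)) = (7 :: nat) * 2 ^ (h + j div 2)" by (simp add: power_add)
  also have "h + j div 2 = j" by (simp add: h_def)
  finally show ?thesis by simp
qed

text \<open>
  Hardy-Ramanujan: at most one of the prime power components of \<open>m \<le> x\<close> exceeds \<open>sqrt x\<close>, so an \<open>m\<close>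
  with \<open>r + 1\<close> prime factors can be split as \<open>q * e\<close> with \<open>q \<le> sqrt x\<close> in at least \<open>r\<close> ways.
\<close>

lemma omega_level_Suc_card_le:
  assumes "x \<ge> 1"
  shows "r * card (omega_level (Suc r) x) \<le> (\<Sum>q\<in>omega_level 1 (sqrt x). card (omega_level r (x / q)))"
proof -
  define S where "S = (\<lambda>m. {p \<in> prime_factors m. real (p ^ multiplicity p m) \<le> sqrt x})"
  have r_le: "r \<le> card (S m)" if m: "m \<in> omega_level (Suc r) x" for m
  proof -
    have m0: "m > 0" "real m \<le> x" "card (prime_factors m) = Suc r"
      using m by (auto simp: omega_level_def pos_upto_def prime_omega_def)
    define L where "L = prime_factors m - S m"
    have "card L \<le> Suc 0"
    proof (subst card_le_Suc0_iff_eq)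
      show "\<forall>p\<in>L. \<forall>p'\<in>L. p = p'"
      proof (intro ballI, rule ccontr)
        fix p p' assume p: "p \<in> L" "p' \<in> L" "p \<noteq> p'"
        hence pp: "prime p" "prime p'" "sqrt x < real (p ^ multiplicity p m)" "sqrt x < real (p' ^ multiplicity p' m)"
          by (auto simp: L_def S_def)
        have "coprime (p ^ multiplicity p m) (p' ^ multiplicity p' m)"
          using pp p(3) by (intro coprime_power_left_iff[THEN iffD2] coprime_power_right_iff[THEN iffD2] disjI1 primes_coprime)
        hence "p ^ multiplicity p m * p' ^ multiplicity p' m dvd m"
          by (intro divides_mult multiplicity_dvd)
        hence "p ^ multiplicity p m * p' ^ multiplicity p' m \<le> m" using m0 by (intro dvd_imp_le) auto
        hence "real (p ^ multiplicity p m) * real (p' ^ multiplicity p' m) \<le> x"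
          using m0(2) by (metis of_nat_le_iff of_nat_mult order_trans)
        moreover have "sqrt x * sqrt x < real (p ^ multiplicity p m) * real (p' ^ multiplicity p' m)"
          using pp assms by (intro mult_strict_mono) (auto simp: prime_gt_0_nat)
        ultimately show False using assms by simp
      qed
    qed (simp add: L_def)
    moreover have "card (prime_factors m) = card (S m) + card L"
      unfolding L_def by (subst card_Un_disjoint[symmetric]) (auto simp: S_def intro!: arg_cong[where f = card])
    ultimately show ?thesis using m0 by linarith
  qed
  have finS: "finite (S m)" for m by (simp add: S_def)
  define T where "T = (SIGMA m:omega_level (Suc r) x. S m)"
  define U where "U = (SIGMA q:omega_level 1 (sqrt x). omega_level r (x / real q))"
  \<comment> \<open>Injective on \<open>T\<close>: \<open>m\<close> is the product of the two
    components, and \<open>p\<close> is the only prime dividing the first.\<close>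
  define \<phi> where "\<phi> = (\<lambda>(m :: nat, p :: nat). (p ^ multiplicity p m, m div p ^ multiplicity p m))"
  have "r * card (omega_level (Suc r) x) = (\<Sum>m\<in>omega_level (Suc r) x. r)" by simp
  also have "\<dots> \<le> (\<Sum>m\<in>omega_level (Suc r) x. card (S m))" by (intro sum_mono r_le)
  also have "\<dots> = card T" unfolding T_def using finS by (intro card_SigmaI[symmetric]) auto
  also have "\<dots> \<le> card U"
  proof (rule card_inj_on_le)
    show "finite U" by (simp add: U_def)
    have dec: "\<exists>e. m = p ^ multiplicity p m * e \<and> m div p ^ multiplicity p m = e \<and> \<not> p dvd e \<and> e > 0 \<and> prime p \<and> 0 < multiplicity p m"
      if "m > 0" "p \<in> S m" for m p
    proof -
      have p: "prime p" "0 < multiplicity p m" "m \<noteq> 0" using that by (auto simp: S_def prime_factors_multiplicity)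
      obtain e where e: "m = p ^ multiplicity p m * e" "\<not> p dvd e"
        by (rule multiplicity_decompose'[of m p]) (use p prime_gt_1_nat[of p] in auto)
      have "p ^ multiplicity p m > 0" using p by (simp add: prime_gt_0_nat)
      hence "m div p ^ multiplicity p m = e" using e(1) by (metis nonzero_mult_div_cancel_left neq0_conv)
      moreover have "e > 0" using e that by (metis mult_0_right neq0_conv)
      ultimately show ?thesis using e p by blast
    qed
    show "inj_on \<phi> T"
    proof (rule inj_onI)
      fix a b assume ab: "a \<in> T" "b \<in> T" "\<phi> a = \<phi> b"
      obtain m p m' p' where mp: "a = (m, p)" "b = (m', p')" by (cases a, cases b)
      have m: "m > 0" "p \<in> S m" "m' > 0" "p' \<in> S m'"
        using ab mp by (auto simp: T_def omega_level_def pos_upto_def)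
      from dec[OF m(1,2)] dec[OF m(3,4)] obtain e e' where e:
        "m = p ^ multiplicity p m * e" "m div p ^ multiplicity p m = e" "prime p" "0 < multiplicity p m"
        "m' = p' ^ multiplicity p' m' * e'" "m' div p' ^ multiplicity p' m' = e'" "prime p'" "0 < multiplicity p' m'" by blast
      have eq: "p ^ multiplicity p m = p' ^ multiplicity p' m'" "e = e'" using ab(3) e by (auto simp: \<phi>_def mp)
      hence "m = m'" using e by metis
      moreover have "p dvd p' ^ multiplicity p' m'" using eq(1)[symmetric] e(4) by simp
      hence "p = p'" using e by (metis prime_dvd_power primes_dvd_imp_eq)
      ultimately show "a = b" by (simp add: mp)
    qed
    show "\<phi> ` T \<subseteq> U"
    proof (rule image_subsetI)
      fix a assume "a \<in> T"
      then obtain m p where a: "a = (m, p)" and mp: "(m, p) \<in> T" by (cases a) auto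
      hence m: "m > 0" "p \<in> S m" "real m \<le> x" "card (prime_factors m) = Suc r"
        by (auto simp: T_def omega_level_def pos_upto_def prime_omega_def)
      define q where "q = p ^ multiplicity p m"
      from dec[OF m(1,2)] obtain e where e: "m = q * e" "m div q = e" "\<not> p dvd e" "e > 0" "prime p" "0 < multiplicity p m"
        unfolding q_def by blast
      have q: "q > 0" "prime_factors q = {p}" using e by (simp_all add: q_def prime_gt_0_nat prime_factorization_prime_power)
      have "prime_factors m = insert p (prime_factors e)"
        unfolding e(1) using prime_factors_product[of q e] q e by simp
      moreover have "p \<notin> prime_factors e" using e by auto
      ultimately have "prime_omega e = r" using m(4) by (simp add: prime_omega_def)
      moreover have "real e \<le> x / real q" using m(3) q unfolding e(1) by (simp add: field_simps)
      moreover have "real q \<le> sqrt x" using m(2) by (simp add: S_def q_def)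
      moreover have "prime_omega q = 1" using q by (simp add: prime_omega_def)
      moreover have "\<phi> (m, p) = (q, e)" unfolding \<phi>_def using e(2) by (simp only: prod.case q_def)
      ultimately show "\<phi> a \<in> U" unfolding a using q e(4) by (simp add: U_def omega_level_def pos_upto_def)
    qed
  qed
  also have "card U = (\<Sum>q\<in>omega_level 1 (sqrt x). card (omega_level r (x / q)))"
    unfolding U_def by (intro card_SigmaI) auto
  finally show ?thesis .
qed

text \<open>The shift by 1, here and in \<open>loglog1\<close>, keeps both quantities at least 1 for
  all \<open>x \<ge> 1\<close>, so the bounds hold uniformly down to \<open>x = 1\<close>, as the
  induction over \<open>x / q\<close> demands.\<close>

definition log1 :: "real \<Rightarrow> real" where "log1 x = 1 + ln x"

definition loglog1 :: "real \<Rightarrow> real" where "loglog1 x = 1 + ln (log1 x)"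

lemma log1_ge_1: "x \<ge> 1 \<Longrightarrow> log1 x \<ge> 1" by (simp add: log1_def)

lemma loglog1_ge_1: "x \<ge> 1 \<Longrightarrow> loglog1 x \<ge> 1" using log1_ge_1[of x] by (simp add: loglog1_def)

lemma log1_mono: "1 \<le> x \<Longrightarrow> x \<le> y \<Longrightarrow> log1 x \<le> log1 y" by (simp add: log1_def)

lemma loglog1_mono: "1 \<le> x \<Longrightarrow> x \<le> y \<Longrightarrow> loglog1 x \<le> loglog1 y"
  using log1_ge_1[of x] log1_mono[of x y] by (simp add: loglog1_def)

text \<open>The reason for splitting at the square root: passing from \<open>x\<close> to
  \<open>x / q\<close> with \<open>q \<le> sqrt x\<close> costs only a factor 2 in the
  logarithm.\<close>

lemma log1_sqrt_le: "x \<ge> 1 \<Longrightarrow> sqrt x \<le> y \<Longrightarrow> log1 x \<le> 2 * log1 y"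
proof -
  assume x: "x \<ge> 1" "sqrt x \<le> y"
  hence "ln x = 2 * ln (sqrt x)" by (simp add: ln_sqrt)
  also have "ln (sqrt x) \<le> ln y" using x by (intro ln_mono) (auto intro: less_le_trans[of 0 "sqrt x"])
  finally show ?thesis by (simp add: log1_def)
qed

lemma dyadic_bracket:
  assumes "x \<ge> (1::real)"
  obtains j :: nat where "2 ^ j \<le> x" "x < 2 ^ Suc j" "log1 x \<le> 2 * real (Suc j)" "real j \<le> 2 * ln x"
proof -
  define j where "j = nat \<lfloor>log 2 x\<rfloor>"
  have l: "log 2 x \<ge> 0" using assms by simp
  have j: "real j \<le> log 2 x" "log 2 x < real (Suc j)" using l by (auto simp: j_def) linarith
  have "2 powr real j \<le> 2 powr log 2 x" using j by (intro powr_mono) auto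
  hence 1: "2 ^ j \<le> x" using assms by (simp add: powr_realpow)
  have "2 powr log 2 x < 2 powr real (Suc j)" using j by (intro powr_less_mono) auto
  hence 2: "x < 2 ^ Suc j" using assms by (simp add: powr_realpow del: of_nat_Suc power_Suc)
  have ln2: "1/2 \<le> ln (2::real)" "ln (2::real) \<le> 1" using ln_2_less_1 ln_le_minus_one[of "1/2::real"] by (auto simp: ln_div)
  have lnx: "ln x = log 2 x * ln 2" by (simp add: log_def)
  have "ln x \<le> real (Suc j) * 1" unfolding lnx using j ln2 l by (intro mult_mono) auto
  hence 3: "log1 x \<le> 2 * real (Suc j)" by (simp add: log1_def)
  have "real j * (1/2) \<le> log 2 x * ln 2" using j ln2 l by (intro mult_mono) auto
  hence "real j \<le> 2 * ln x" using lnx by simp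
  with 1 2 3 show ?thesis using that by blast
qed

lemma card_prime_powers_le:
  assumes "x \<ge> 1" shows "real (card (omega_level 1 x)) \<le> 80 * x / log1 x"
proof -
  obtain j where j: "2 ^ j \<le> x" "x < 2 ^ Suc j" "log1 x \<le> 2 * real (Suc j)" using dyadic_bracket[OF assms] by metis
  have "card (omega_level 1 x) \<le> card (omega_level 1 (2 ^ Suc j))"
    by (intro card_mono omega_level_mono) (use j in auto)
  hence "real (card (omega_level 1 x)) * log1 x \<le> real (card (omega_level 1 (2 ^ Suc j))) * (2 * real (Suc j))"
    using j log1_ge_1[OF assms] by (intro mult_mono) auto
  also have "\<dots> = 2 * real (Suc j * card (omega_level 1 (2 ^ Suc j)))" by (simp only: of_nat_mult mult_ac)
  also have "\<dots> \<le> 2 * real (20 * 2 ^ Suc j)"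
    using card_prime_powers_dyadic[of "Suc j"] by (intro mult_left_mono of_nat_mono) auto
  also have "\<dots> \<le> 80 * x" using j by simp
  finally show ?thesis using log1_ge_1[OF assms] by (simp add: field_simps)
qed

text \<open>A dyadic block of at most \<open>20 * 2 ^ Suc j / Suc j\<close> prime powers, each at
  least \<open>2 ^ j\<close>, contributes at most \<open>40 / Suc j\<close>; the harmonic sum over
  \<open>j\<close> up to \<open>2 * ln x\<close> gives the iterated logarithm.\<close>

lemma sum_recip_prime_powers_le:
  assumes "x \<ge> 1" shows "(\<Sum>q\<in>omega_level 1 x. 1 / real q) \<le> 40 * loglog1 x"
proof -
  obtain J where J: "2 ^ J \<le> x" "x < 2 ^ Suc J" "real J \<le> 2 * ln x" using dyadic_bracket[OF assms] by metis
  define B where "B = (\<lambda>j. {q \<in> omega_level 1 (2 ^ Suc j). 2 ^ j \<le> real q})"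
  have sub: "omega_level 1 x \<subseteq> (\<Union>j\<in>{1..J}. B j)"
  proof
    fix q assume q: "q \<in> omega_level 1 x"
    hence q1: "q > 0" "real q \<le> x" "prime_omega q = 1" by (auto simp: omega_level_def pos_upto_def)
    hence "q \<noteq> 1" by (auto simp: prime_omega_def)
    hence q2: "real q \<ge> 2" using q1 by simp
    then obtain j where j: "2 ^ j \<le> real q" "real q < 2 ^ Suc j" using dyadic_bracket[of "real q"] by auto
    \<comment> \<open>As 1 is not counted as a prime power, the block \<open>j = 0\<close> is empty
      and the harmonic sum starts at \<open>1/2\<close>, which fits
      \<open>sum_recip_le_ln\<close>.\<close>
    have "j \<noteq> 0" using j q2 by (intro notI) simp
    moreover have "(2::real) ^ j < 2 ^ Suc J" using j q1 J by linarith
    hence "j < Suc J" by (rule power_less_imp_less_exp[rotated]) simp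
    ultimately have "j \<in> {1..J}" by simp
    moreover have "q \<in> B j" using j q1 by (simp add: B_def omega_level_def pos_upto_def)
    ultimately show "q \<in> (\<Union>j\<in>{1..J}. B j)" by blast
  qed
  have "(\<Sum>q\<in>omega_level 1 x. 1 / real q) \<le> (\<Sum>q\<in>(\<Union>j\<in>{1..J}. B j). 1 / real q)"
    by (rule sum_mono2[OF _ sub]) (auto simp: B_def)
  also have "\<dots> \<le> (\<Sum>j\<in>{1..J}. \<Sum>q\<in>B j. 1 / real q)"
    by (rule sum_UNION_le) (auto simp: B_def)
  also have "\<dots> \<le> (\<Sum>j\<in>{1..J}. 40 * (1 / real (Suc j)))"
  proof (rule sum_mono)
    fix j
    have "(\<Sum>q\<in>B j. 1 / real q) \<le> (\<Sum>q\<in>B j. 1 / 2 ^ j)"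
      by (intro sum_mono) (auto simp: B_def intro!: divide_left_mono mult_pos_pos intro: less_le_trans[of 0 "2 ^ j"])
    also have "\<dots> = real (card (B j)) / 2 ^ j" by simp
    also have "\<dots> \<le> real (card (omega_level 1 (2 ^ Suc j))) / 2 ^ j"
      by (intro divide_right_mono of_nat_mono card_mono) (auto simp: B_def)
    also have "\<dots> \<le> 40 * (1 / real (Suc j))"
    proof -
      have "real (Suc j * card (omega_level 1 (2 ^ Suc j))) \<le> real (20 * 2 ^ Suc j)"
        using card_prime_powers_dyadic[of "Suc j"] by (rule of_nat_mono)
      thus ?thesis by (simp add: field_simps)
    qed
    finally show "(\<Sum>q\<in>B j. 1 / real q) \<le> 40 * (1 / real (Suc j))" .
  qed
  also have "\<dots> = 40 * (\<Sum>n\<in>{1<..Suc J}. 1 / real n)"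
    unfolding sum_distrib_left[symmetric]
    by (intro arg_cong[where f = "(*) 40"] sum.reindex_bij_witness[of _ "\<lambda>n. n - 1" Suc]) auto
  also have "\<dots> \<le> 40 * (ln (real (Suc J)) - ln (real 1))"
    by (intro mult_left_mono sum_recip_le_ln) auto
  also have "\<dots> \<le> 40 * loglog1 x"
  proof -
    have "real (Suc J) \<le> 2 * log1 x" using J by (simp add: log1_def)
    hence "ln (real (Suc J)) \<le> ln (2 * log1 x)" by (intro ln_mono) auto
    also have "\<dots> = ln 2 + ln (log1 x)" using log1_ge_1[OF assms] by (simp add: ln_mult)
    also have "\<dots> \<le> loglog1 x" using ln_2_less_1 by (simp add: loglog1_def)
    finally show ?thesis by simp
  qed
  finally show ?thesis .
qed

text \<open>The factor \<open>Suc r\<close> from \<open>omega_level_Suc_card_le\<close> is given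
  away, since for bounded \<open>r\<close> only a constant is at stake. Each induction step costs
  \<open>80 = 2 * 40\<close>: the halved logarithm and the reciprocal sum, which also supplies one
  more \<open>loglog1 x\<close>.\<close>

lemma card_omega_level_le:
  assumes "x \<ge> 1"
  shows "real (card (omega_level (Suc r) x)) \<le> 80 ^ Suc r * x * loglog1 x ^ r / log1 x"
  using assms
proof (induction r arbitrary: x)
  case 0
  thus ?case using card_prime_powers_le[of x] by simp
next
  case (Suc r)
  have l: "log1 x \<ge> 1" "loglog1 x \<ge> 1" using Suc.prems by (simp_all add: log1_ge_1 loglog1_ge_1)
  have sx: "1 \<le> sqrt x" "sqrt x \<le> x" using Suc.prems real_sqrt_le_iff[of x "x\<^sup>2"] by (auto simp: power2_eq_square)
  have "real (card (omega_level (Suc (Suc r)) x)) \<le> real (Suc r * card (omega_level (Suc (Suc r)) x))"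
    by simp
  also have "\<dots> \<le> real (\<Sum>q\<in>omega_level 1 (sqrt x). card (omega_level (Suc r) (x / q)))"
    by (intro of_nat_mono omega_level_Suc_card_le Suc.prems)
  also have "\<dots> = (\<Sum>q\<in>omega_level 1 (sqrt x). real (card (omega_level (Suc r) (x / q))))" by simp
  also have "\<dots> \<le> (\<Sum>q\<in>omega_level 1 (sqrt x). (80 ^ Suc r * x * loglog1 x ^ r * 2 / log1 x) * (1 / real q))"
  proof (rule sum_mono)
    fix q assume "q \<in> omega_level 1 (sqrt x)"
    hence q: "q > 0" "real q \<le> sqrt x" by (auto simp: omega_level_def pos_upto_def)
    have xq: "sqrt x \<le> x / real q"
    proof -
      have "sqrt x * real q \<le> sqrt x * sqrt x" using q sx by (intro mult_left_mono) auto
      thus ?thesis using q Suc.prems by (simp add: field_simps)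
    qed
    have xq1: "1 \<le> x / real q" using xq sx by linarith
    have "x / real q \<le> x / 1" using q Suc.prems by (intro divide_left_mono) auto
    hence "loglog1 (x / real q) \<le> loglog1 x" using loglog1_mono[OF xq1] by simp
    hence ll: "loglog1 (x / real q) ^ r \<le> loglog1 x ^ r" using loglog1_ge_1[OF xq1] by (intro power_mono) auto
    have lq: "log1 x / 2 \<le> log1 (x / real q)" using log1_sqrt_le[OF Suc.prems xq] by simp
    have "real (card (omega_level (Suc r) (x / q))) \<le> 80 ^ Suc r * (x / q) * loglog1 (x / q) ^ r / log1 (x / q)"
      by (rule Suc.IH[OF xq1])
    also have "\<dots> \<le> 80 ^ Suc r * (x / q) * loglog1 x ^ r / (log1 x / 2)"
      using l lq ll q Suc.prems by (intro frac_le mult_left_mono) auto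
    finally show "real (card (omega_level (Suc r) (x / q))) \<le> (80 ^ Suc r * x * loglog1 x ^ r * 2 / log1 x) * (1 / real q)"
      by (simp add: mult_ac)
  qed
  also have "\<dots> = (80 ^ Suc r * x * loglog1 x ^ r * 2 / log1 x) * (\<Sum>q\<in>omega_level 1 (sqrt x). 1 / real q)"
    by (simp add: sum_distrib_left)
  also have "\<dots> \<le> (80 ^ Suc r * x * loglog1 x ^ r * 2 / log1 x) * (40 * loglog1 x)"
    using sum_recip_prime_powers_le[OF sx(1)] loglog1_mono[OF sx] l Suc.prems by (intro mult_left_mono) auto
  also have "\<dots> = 80 ^ Suc (Suc r) * x * loglog1 x ^ Suc r / log1 x" by simp
  finally show ?case .
qed

section \<open>Cancellation in the partial sums of mu(n)/n\<close>

text \<open>Division by \<open>n\<close> shifts the argument of the Dirichlet series by 1. The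
  factor \<open>s\<close> from partial summation is exactly the one contained in
  \<open>zeta_reg (1 + s)\<close>, so no pole at 0 remains.\<close>

lemma moebius_recip_sum_laplace:
  assumes "Re s > 0"
  shows "laplace (\<lambda>u. of_real (moebius_recip_sum (exp u))) s = 1 / zeta_reg (1 + s)"
    and "zeta_reg (1 + s) \<noteq> 0"
proof -
  have s: "Re (1 + s) > 1" "s \<noteq> 0" using assms by auto
  let ?a = "\<lambda>n. complex_of_real (of_int (moebius_mu n) / real n)"
  have a: "?a n * npow s n = of_int (moebius_mu n) * npow (1 + s) n" for n
  proof (cases "n = 0")
    case False
    have "npow (1 + s) n * of_nat n = npow s n"
    proof -
      have "complex_of_nat n = exp (of_real (ln (real n)))" using False by (simp add: exp_of_real)
      thus ?thesis by (simp add: npow_def ring_distribs flip: exp_add)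
    qed
    thus ?thesis using False by (simp add: field_simps)
  qed auto
  have "(\<lambda>n. ?a n * npow s n) sums (s * laplace (\<lambda>u. \<Sum>n\<in>pos_upto (exp u). ?a n) s)"
    by (rule laplace_summatory) (use assms summable_norm_moebius_npow[OF s(1)] in \<open>simp_all only: a of_nat_0 div_by_0 of_real_0\<close>)
  also have "(\<lambda>u. \<Sum>n\<in>pos_upto (exp u). ?a n) = (\<lambda>u. of_real (moebius_recip_sum (exp u)))"
    by (simp only: moebius_recip_sum_def of_real_sum)
  finally have "s * laplace (\<lambda>u. of_real (moebius_recip_sum (exp u))) s = moebius_series (1 + s)"
    unfolding a using moebius_series_sums[OF s(1)] by (rule sums_unique2)
  moreover have *: "moebius_series (1 + s) * zeta_reg (1 + s) = s"
    using moebius_series_mult_zeta_reg[OF s(1)] by simp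
  ultimately have "s * (laplace (\<lambda>u. of_real (moebius_recip_sum (exp u))) s * zeta_reg (1 + s)) = s * 1"
    by (metis mult.assoc mult_1_right)
  hence "laplace (\<lambda>u. of_real (moebius_recip_sum (exp u))) s * zeta_reg (1 + s) = 1" using s(2) by simp
  moreover show "zeta_reg (1 + s) \<noteq> 0" using * s(2) by auto
  ultimately show "laplace (\<lambda>u. of_real (moebius_recip_sum (exp u))) s = 1 / zeta_reg (1 + s)"
    by (simp add: field_simps)
qed

text \<open>The sum of \<open>1 / n\<close> between the two cut-offs is at most a difference of
  logarithms plus its first term. That first term, a single jump, accounts for
  \<open>exp (- min u v)\<close>.\<close>

lemma moebius_recip_sum_lipschitz:
  assumes "0 \<le> u" "0 \<le> v"
  shows "\<bar>moebius_recip_sum (exp u) - moebius_recip_sum (exp v)\<bar> \<le> \<bar>u - v\<bar> + exp (- min u v)"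
proof -
  have main: "\<bar>moebius_recip_sum (exp v) - moebius_recip_sum (exp u)\<bar> \<le> (v - u) + exp (- u)" if uv: "0 \<le> u" "u \<le> v" for u v
  proof -
    define m M where "m = nat \<lfloor>exp u\<rfloor>" and "M = nat \<lfloor>exp v\<rfloor>"
    have e: "1 \<le> exp u" "exp u \<le> exp v" using uv by auto
    have mM: "m \<le> M" using e unfolding m_def M_def by (intro nat_mono floor_mono)
    have m1: "exp u < real (Suc m)" using e unfolding m_def by linarith
    have M1: "real M \<le> exp v" using e unfolding M_def by linarith
    have "moebius_recip_sum (exp v) - moebius_recip_sum (exp u) = (\<Sum>n\<in>{m<..M}. of_int (moebius_mu n) / n)"
    proof -
      have "{0<..M} = {0<..m} \<union> {m<..M}" using mM by auto
      thus ?thesis unfolding moebius_recip_sum_def pos_upto_eq m_def[symmetric] M_def[symmetric]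
        by (simp add: sum.union_disjoint)
    qed
    also have "\<bar>\<dots>\<bar> \<le> (\<Sum>n\<in>{m<..M}. 1 / real n)"
      by (intro order_trans[OF sum_abs] sum_mono) (auto simp: abs_divide abs_moebius_mu_le intro!: divide_right_mono)
    also have "\<dots> \<le> (v - u) + exp (- u)"
    proof (cases "m = M")
      case True thus ?thesis using uv by simp
    next
      case False
      hence "{m<..M} = insert (Suc m) {Suc m<..M}" using mM by auto
      hence "(\<Sum>n\<in>{m<..M}. 1 / real n) = 1 / real (Suc m) + (\<Sum>n\<in>{Suc m<..M}. 1 / real n)" by simp
      moreover have "1 / real (Suc m) + (\<Sum>n\<in>{Suc m<..M}. 1 / real n) \<le> exp (- u) + (ln (real M) - ln (real (Suc m)))"
      proof (intro add_mono sum_recip_le_ln)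
        show "1 / real (Suc m) \<le> exp (- u)" using m1 by (simp add: exp_minus field_simps)
      qed (use False mM in auto)
      moreover have "ln (real M) \<le> v"
      proof -
        have "0 < real M" using False mM by auto
        thus ?thesis using M1 by (metis ln_exp ln_le_cancel_iff exp_gt_zero)
      qed
      moreover have "u \<le> ln (real (Suc m))"
        using m1 by (metis exp_gt_zero less_imp_le ln_exp ln_le_cancel_iff order_less_trans)
      ultimately show ?thesis by linarith
    qed
    finally show ?thesis .
  qed
  show ?thesis
  proof (cases "u \<le> v")
    case True
    thus ?thesis using main[of u v] assms by (simp add: min_def abs_minus_commute)
  next
    case False
    thus ?thesis using main[of v u] assms by (simp add: min_def)
  qed
qed

theorem moebius_recip_sum_bound:
  "\<exists>D. \<forall>x\<ge>1. \<bar>moebius_recip_sum x\<bar> \<le> D / (1 + ln x)\<^sup>2"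
proof -
  define f where "f = (\<lambda>u. moebius_recip_sum (exp u))"
  have neg: "f u = 0" if "u < 0" for u
  proof -
    have "\<lfloor>exp u\<rfloor> = 0" using that by (simp add: floor_eq_iff)
    hence "pos_upto (exp u) = {}" by (simp add: pos_upto_eq)
    thus ?thesis by (simp add: f_def moebius_recip_sum_def)
  qed
  have bdd: "\<bar>f u\<bar> \<le> 1" for u unfolding f_def by (rule abs_moebius_recip_sum_le)
  have meas: "f \<in> borel_measurable borel"
  proof -
    have [measurable]: "(\<lambda>k::nat. \<Sum>n\<in>{0<..k}. real_of_int (moebius_mu n) / n) \<in> measurable (count_space UNIV) borel" by simp
    have "(\<lambda>u::real. (\<lambda>k::nat. \<Sum>n\<in>{0<..k}. real_of_int (moebius_mu n) / n) (nat \<lfloor>exp u\<rfloor>)) \<in> borel_measurable borel"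
      by measurable
    thus ?thesis by (simp add: f_def moebius_recip_sum_def pos_upto_eq)
  qed
  have caus: "causal (\<lambda>u. of_real (f u))"
    by (rule causal_bounded) (use neg bdd meas in auto)
  obtain c C where c: "c > 0" and C: "\<And>s. 0 < Re s \<Longrightarrow> Re s \<le> c \<Longrightarrow>
     norm ((deriv ^^ 8) (\<lambda>s. 1 / zeta_reg (1 + s)) s) \<le> C * (1 + \<bar>Im s\<bar>)\<^sup>2"
    using higher_deriv_recip_zeta_reg_bound by blast
  have "\<exists>D. \<forall>v\<ge>0. \<bar>f v\<bar> \<le> D / (1 + v)\<^sup>2"
  proof (rule laplace_tauberian[OF meas neg bdd _ c])
    show "\<bar>f u - f v\<bar> \<le> \<bar>u - v\<bar> + exp (- min u v)" if "u \<ge> 0" "v \<ge> 0" for u v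
      unfolding f_def using that by (rule moebius_recip_sum_lipschitz)
    fix s assume s: "0 < Re s" "Re s \<le> c"
    let ?H = "{s. Re s > 0}"
    have "laplace (\<lambda>u. (- of_real u) ^ 8 * of_real (f u)) s = (deriv ^^ 8) (laplace (\<lambda>u. of_real (f u))) s"
      by (rule higher_deriv_laplace[OF caus s(1), symmetric])
    also have "\<dots> = (deriv ^^ 8) (\<lambda>s. 1 / zeta_reg (1 + s)) s"
    proof (rule higher_deriv_transform_within_open[of _ ?H])
      show "laplace (\<lambda>u. of_real (f u)) holomorphic_on ?H" by (rule laplace_holomorphic[OF caus])
      thus "(\<lambda>s. 1 / zeta_reg (1 + s)) holomorphic_on ?H"
        by (rule holomorphic_transform) (simp add: f_def moebius_recip_sum_laplace)
      show "open ?H" by (rule open_halfspace_Re_gt)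
      show "laplace (\<lambda>u. of_real (f u)) w = 1 / zeta_reg (1 + w)" if "w \<in> ?H" for w
        using that by (simp add: f_def moebius_recip_sum_laplace)
    qed (use s in auto)
    finally show "norm (laplace (\<lambda>u. (- of_real u) ^ 8 * of_real (f u)) s) \<le> C * (1 + \<bar>Im s\<bar>)\<^sup>2"
      using C[OF s] by simp
  qed
  then obtain D where D: "\<And>v. v \<ge> 0 \<Longrightarrow> \<bar>f v\<bar> \<le> D / (1 + v)\<^sup>2" by blast
  have "\<bar>moebius_recip_sum x\<bar> \<le> D / (1 + ln x)\<^sup>2" if "x \<ge> 1" for x
    using D[of "ln x"] that by (simp add: f_def)
  thus ?thesis by blast
qed

section \<open>The main estimate\<close>

text \<open>For \<open>m = 1\<close> only the empty set occurs, contributing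
  \<open>0 ^ k = 0\<close> because \<open>k > 0\<close>. Otherwise, up to \<open>k\<close> prime
  factors leave at most \<open>2 ^ k\<close> sets with terms of size at most
  \<open>k ^ k\<close>.\<close>

lemma sum_divisors_moebius_omega_power:
  assumes "m > 0" "k > 0"
  shows "prime_omega m \<notin> {1..k} \<Longrightarrow> (\<Sum>d | d dvd m. of_int (moebius_mu d) * real (prime_omega d) ^ k) = 0"
    and "\<bar>\<Sum>d | d dvd m. of_int (moebius_mu d) * real (prime_omega d) ^ k\<bar> \<le> 2 ^ k * real k ^ k"
proof -
  let ?P = "prime_factors m"
  define h where "h = (\<Sum>d | d dvd m. of_int (moebius_mu d) * real (prime_omega d) ^ k)"
  have h: "h = (\<Sum>S\<in>Pow ?P. (-1) ^ card S * real (card S) ^ k)"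
    unfolding h_def using sum_divisors_moebius[OF assms(1), of "\<lambda>j. real j ^ k"] by simp
  have 0: "h = 0" if "prime_omega m \<notin> {1..k}"
  proof (cases "prime_omega m = 0")
    case True
    hence "?P = {}" by (simp add: prime_omega_def)
    thus ?thesis using assms unfolding h by simp
  next
    case False
    with that have "k < prime_omega m" by (simp add: Suc_le_eq)
    hence "k < card ?P" by (simp add: prime_omega_def)
    thus ?thesis unfolding h by (intro sum_Pow_alternating_power) auto
  qed
  thus "prime_omega m \<notin> {1..k} \<Longrightarrow> (\<Sum>d | d dvd m. of_int (moebius_mu d) * real (prime_omega d) ^ k) = 0"
    by (simp add: h_def)
  have "\<bar>h\<bar> \<le> 2 ^ k * real k ^ k"
  proof (cases "prime_omega m \<in> {1..k}")
    case True
    hence c: "card ?P \<le> k" by (simp add: prime_omega_def)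
    have "\<bar>h\<bar> \<le> (\<Sum>S\<in>Pow ?P. \<bar>(-1) ^ card S * real (card S) ^ k\<bar>)" unfolding h by (rule sum_abs)
    also have "\<dots> \<le> (\<Sum>S\<in>Pow ?P. real k ^ k)"
    proof (intro sum_mono)
      fix S assume "S \<in> Pow ?P"
      hence "card S \<le> k" using c card_mono[of ?P S] by auto
      thus "\<bar>(-1) ^ card S * real (card S) ^ k\<bar> \<le> real k ^ k"
        by (simp add: abs_mult power_abs power_mono)
    qed
    also have "\<dots> = 2 ^ card ?P * real k ^ k" by (simp add: card_Pow)
    also have "\<dots> \<le> 2 ^ k * real k ^ k" using c by (intro mult_right_mono power_increasing) auto
    finally show ?thesis .
  qed (simp add: 0)
  thus "\<bar>\<Sum>d | d dvd m. of_int (moebius_mu d) * real (prime_omega d) ^ k\<bar> \<le> 2 ^ k * real k ^ k"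
    by (simp add: h_def)
qed

definition omega_upto :: "nat \<Rightarrow> real \<Rightarrow> nat set" where
  "omega_upto k x = {m \<in> pos_upto x. prime_omega m \<in> {1..k}}"

lemma finite_omega_upto [simp]: "finite (omega_upto k x)" by (simp add: omega_upto_def)

lemma card_omega_upto_le:
  assumes "x \<ge> 1" "k > 0"
  shows "real (card (omega_upto k x)) \<le> real k * 80 ^ k * x * loglog1 x ^ (k - 1) / log1 x"
proof -
  have l: "log1 x \<ge> 1" "loglog1 x \<ge> 1" using assms by (simp_all add: log1_ge_1 loglog1_ge_1)
  have "omega_upto k x = (\<Union>r\<in>{..<k}. omega_level (Suc r) x)"
    by (auto simp: omega_upto_def omega_level_def Suc_le_eq) (metis Suc_le_lessD Suc_pred less_le_trans lessThan_iff zero_less_one neq0_conv)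
  hence "real (card (omega_upto k x)) \<le> real (\<Sum>r<k. card (omega_level (Suc r) x))"
    by (simp only: of_nat_le_iff) (rule card_UN_le, simp)
  also have "\<dots> = (\<Sum>r<k. real (card (omega_level (Suc r) x)))" by simp
  also have "\<dots> \<le> (\<Sum>r<k. 80 ^ k * x * loglog1 x ^ (k - 1) / log1 x)"
  proof (intro sum_mono order_trans[OF card_omega_level_le[OF assms(1)]] divide_right_mono mult_mono power_increasing)
  qed (use l assms in \<open>auto intro!: mult_nonneg_nonneg\<close>)
  finally show ?thesis by (simp add: mult_ac)
qed

text \<open>For \<open>m \<le> sqrt x\<close> the squared logarithm is of order
  \<open>(log1 x)\<^sup>2\<close>, which beats even the full harmonic sum. For larger
  \<open>m\<close> the range \<open>x / m\<close> near \<open>2 ^ i\<close> is bounded by the count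
  up to \<open>x / 2 ^ i\<close>; the factors \<open>2 ^ i\<close> cancel and
  \<open>1 / (i + 1) ^ 2\<close> is summable.\<close>

lemma sum_omega_upto_recip_log_square_le:
  assumes "k > 0"
  shows "\<exists>C\<ge>0. \<forall>x\<ge>1. (\<Sum>m\<in>omega_upto k x. x / real m / (log1 (x / real m))\<^sup>2) \<le> C * x * loglog1 x ^ (k - 1) / log1 x"
proof -
  define A where "A = real k * 80 ^ k"
  define Z where "Z = (\<Sum>n. 1 / real (Suc n) ^ 2)"
  have smZ: "summable (\<lambda>n. 1 / real (Suc n) ^ 2)" using sums_summable[OF inverse_squares_sums] by simp
  have Z: "Z \<ge> 0" unfolding Z_def by (rule suminf_nonneg[OF smZ]) auto
  have A: "A \<ge> 0" by (simp add: A_def)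
  have "(\<Sum>m\<in>omega_upto k x. x / real m / (log1 (x / real m))\<^sup>2) \<le> (4 + 16 * A * Z) * x * loglog1 x ^ (k - 1) / log1 x"
    if x: "x \<ge> 1" for x
  proof -
    define \<phi> where "\<phi> = (\<lambda>m. x / real m / (log1 (x / real m))\<^sup>2)"
    define L where "L = loglog1 x ^ (k - 1) / log1 x"
    have \<phi>0: "\<phi> m \<ge> 0" for m using x by (simp add: \<phi>_def)
    have l: "log1 x \<ge> 1" "loglog1 x \<ge> 1" using x by (simp_all add: log1_ge_1 loglog1_ge_1)
    have L: "L \<ge> 0" "1 / log1 x \<le> L" using l by (auto simp: L_def intro!: divide_right_mono one_le_power)
    have sx: "1 \<le> sqrt x" using x by simp
    have sxx: "sqrt x * sqrt x = x" using x by simp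
    define S1 where "S1 = pos_upto (sqrt x)"
    define S2 where "S2 = {m \<in> omega_upto k x. sqrt x < real m}"
    have "sum \<phi> (omega_upto k x) \<le> sum \<phi> (S1 \<union> S2)"
    proof (rule sum_mono2)
      show "finite (S1 \<union> S2)" by (simp add: S1_def S2_def)
      show "omega_upto k x \<subseteq> S1 \<union> S2" by (auto simp: S1_def S2_def omega_upto_def pos_upto_def)
    qed (rule \<phi>0)
    also have "\<dots> \<le> sum \<phi> S1 + sum \<phi> S2"
      using sum.union_inter[of S1 S2 \<phi>] sum_nonneg[of "S1 \<inter> S2" \<phi>] \<phi>0 by (simp add: S1_def S2_def)
    also have "sum \<phi> S1 \<le> 4 * x * L"
    proof -
      have "sum \<phi> S1 \<le> (\<Sum>m\<in>S1. 4 * x / (log1 x)\<^sup>2 * (1 / real m))"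
      proof (rule sum_mono)
        fix m assume "m \<in> S1"
        hence m: "m > 0" "real m \<le> sqrt x" by (auto simp: S1_def pos_upto_def)
        have "sqrt x * real m \<le> x" using mult_left_mono[OF m(2), of "sqrt x"] sxx x by simp
        hence "sqrt x \<le> x / real m" using m by (simp add: field_simps)
        from log1_sqrt_le[OF x this] have "log1 x / 2 \<le> log1 (x / real m)" by simp
        hence "(log1 x / 2)\<^sup>2 \<le> (log1 (x / real m))\<^sup>2" using l by (intro power_mono) auto
        hence "\<phi> m \<le> x / real m / (log1 x / 2)\<^sup>2" unfolding \<phi>_def using x l m by (intro frac_le) auto
        thus "\<phi> m \<le> 4 * x / (log1 x)\<^sup>2 * (1 / real m)" by (simp add: power_divide mult_ac)
      qed
      also have "\<dots> = 4 * x / (log1 x)\<^sup>2 * (\<Sum>m\<in>S1. 1 / real m)" by (simp add: sum_distrib_left)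
      also have "\<dots> \<le> 4 * x / (log1 x)\<^sup>2 * log1 x"
      proof (rule mult_left_mono)
        define N where "N = nat \<lfloor>sqrt x\<rfloor>"
        have N: "N \<ge> 1" "real N \<le> sqrt x" using sx by (simp_all add: N_def le_nat_iff le_floor_iff)
        have "S1 = insert 1 {1<..N}" using N by (auto simp: S1_def pos_upto_eq N_def[symmetric])
        hence "(\<Sum>m\<in>S1. 1 / real m) = 1 + (\<Sum>m\<in>{1<..N}. 1 / real m)" by simp
        also have "\<dots> \<le> 1 + (ln (real N) - ln (real 1))" using N by (intro add_left_mono sum_recip_le_ln) auto
        also have "ln (real N) \<le> ln x"
        proof (rule ln_mono)
          show "real N \<le> x" using N(2) sxx mult_left_mono[OF sx, of "sqrt x"] sx by simp
        qed (use N in auto)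
        finally show "(\<Sum>m\<in>S1. 1 / real m) \<le> log1 x" by (simp add: log1_def)
      qed (use x in auto)
      also have "\<dots> = 4 * x * (1 / log1 x)" using l by (simp add: power2_eq_square)
      also have "\<dots> \<le> 4 * x * L" using L x by (intro mult_left_mono) auto
      finally show ?thesis .
    qed
    also have "sum \<phi> S2 \<le> 16 * A * Z * x * L"
    proof -
      \<comment> \<open>The quotients \<open>x / m\<close> with \<open>m > sqrt x\<close> lie below
        \<open>sqrt x\<close>, so only these \<open>i\<close> occur. Conversely they satisfy
        \<open>sqrt x \<le> x / 2 ^ i\<close>, which keeps the logarithm in the counting bound
        comparable to \<open>log1 x\<close>.\<close>
      define I where "I = {i::nat. 2 ^ i \<le> sqrt x}"
      have finI: "finite I"
      proof (rule finite_subset)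
        show "I \<subseteq> {..nat \<lfloor>sqrt x\<rfloor>}"
        proof
          fix i assume "i \<in> I"
          hence "2 ^ i \<le> sqrt x" by (simp add: I_def)
          moreover have "real i < 2 ^ i" by (rule of_nat_less_two_power)
          ultimately have "real i \<le> sqrt x" by linarith
          thus "i \<in> {..nat \<lfloor>sqrt x\<rfloor>}" by (simp add: le_nat_floor)
        qed
      qed simp
      define B where "B = (\<lambda>i. {m \<in> omega_upto k (x / 2 ^ i). x / real m \<le> 2 ^ Suc i \<and> real (Suc i) / 2 \<le> log1 (x / real m)})"
      have "S2 \<subseteq> (\<Union>i\<in>I. B i)"
      proof
        fix m assume "m \<in> S2"
        hence m: "m > 0" "real m \<le> x" "sqrt x < real m" "prime_omega m \<in> {1..k}"
          by (auto simp: S2_def omega_upto_def pos_upto_def)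
        have "1 \<le> x / real m" using m by simp
        then obtain i where i: "2 ^ i \<le> x / real m" "x / real m < 2 ^ Suc i" "real i \<le> 2 * ln (x / real m)"
          using dyadic_bracket by metis
        have "x / real m \<le> sqrt x"
        proof -
          have "sqrt x * sqrt x \<le> sqrt x * real m" using m x by (intro mult_left_mono) auto
          thus ?thesis using m sxx by (simp add: field_simps)
        qed
        hence "i \<in> I" using i by (simp add: I_def)
        moreover have "real m \<le> x / 2 ^ i" using i(1) m by (simp add: field_simps)
        hence "m \<in> B i" using i m by (simp add: B_def omega_upto_def pos_upto_def log1_def)
        ultimately show "m \<in> (\<Union>i\<in>I. B i)" by blast
      qed
      hence "sum \<phi> S2 \<le> sum \<phi> (\<Union>i\<in>I. B i)"
        by (intro sum_mono2) (use finI \<phi>0 in \<open>auto simp: B_def\<close>)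
      also have "\<dots> \<le> (\<Sum>i\<in>I. sum \<phi> (B i))"
        by (rule sum_UNION_le) (use finI \<phi>0 in \<open>auto simp: B_def\<close>)
      also have "\<dots> \<le> (\<Sum>i\<in>I. 16 * A * x * L * (1 / real (Suc i) ^ 2))"
      proof (rule sum_mono)
        fix i assume i: "i \<in> I"
        define y where "y = x / 2 ^ i"
        have "sqrt x * 2 ^ i \<le> x" using i mult_left_mono[of "2 ^ i" "sqrt x" "sqrt x"] sxx x by (simp add: I_def)
        hence ysx: "sqrt x \<le> y" by (simp add: y_def field_simps)
        hence y1: "y \<ge> 1" using sx by linarith
        have "x / 2 ^ i \<le> x / 1" using x by (intro divide_left_mono) auto
        hence yx: "y \<le> x" by (simp add: y_def)
        have ly: "log1 x / 2 \<le> log1 y" using log1_sqrt_le[OF x ysx] by simp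
        have lly: "loglog1 y ^ (k - 1) \<le> loglog1 x ^ (k - 1)"
          using loglog1_mono[OF y1 yx] loglog1_ge_1[OF y1] by (intro power_mono) auto
        have "sum \<phi> (B i) \<le> (\<Sum>m\<in>B i. 2 ^ Suc i / (real (Suc i) / 2)\<^sup>2)"
        proof (rule sum_mono)
          fix m assume "m \<in> B i"
          hence m: "x / real m \<le> 2 ^ Suc i" "real (Suc i) / 2 \<le> log1 (x / real m)" by (auto simp: B_def)
          have "(real (Suc i) / 2)\<^sup>2 \<le> (log1 (x / real m))\<^sup>2" using m by (intro power_mono) auto
          thus "\<phi> m \<le> 2 ^ Suc i / (real (Suc i) / 2)\<^sup>2" unfolding \<phi>_def using m by (intro frac_le) auto
        qed
        also have "\<dots> = real (card (B i)) * (2 ^ Suc i / (real (Suc i) / 2)\<^sup>2)" by simp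
        also have "\<dots> \<le> (A * y * loglog1 x ^ (k - 1) / (log1 x / 2)) * (2 ^ Suc i / (real (Suc i) / 2)\<^sup>2)"
        proof (rule mult_right_mono)
          have "real (card (B i)) \<le> real (card (omega_upto k y))"
            by (intro of_nat_mono card_mono) (auto simp: B_def y_def)
          also have "\<dots> \<le> A * y * loglog1 y ^ (k - 1) / log1 y"
            unfolding A_def by (rule card_omega_upto_le[OF y1 assms])
          also have "\<dots> \<le> A * y * loglog1 x ^ (k - 1) / (log1 x / 2)"
            using A y1 l ly lly by (intro frac_le mult_left_mono) auto
          finally show "real (card (B i)) \<le> A * y * loglog1 x ^ (k - 1) / (log1 x / 2)" .
        qed auto
        \<comment> \<open>Here \<open>16 = 2 * 2 * 4\<close>: the halved \<open>log1 x\<close>,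
          \<open>2 ^ Suc i\<close> against \<open>2 ^ i\<close>, and the square of
          \<open>real (Suc i) / 2\<close>.\<close>
        also have "\<dots> = 16 * A * x * L * (1 / real (Suc i) ^ 2)"
          by (simp add: y_def L_def power_divide del: of_nat_Suc)
        finally show "sum \<phi> (B i) \<le> 16 * A * x * L * (1 / real (Suc i) ^ 2)" .
      qed
      also have "\<dots> = 16 * A * x * L * (\<Sum>i\<in>I. 1 / real (Suc i) ^ 2)" by (simp add: sum_distrib_left)
      also have "\<dots> \<le> 16 * A * x * L * Z"
        unfolding Z_def by (intro mult_left_mono sum_le_suminf smZ finI) (use A x L in auto)
      finally show ?thesis by (simp add: mult_ac)
    qed
    also have "4 * x * L + 16 * A * Z * x * L = (4 + 16 * A * Z) * x * loglog1 x ^ (k - 1) / log1 x"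
      by (simp add: L_def algebra_simps add_divide_distrib)
    finally show ?thesis by (simp add: \<phi>_def)
  qed
  moreover have "4 + 16 * A * Z \<ge> 0" using A Z by simp
  ultimately show ?thesis by blast
qed

lemma moebius_omega_frac_sum_bound:
  assumes "k > 0"
  shows "\<exists>C\<ge>0. \<forall>x\<ge>1. \<bar>\<Sum>n\<in>pos_upto x. of_int (moebius_mu n) * real (prime_omega n) ^ k * frac (x / real n)\<bar>
           \<le> C * x * loglog1 x ^ (k - 1) / log1 x"
proof -
  obtain D where D: "\<And>x. x \<ge> 1 \<Longrightarrow> \<bar>moebius_recip_sum x\<bar> \<le> D / (log1 x)\<^sup>2"
    using moebius_recip_sum_bound by (auto simp: log1_def)
  have D0: "D \<ge> 0" using order_trans[OF abs_ge_zero D[of 1]] by (simp add: log1_def)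
  obtain C1 where C1: "C1 \<ge> 0" "\<And>x. x \<ge> 1 \<Longrightarrow>
      (\<Sum>m\<in>omega_upto k x. x / real m / (log1 (x / real m))\<^sup>2) \<le> C1 * x * loglog1 x ^ (k - 1) / log1 x"
    using sum_omega_upto_recip_log_square_le[OF assms] by blast
  define A where "A = real k * 80 ^ k"
  define B where "B = 2 ^ k * real k ^ k"
  define h where "h = (\<lambda>m. \<Sum>d | d dvd m. of_int (moebius_mu d) * real (prime_omega d) ^ k)"
  have "\<bar>\<Sum>n\<in>pos_upto x. of_int (moebius_mu n) * real (prime_omega n) ^ k * frac (x / real n)\<bar>
           \<le> (B * (D * C1 + A)) * x * loglog1 x ^ (k - 1) / log1 x" if x: "x \<ge> 1" for x
  proof -
    have "(\<Sum>n\<in>pos_upto x. of_int (moebius_mu n) * real (prime_omega n) ^ k * frac (x / real n)) =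
        (\<Sum>m\<in>pos_upto x. h m * (x / m * moebius_recip_sum (x / m) - 1))"
      unfolding h_def by (rule sum_frac_eq[OF x])
    \<comment> \<open>Few \<open>m\<close> remain, so the subtracted 1 costs just the cardinality of
      \<open>omega_upto k x\<close>, which already has the target order.\<close>
    also have "\<dots> = (\<Sum>m\<in>omega_upto k x. h m * (x / m * moebius_recip_sum (x / m) - 1))"
      by (rule sum.mono_neutral_right)
         (auto simp: omega_upto_def h_def pos_upto_def[of x] intro!: sum_divisors_moebius_omega_power(1) assms finite_pos_upto[unfolded pos_upto_def])
    also have "\<bar>\<dots>\<bar> \<le> (\<Sum>m\<in>omega_upto k x. B * (D * (x / real m / (log1 (x / real m))\<^sup>2) + 1))"
    proof (intro order_trans[OF sum_abs] sum_mono)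
      fix m assume "m \<in> omega_upto k x"
      hence m: "m > 0" "real m \<le> x" by (auto simp: omega_upto_def pos_upto_def)
      have "\<bar>x / m * moebius_recip_sum (x / m) - 1\<bar> \<le> x / m * \<bar>moebius_recip_sum (x / m)\<bar> + 1"
        using abs_triangle_ineq4[of "x / m * moebius_recip_sum (x / m)" 1] x by (simp add: abs_mult)
      also have "x / m * \<bar>moebius_recip_sum (x / m)\<bar> \<le> x / m * (D / (log1 (x / m))\<^sup>2)"
        using D[of "x / m"] m x by (intro mult_left_mono) auto
      finally have "\<bar>x / m * moebius_recip_sum (x / m) - 1\<bar> \<le> D * (x / real m / (log1 (x / real m))\<^sup>2) + 1"
        by (simp add: mult_ac)
      moreover have "\<bar>h m\<bar> \<le> B"
        unfolding h_def B_def by (rule sum_divisors_moebius_omega_power(2)[OF m(1) assms])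
      ultimately show "\<bar>h m * (x / m * moebius_recip_sum (x / m) - 1)\<bar> \<le> B * (D * (x / real m / (log1 (x / real m))\<^sup>2) + 1)"
        unfolding abs_mult by (intro mult_mono) (auto simp: B_def)
    qed
    also have "\<dots> = B * (D * (\<Sum>m\<in>omega_upto k x. x / real m / (log1 (x / real m))\<^sup>2) + real (card (omega_upto k x)))"
      unfolding sum_distrib_left[symmetric] sum.distrib by simp
    also have "\<dots> \<le> B * (D * (C1 * x * loglog1 x ^ (k - 1) / log1 x) + A * x * loglog1 x ^ (k - 1) / log1 x)"
      using C1(2)[OF x] card_omega_upto_le[OF x assms] D0 unfolding A_def
      by (intro mult_left_mono add_mono) (auto simp: B_def)
    also have "\<dots> = (B * (D * C1 + A)) * x * loglog1 x ^ (k - 1) / log1 x"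
      by (simp add: algebra_simps add_divide_distrib)
    finally show ?thesis .
  qed
  moreover have "B * (D * C1 + A) \<ge> 0" using D0 C1 by (simp add: A_def B_def)
  ultimately show ?thesis by blast
qed

theorem theorem2:
  fixes k :: nat
  assumes "k \<ge> 3"
  shows "(\<lambda>x::real. \<Sum>n | 0 < n \<and> real n \<le> x.
             real_of_int (moebius_mu n) * real (prime_omega n) ^ k * frac (x / real n))
         \<in> O[at_top](\<lambda>x. x * (ln (ln x)) powr ((2 * real k - 1) / 2) / ln x)"
proof -
  obtain C where C: "C \<ge> 0" and bound: "\<And>x. x \<ge> 1 \<Longrightarrow>
      \<bar>\<Sum>n\<in>pos_upto x. of_int (moebius_mu n) * real (prime_omega n) ^ k * frac (x / real n)\<bar>
       \<le> C * x * loglog1 x ^ (k - 1) / log1 x"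
    using moebius_omega_frac_sum_bound[of k] assms by auto
  show ?thesis
  proof (rule bigoI)
    show "eventually (\<lambda>x. norm (\<Sum>n | 0 < n \<and> real n \<le> x.
             real_of_int (moebius_mu n) * real (prime_omega n) ^ k * frac (x / real n))
        \<le> C * 3 ^ (k - 1) * norm (x * (ln (ln x)) powr ((2 * real k - 1) / 2) / ln x)) at_top"
      using eventually_ge_at_top[of "exp (exp 1)"]
    proof eventually_elim
      case (elim x)
      have e: "exp 1 \<ge> (1::real)" "exp (exp 1) \<ge> (1::real)" by simp_all
      have x: "x \<ge> 1" using elim e by linarith
      have "1 < exp (exp (1 :: real))" by simp
      hence x1: "x > 1" using elim by linarith
      have lx: "ln x \<ge> exp 1" using elim x by (simp add: ln_ge_iff)
      hence lx1: "ln x \<ge> 1" using e by linarith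
      \<comment> \<open>The threshold \<open>exp (exp 1)\<close> is chosen for this: powers of
        \<open>ln (ln x)\<close> now increase with the exponent, and additive constants are absorbed
        into the factor 3.\<close>
      have llx: "ln (ln x) \<ge> 1" using lx lx1 by (simp add: ln_ge_iff)
      have "ln (1 + ln x) \<le> ln (2 * ln x)" using lx1 by (intro ln_mono) auto
      also have "\<dots> \<le> 1 + ln (ln x)" using lx1 ln_2_less_1 by (simp add: ln_mult)
      finally have "loglog1 x \<le> 3 * ln (ln x)" using llx by (simp add: loglog1_def log1_def)
      hence "loglog1 x ^ (k - 1) \<le> (3 * ln (ln x)) ^ (k - 1)" using loglog1_ge_1[OF x] by (intro power_mono) auto
      also have "\<dots> = 3 ^ (k - 1) * ln (ln x) powr real (k - 1)"
        using llx by (simp add: power_mult_distrib powr_realpow)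
      \<comment> \<open>The exponent is raised from \<open>k - 1\<close> to \<open>k - 1/2\<close>,
        giving away half a power of \<open>ln (ln x)\<close>.\<close>
      also have "\<dots> \<le> 3 ^ (k - 1) * ln (ln x) powr ((2 * real k - 1) / 2)"
        using llx assms by (intro mult_left_mono powr_mono) (auto simp: of_nat_diff)
      finally have ll: "loglog1 x ^ (k - 1) \<le> 3 ^ (k - 1) * ln (ln x) powr ((2 * real k - 1) / 2)" .
      have "\<bar>\<Sum>n\<in>pos_upto x. of_int (moebius_mu n) * real (prime_omega n) ^ k * frac (x / real n)\<bar>
          \<le> C * x * loglog1 x ^ (k - 1) / log1 x" by (rule bound[OF x])
      also have "\<dots> \<le> C * x * (3 ^ (k - 1) * ln (ln x) powr ((2 * real k - 1) / 2)) / ln x"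
        using C x x1 lx1 ll by (intro frac_le mult_left_mono) (auto simp: log1_def)
      also have "\<dots> = C * 3 ^ (k - 1) * norm (x * (ln (ln x)) powr ((2 * real k - 1) / 2) / ln x)"
        using x lx1 by (simp add: abs_mult)
      finally show ?case by (simp add: pos_upto_def)
    qed
  qed
qed

end
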